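(* Let $d>1$ be an integer, let $T=[0,2\pi)$ and let $T^d=[0,2\pi)^d$ be the $d$-dimensional torus. a) If $\Lambda=\{\lambda_n\}_{n=1}^\infty$ with $$\lambda_n=\frac{n}{\log^{d-1}(n+1)},\qquad n=1,2,\ldots,$$ then the class $\Lambda^{\#}BV(T^d)$ is a class of convergence on $T^d$. b) If $\Lambda=\{\lambda_n\}_{n=1}^\infty$ with $$\lambda_n=\frac{n\,\xi_n}{\log^{d-1}(n+1)},\qquad n=1,2,\ldots,$$ where $\{\xi_n\}$ is a sequence of positive numbers with $\xi_n\to\infty$ as $n\to\infty$, then there exists a continuous function $f\in\Lambda^{\#}BV(T^d)$ (continuous and $2\pi$-periodic in each variable) such that the cubical partial sums of the $d$-dimensional Fourier series of $f$ diverge unboundedly at $(0,\ldots,0)$, i.e. $\sup_N|S_{N,\ldots,N}f(0,\ldots,0)|=\infty$.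
   Context: Functions on $T^d=[0,2\pi)^d$ are identified with their extensions to $\mathbb R^d$ that are $2\pi$-periodic in each variable; limits and continuity refer to this periodic extension. **Class $\Lambda^{\#}BV$.** Let $\Lambda=\{\lambda_n\}_{n\ge1}$ be a sequence of positive numbers. For $s\in\{1,\ldots,d\}$, an interval $I=(a,b)$ with endpoints $a<b$ in $T$, and $y=(y_1,\ldots,y_{s-1},y_{s+1},\ldots,y_d)\in T^{d-1}$, put $f(I^s,y):=f(y_1,\ldots,y_{s-1},b,y_{s+1},\ldots,y_d)-f(y_1,\ldots,y_{s-1},a,y_{s+1},\ldots,y_d)$ with $I^s=I$ (difference in the $s$-th variable, the others fixed at $y$). Define $$\Lambda^{\#}V_s(f,T^d):=\sup_{\{y^i\}\subset T^{d-1}}\ \sup_{\{I_i\}}\ \sum_i\frac{|f(I_i^s,y^i)|}{\lambda_i},$$ where $\{I_i\}$ runs over all collections of nonoverlapping intervals in $T$, indexed in arbitrary order, and each $I_i$ may be paired with its own $y^i\in T^{d-1}$. Then $f\in\Lambda^{\#}BV(T^d)$ means $\Lambda^{\#}V(f,T^d):=\sum_{s=1}^d\Lambda^{\#}V_s(f,T^d)<\infty$. **Fourier series.** For $f\in L^1(T^d)$, $\widehat f(n_1,\ldots,n_d)=(2\pi)^{-d}\int_{T^d}f(x)e^{-i(n_1x_1+\cdots+n_dx_d)}\,dx$, and the rectangular partial sums are $$S_{N_1,\ldots,N_d}f(x)=\sum_{n_1=-N_1}^{N_1}\cdots\sum_{n_d=-N_d}^{N_d}\widehat f(n_1,\ldots,n_d)e^{i(n_1x_1+\cdots+n_dx_d)}.$$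 Cubical partial sums are those with $N_1=\cdots=N_d=N$. Convergence of the Fourier series means convergence of the rectangular partial sums in the sense of Pringsheim, i.e. as $N_1,\ldots,N_d\to\infty$ independently ($\min_i N_i\to\infty$). **Regular points.** Let $\Delta=\{\delta=(\delta_1,\ldots,\delta_d):\delta_i=\pm1\}$. For $x\in\mathbb R^d$ and $\delta\in\Delta$, let $\pi_\delta(x)$ be the product over $i$ of the open intervals with endpoints $x_i$ and $x_i+\delta_i$, and let $f_\delta(x):=\lim_{t\in\pi_\delta(x),\,t\to x}f(t)$ if this (finite) limit exists. The point $x$ is a regular point of $f$ if $f_\delta(x)$ exists for every $\delta\in\Delta$; then $f^*(x):=2^{-d}\sum_{\delta\in\Delta}f_\delta(x)$. **Class of convergence.** A class of functions $V\subset L^1(T^d)$ is a class of convergence on $T^d$ if for every $f\in V$: (1) the Fourier series of $f$ converges to $f^*(x)$ at every regular point $x\in T^d$; (2) the convergence is uniform on a compact set $K\subset T^d$ whenever $f$ is continuous on $K$, meaning continuous at every point of $K$ as a function on the torus. *)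

theory Defs
  imports "HOL-Analysis.Analysis"
begin

definition torus_cube :: "(real ^ 'n) set" where
  "torus_cube = {x. \<forall>i. x $ i \<in> {0..<2 * pi}}"

text \<open>A function on the torus is represented by its extension to the whole space, which is
  \<open>2\<pi>\<close>-periodic in each variable.\<close>

definition torus_periodic :: "(real ^ 'n \<Rightarrow> 'a) \<Rightarrow> bool" where
  "torus_periodic f \<longleftrightarrow> (\<forall>x i. f (x + axis i (2 * pi)) = f x)"

definition L1_torus :: "(real ^ 'n \<Rightarrow> complex) set" where
  "L1_torus = {f. torus_periodic f \<and> set_integrable lebesgue torus_cube f}"


subsection \<open>The class \<open>\<Lambda>\<^sup>#BV\<close>\<close>

text \<open>A point of \<open>T\<^sup>d\<^sup>-\<^sup>1\<close> is given by a point \<open>y\<close> of \<open>T\<^sup>d\<close> whose coordinate \<open>s\<close> is overwritten.\<close>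

definition coord_increment ::
    "(real ^ 'n \<Rightarrow> complex) \<Rightarrow> 'n \<Rightarrow> real \<Rightarrow> real \<Rightarrow> real ^ 'n \<Rightarrow> complex" where
  "coord_increment f s a b y =
     f (\<chi> j. if j = s then b else y $ j) - f (\<chi> j. if j = s then a else y $ j)"

text \<open>The supremum is over finite indexed families of intervals. Infinite families would not
  change it: the terms are nonnegative and initial segments of a family are again families.
  Only the values \<open>L 1, L 2, \<dots>\<close> matter.\<close>

definition sharp_variation_in ::
    "(nat \<Rightarrow> real) \<Rightarrow> 'n \<Rightarrow> (real ^ 'n \<Rightarrow> complex) \<Rightarrow> ennreal" where
  "sharp_variation_in L s f =
     (SUP (m, a, b, y) \<in> {(m :: nat, a :: nat \<Rightarrow> real, b :: nat \<Rightarrow> real, y :: nat \<Rightarrow> real ^ 'n).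
            (\<forall>i\<in>{1..m}. 0 \<le> a i \<and> a i < b i \<and> b i < 2 * pi \<and> y i \<in> torus_cube) \<and>
            disjoint_family_on (\<lambda>i. {a i<..<b i}) {1..m}}.
        \<Sum>i = 1..m. ennreal (norm (coord_increment f s (a i) (b i) (y i)) / L i))"

definition sharp_variation :: "(nat \<Rightarrow> real) \<Rightarrow> (real ^ 'n \<Rightarrow> complex) \<Rightarrow> ennreal" where
  "sharp_variation L f = (\<Sum>s\<in>UNIV. sharp_variation_in L s f)"

definition sharp_BV :: "(nat \<Rightarrow> real) \<Rightarrow> (real ^ 'n \<Rightarrow> complex) set" where
  "sharp_BV L = {f. torus_periodic f \<and> sharp_variation L f < \<infinity>}"


subsection \<open>Multiple Fourier series\<close>

definition fourier_coeff :: "(real ^ 'n \<Rightarrow> complex) \<Rightarrow> ('n \<Rightarrow> int) \<Rightarrow> complex" where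
  "fourier_coeff f n =
     (LINT x:torus_cube|lebesgue. f x * exp (- \<i> * of_real (\<Sum>j\<in>UNIV. of_int (n j) * x $ j)))
       / of_real ((2 * pi) ^ CARD('n))"

definition fourier_partial_sum ::
    "('n \<Rightarrow> nat) \<Rightarrow> (real ^ 'n \<Rightarrow> complex) \<Rightarrow> real ^ 'n \<Rightarrow> complex" where
  "fourier_partial_sum N f x =
     (\<Sum>n \<in> (\<Pi>\<^sub>E j\<in>UNIV. {- int (N j)..int (N j)}).
        fourier_coeff f n * exp (\<i> * of_real (\<Sum>j\<in>UNIV. of_int (n j) * x $ j)))"

text \<open>Convergence in the sense of Pringsheim: the minimum of the \<open>N j\<close> tends to infinity.\<close>

definition pringsheim :: "('n::finite \<Rightarrow> nat) filter" where
  "pringsheim = filtercomap (\<lambda>N. Min (range N)) at_top"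


subsection \<open>Regular points\<close>

definition sign_vectors :: "('n \<Rightarrow> real) set" where
  "sign_vectors = {\<delta>. \<forall>i. \<delta> i \<in> {-1, 1}}"

definition octant_box :: "('n \<Rightarrow> real) \<Rightarrow> real ^ 'n \<Rightarrow> (real ^ 'n) set" where
  "octant_box \<delta> x = {t. \<forall>i. t $ i \<in> open_segment (x $ i) (x $ i + \<delta> i)}"

definition regular_point :: "(real ^ 'n \<Rightarrow> complex) \<Rightarrow> real ^ 'n \<Rightarrow> bool" where
  "regular_point f x \<longleftrightarrow>
     (\<forall>\<delta>\<in>sign_vectors. \<exists>l. (f \<longlongrightarrow> l) (at x within octant_box \<delta> x))"

definition octant_mean :: "(real ^ 'n \<Rightarrow> complex) \<Rightarrow> real ^ 'n \<Rightarrow> complex" where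
  "octant_mean f x = (\<Sum>\<delta>\<in>sign_vectors. Lim (at x within octant_box \<delta> x) f) / 2 ^ CARD('n)"


subsection \<open>Classes of convergence\<close>

text \<open>The compact subsets of the torus are exactly the images of the compact subsets \<open>K\<close> of the
  whole space. All functions involved are periodic, so the condition below depends only on the
  image of \<open>K\<close>. Restricting to \<open>K \<subseteq> torus_cube\<close> would lose, for instance, the whole torus.\<close>

definition class_of_convergence :: "(real ^ 'n \<Rightarrow> complex) set \<Rightarrow> bool" where
  "class_of_convergence V \<longleftrightarrow>
     V \<subseteq> L1_torus \<and>
     (\<forall>f\<in>V.
        (\<forall>x\<in>torus_cube. regular_point f x \<longrightarrow>
           ((\<lambda>N. fourier_partial_sum N f x) \<longlongrightarrow> octant_mean f x) pringsheim) \<and>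
        (\<forall>K. compact K \<and> (\<forall>x\<in>K. isCont f x) \<longrightarrow>
           uniform_limit K (\<lambda>N. fourier_partial_sum N f) (octant_mean f) pringsheim))"

end

(* Part a).  Fix a coordinate s and let rho(a,b) be the supremum over the remaining coordinates of
   |f(I^s,y)| for I = (a,b).  The definition of the variation says precisely that the sums of
   rho(a_i,b_i) log^(d-1)(i+1)/i over nonoverlapping intervals are bounded, and Waterman's
   concatenation argument makes these sums small, uniformly, for families that lie in a short
   interval and carry large indices.  Write S_N f(x) - f*(x) as a sum over octants of integrals of
   f(x+u) - f_delta(x) against products of Dirichlet kernels, and cut the j-th axis into
   periods of sin((N_j+1/2)u).  On the k-th such interval the kernel has L1 norm O(1/k) and
   mean O(1/k^2).  In a product cell one isolates the coordinate s with the largest index k; the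
   others contribute log^(d-1) k after summation, the s-th one contributes rho/k plus O(1/k^2), and
   so the sum over k is again a sum of rho with the weights log^(d-1)(k+1)/k.

   Part b).  |sin(t/2)| D_N(t) is bounded by 1 and Lipschitz with constant O(N), while its N-th
   partial sum at 0 is at least (log N)/pi.  Divide the d-fold product of such blocks by
   log^(d-1)(N+1) times the sum of 1/(i xi_i) over i <= N: the variations stay bounded, whereas the
   cubical sums at 0 tend to infinity along a subsequence because xi_i does.  A gliding hump
   combines the blocks into one function. *)
theory Submission
  imports Defs "HOL-Real_Asymp.Real_Asymp"
begin

section \<open>Logarithmic weights\<close>

text \<open>The class constrains increments only, so boundedness and Borel measurability of f have
  to be extracted from the variation before any Fourier integral can be handled. That each interval
  carries its own y is what allows the supremum over y inside the sum, and all later estimates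
  become uniform in the remaining coordinates. Waterman's smallness concerns short intervals,
  whereas the cells reach up to pi. Away from 0 it is replaced by averaging over reindexings: the
  oscillations over the cells of one axis sum to O(N / log^d N), each weight there is O(log^(d-1) N
  / N), and 1 / log N remains. Cells whose indices are all below M gain nothing from the variation;
  they are small because f is close to its octant limit. Hence M is fixed first and the closeness
  afterwards. In part b) the normaliser is read off from the variation of a block: the first N
  indices contribute log^(d-1)(N+1) times the sum of 1/(i \<xi>_i), the later ones are controlled by
  the Lipschitz bound and the total length 2 pi. Of the d logarithms of the partial sum, one
  survives.\<close>

definition log_weight :: "nat \<Rightarrow> nat \<Rightarrow> real" where
  "log_weight p n = ln (real n + 1) ^ p / real n"

lemma log_weight_nonneg: "0 \<le> log_weight p n"
  by (simp add: log_weight_def)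

lemma log_weight_pos: "n \<ge> 1 \<Longrightarrow> 0 < log_weight p n"
  by (simp add: log_weight_def)

lemma log_weight_tendsto_0: "log_weight p \<longlonglongrightarrow> 0"
  unfolding log_weight_def by real_asymp

text \<open>Discrete counterpart of the integral of ln^p t / t: a step of ln^(p+1) is at most p + 1
  times the larger value of ln^p times the step of ln, and the latter is at most 1/(n+1). It turns
  the divergence of the sum of the weights into a rate.\<close>

lemma ln_power_le_sum_log_weight:
  "ln (real n + 1) ^ Suc p \<le> real (Suc p) * (\<Sum>i=1..n. log_weight p i)"
proof (induction n)
  case (Suc n)
  define a b where "a = ln (real n + 1)" and "b = ln (real n + 2)"
  have ab: "0 \<le> a" "a \<le> b" by (simp_all add: a_def b_def)
  have "b - a \<le> 1 / (real n + 1)"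
  proof -
    have "b - a = ln ((real n + 2) / (real n + 1))" by (simp add: a_def b_def ln_div)
    also have "\<dots> \<le> (real n + 2) / (real n + 1) - 1" by (rule ln_le_minus_one) simp
    also have "\<dots> = 1 / (real n + 1)" by (simp add: field_simps)
    finally show ?thesis .
  qed
  have "b ^ Suc p - a ^ Suc p = (b - a) * (\<Sum>i<Suc p. b ^ i * a ^ (p - i))"
    unfolding power_diff_sumr2 by (simp only: diff_Suc_Suc mult.commute)
  also have "\<dots> \<le> (b - a) * (\<Sum>i<Suc p. b ^ p)"
  proof (intro mult_left_mono sum_mono)
    fix i assume "i \<in> {..<Suc p}"
    then have "b ^ p = b ^ i * b ^ (p - i)" by (simp flip: power_add)
    then show "b ^ i * a ^ (p - i) \<le> b ^ p"
      using ab by (simp add: mult_left_mono power_mono)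
  qed (use ab in auto)
  also have "\<dots> = (b - a) * (real (Suc p) * b ^ p)" by simp
  also have "\<dots> \<le> 1 / (real n + 1) * (real (Suc p) * b ^ p)"
    using \<open>b - a \<le> _\<close> ab by (intro mult_right_mono) auto
  also have "\<dots> = real (Suc p) * log_weight p (Suc n)"
    by (simp add: log_weight_def b_def add.commute)
  finally have "b ^ Suc p \<le> real (Suc p) * log_weight p (Suc n) + a ^ Suc p" by simp
  also have "\<dots> \<le> real (Suc p) * log_weight p (Suc n) + real (Suc p) * (\<Sum>i=1..n. log_weight p i)"
    using Suc by (simp add: a_def)
  finally show ?case by (simp add: b_def algebra_simps)
qed (simp)

text \<open>On complete cells the mean of the kernel has one factor 1/k more than its L1 norm.
  Summability of the weights with this extra factor makes the mean value part of the far cells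
  negligible. Any exponent strictly between 1 and 2 would serve for the comparison.\<close>

lemma summable_log_weight_div: "summable (\<lambda>k. log_weight p (Suc k) / real (Suc k))"
proof (rule summable_comparison_test_ev)
  show "\<forall>\<^sub>F k in sequentially. norm (log_weight p (Suc k) / real (Suc k)) \<le> real (Suc k) powr (-3/2)"
  proof -
    have "(\<lambda>k. ln (real (Suc k) + 1) ^ p / real (Suc k) / real (Suc k) / real (Suc k) powr (-3/2)) \<longlonglongrightarrow> 0"
      by real_asymp
    then have "\<forall>\<^sub>F k in sequentially.
        ln (real (Suc k) + 1) ^ p / real (Suc k) / real (Suc k) / real (Suc k) powr (-3/2) < 1"
      by (rule order_tendstoD) simp
    then show ?thesis
      by eventually_elim (simp add: log_weight_def divide_less_eq pos_divide_le_eq mult_ac)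
  qed
  show "summable (\<lambda>k. real (Suc k) powr (-3/2))"
    using summable_real_powr_iff[of "-3/2"] summable_Suc_iff[of "\<lambda>k. real k powr (-3/2)"] by simp
qed

lemma log_weight_bounded: obtains W where "W > 0" "\<And>n. log_weight p n \<le> W"
proof -
  have "Bseq (log_weight p)"
    using log_weight_tendsto_0 convergentI convergent_imp_Bseq by blast
  then obtain W where "W > 0" "\<And>n. norm (log_weight p n) \<le> W" by (auto elim: BseqE)
  then show ?thesis using that by (metis abs_ge_self order_trans real_norm_def)
qed

section \<open>Gauges of bounded weighted variation\<close>

text \<open>In the application, \<open>\<rho> a b\<close> is the supremum of the increments \<open>\<bar>f(I\<^sup>s, y)\<bar>\<close> over \<open>y\<close>, where
  \<open>I\<close> has end points \<open>a\<close> and \<open>b\<close> and \<open>s\<close> is fixed.\<close>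

locale log_gauge =
  fixes p :: nat and \<rho> :: "real \<Rightarrow> real \<Rightarrow> real" and V R :: real
  assumes nonneg: "0 \<le> \<rho> a b"
    and le_R: "\<rho> a b \<le> R"
    and refl: "\<rho> a a = 0"
    and periodic: "\<rho> (a + 2 * pi * of_int k) (b + 2 * pi * of_int k) = \<rho> a b"
    and variation: "\<lbrakk>finite J; 0 \<notin> J; \<And>i. i \<in> J \<Longrightarrow> u i \<in> {c..c + 2 * pi} \<and> v i \<in> {c..c + 2 * pi};
      disjoint_family_on (\<lambda>i. open_segment (u i) (v i)) J\<rbrakk>
      \<Longrightarrow> (\<Sum>i\<in>J. log_weight p i * \<rho> (u i) (v i)) \<le> V"
begin

lemma R_nonneg: "0 \<le> R"
  using nonneg[of 0 0] le_R[of 0 0] by simp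

lemma V_nonneg: "0 \<le> V"
  using variation[of "{}" undefined 0 undefined] by (simp add: disjoint_family_on_def)

text \<open>In \<open>variation\<close> the weight of an interval is tied to its index. An arbitrary
  distribution of distinct weights over the intervals is a reindexing by an injection.\<close>

lemma variation_reindex:
  fixes a b :: "nat \<Rightarrow> real"
  assumes "finite K" "inj_on \<sigma> K" "0 \<notin> \<sigma> ` K"
    and ab: "\<And>k. k \<in> K \<Longrightarrow> a k \<in> {c..c + 2 * pi} \<and> b k \<in> {c..c + 2 * pi}"
    and disj: "disjoint_family_on (\<lambda>k. open_segment (a k) (b k)) K"
  shows "(\<Sum>k\<in>K. log_weight p (\<sigma> k) * \<rho> (a k) (b k)) \<le> V"
proof -
  let ?g = "inv_into K \<sigma>"
  have "(\<Sum>i\<in>\<sigma> ` K. log_weight p i * \<rho> (a (?g i)) (b (?g i))) \<le> V"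
  proof (rule variation[where c=c])
    show "disjoint_family_on (\<lambda>i. open_segment (a (?g i)) (b (?g i))) (\<sigma> ` K)"
      unfolding disjoint_family_on_def
    proof (intro ballI impI)
      fix m n assume "m \<in> \<sigma> ` K" "n \<in> \<sigma> ` K" "m \<noteq> n"
      then have "?g m \<in> K" "?g n \<in> K" "?g m \<noteq> ?g n"
        by (auto simp: inv_into_into dest: inv_into_injective)
      then show "open_segment (a (?g m)) (b (?g m)) \<inter> open_segment (a (?g n)) (b (?g n)) = {}"
        using disj by (auto simp: disjoint_family_on_def)
    qed
  qed (use assms in \<open>auto simp: inv_into_into\<close>)
  also have "(\<Sum>i\<in>\<sigma> ` K. log_weight p i * \<rho> (a (?g i)) (b (?g i))) =
      (\<Sum>k\<in>K. log_weight p (\<sigma> k) * \<rho> (a k) (b k))"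
    using assms(2) by (simp add: sum.reindex)
  finally show ?thesis .
qed

text \<open>Averaging over the cyclic shifts of the index set.\<close>

lemma sum_gauge_le:
  fixes a b :: "nat \<Rightarrow> real"
  assumes ab: "\<And>k. k < n \<Longrightarrow> a k \<in> {c..c + 2 * pi} \<and> b k \<in> {c..c + 2 * pi}"
    and disj: "disjoint_family_on (\<lambda>k. open_segment (a k) (b k)) {..<n}"
  shows "(\<Sum>i=1..n. log_weight p i) * (\<Sum>k<n. \<rho> (a k) (b k)) \<le> real n * V"
proof (cases "n = 0")
  case False
  define \<tau> where "\<tau> = (\<lambda>s k. Suc ((k + s) mod n))"
  have inj_mod: "inj_on (\<lambda>k. (k + s) mod n) {..<n}" for s
  proof (rule inj_onI)
    fix x y assume xy: "x \<in> {..<n}" "y \<in> {..<n}" and eq: "(x + s) mod n = (y + s) mod n"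
    have "n dvd (y + s) - (x + s)" if "x < y"
      by (rule mod_eq_dvd_iff_nat[THEN iffD1]) (use that eq in simp_all)
    moreover have "n dvd (x + s) - (y + s)" if "y < x"
      by (rule mod_eq_dvd_iff_nat[THEN iffD1]) (use that eq in simp_all)
    ultimately have "x < y \<Longrightarrow> n \<le> y - x" "y < x \<Longrightarrow> n \<le> x - y"
      by (auto intro: dvd_imp_le)
    then show "x = y" using xy by (cases x y rule: linorder_cases) auto
  qed
  have inj: "inj_on (\<tau> s) {..<n}" for s
    unfolding \<tau>_def inj_on_def nat.inject by (rule inj_mod[unfolded inj_on_def])
  \<comment> \<open>For a fixed interval k the shifts s run through every weight index exactly once,
    so all intervals receive the same total weight.\<close>
  have weights: "(\<Sum>s<n. log_weight p (\<tau> s k)) = (\<Sum>i=1..n. log_weight p i)" for k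
  proof -
    have "(\<lambda>s. (s + k) mod n) ` {..<n} = {..<n}"
      by (rule card_subset_eq) (use False inj_mod[of k] in \<open>auto simp: card_image\<close>)
    then have "(\<Sum>s<n. log_weight p (Suc ((s + k) mod n))) = (\<Sum>i<n. log_weight p (Suc i))"
      using sum.reindex[OF inj_mod[of k], of "\<lambda>i. log_weight p (Suc i)"] by (simp add: o_def)
    then show ?thesis
      by (simp add: \<tau>_def add.commute sum.atLeast1_atMost_eq)
  qed
  have "(\<Sum>i=1..n. log_weight p i) * (\<Sum>k<n. \<rho> (a k) (b k)) =
      (\<Sum>k<n. \<Sum>s<n. log_weight p (\<tau> s k) * \<rho> (a k) (b k))"
    by (simp add: weights sum_distrib_left flip: sum_distrib_right)
  also have "\<dots> = (\<Sum>s<n. \<Sum>k<n. log_weight p (\<tau> s k) * \<rho> (a k) (b k))"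
    by (rule sum.swap)
  also have "\<dots> \<le> (\<Sum>s<n. V)"
    by (intro sum_mono variation_reindex[where c=c] inj) (use ab disj in \<open>auto simp: \<tau>_def\<close>)
  finally show ?thesis by simp
qed simp


text \<open>Waterman's argument: infinitely many disjoint families near one point, each contributing at
  least \<open>\<epsilon>/2\<close>, would violate the bound on the variation. Compactness of the circle gives
  uniformity.\<close>

lemma uniformly_small_variation:
  assumes "\<epsilon> > 0"
  obtains \<eta> K where "\<eta> > 0"
    and "\<And>x J u v. \<lbrakk>finite J; J \<subseteq> {K<..}; \<And>i. i \<in> J \<Longrightarrow> u i \<in> ball x \<eta> \<and> v i \<in> ball x \<eta>;
      disjoint_family_on (\<lambda>i. open_segment (u i) (v i)) J\<rbrakk>
      \<Longrightarrow> (\<Sum>i\<in>J. log_weight p i * \<rho> (u i) (v i)) \<le> \<epsilon>"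
proof (rule ccontr)
  note main = that
  \<comment> \<open>Failure of the claim gives a bad centre for every scale \<delta> and threshold
    K. A limit point of such centres will be bad for all scales and thresholds at once.\<close>
  define bad where "bad = (\<lambda>\<delta> K x. \<exists>J u v. finite J \<and> J \<subseteq> {K<..} \<and>
      (\<forall>i\<in>J. u i \<in> ball x \<delta> \<and> v i \<in> ball x \<delta>) \<and>
      disjoint_family_on (\<lambda>i. open_segment (u i) (v i)) J \<and>
      \<epsilon> < (\<Sum>i\<in>J. log_weight p i * \<rho> (u i) (v i)))"
  assume "\<not> thesis"
  have exists_bad: "\<exists>x. bad \<delta> K x" if "\<delta> > 0" for \<delta> K
  proof (rule ccontr)
    assume none: "\<nexists>x. bad \<delta> K x"
    have thesis
    proof (rule main[OF \<open>\<delta> > 0\<close>, of K])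
      fix x :: real and J :: "nat set" and u v :: "nat \<Rightarrow> real"
      assume "finite J" "J \<subseteq> {K<..}" "\<And>i. i \<in> J \<Longrightarrow> u i \<in> ball x \<delta> \<and> v i \<in> ball x \<delta>"
        "disjoint_family_on (\<lambda>i. open_segment (u i) (v i)) J"
      then have "bad \<delta> K x" if "\<epsilon> < (\<Sum>i\<in>J. log_weight p i * \<rho> (u i) (v i))"
        unfolding bad_def using that by (intro exI conjI) auto
      with none show "(\<Sum>i\<in>J. log_weight p i * \<rho> (u i) (v i)) \<le> \<epsilon>"
        by (auto simp flip: not_less)
    qed
    with \<open>\<not> thesis\<close> show False ..
  qed
  \<comment> \<open>Translation by periods moves the centres into the compact interval
    \<open>{0..2 * pi}\<close>, where they accumulate.\<close>
  have bad_shift: "bad \<delta> K (x + 2 * pi * of_int k)" if bad: "bad \<delta> K x" for \<delta> K x k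
  proof -
    let ?c = "2 * pi * of_int k"
    obtain J u v where J: "finite J" "J \<subseteq> {K<..}" "\<forall>i\<in>J. u i \<in> ball x \<delta> \<and> v i \<in> ball x \<delta>"
      "disjoint_family_on (\<lambda>i. open_segment (u i) (v i)) J"
      "\<epsilon> < (\<Sum>i\<in>J. log_weight p i * \<rho> (u i) (v i))"
      using bad unfolding bad_def by blast
    have "z \<in> open_segment (u i + ?c) (v i + ?c) \<longleftrightarrow> z - ?c \<in> open_segment (u i) (v i)" for z i
      by (auto simp: open_segment_eq_real_ivl split: if_splits)
    then have "disjoint_family_on (\<lambda>i. open_segment (u i + ?c) (v i + ?c)) J"
      using J(4) by (simp add: disjoint_family_on_def disjoint_iff)
    with J show ?thesis
      unfolding bad_def
      by - (rule exI[of _ J], rule exI[of _ "\<lambda>i. u i + ?c"], rule exI[of _ "\<lambda>i. v i + ?c"], auto simp: periodic dist_real_def)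
  qed
  have "\<exists>x. x \<in> {0..2 * pi} \<and> bad \<delta> K x" if "\<delta> > 0" for \<delta> K
  proof -
    obtain x where x: "bad \<delta> K x" using exists_bad[OF \<open>\<delta> > 0\<close>] by blast
    let ?y = "x + 2 * pi * of_int (- \<lfloor>x / (2 * pi)\<rfloor>)"
    have "?y \<in> {0..2 * pi}"
      using floor_divide_lower[of "2 * pi" x] floor_divide_upper[of "2 * pi" x] by (simp add: algebra_simps)
    moreover have "bad \<delta> K ?y" by (rule bad_shift[OF x])
    ultimately show ?thesis by blast
  qed
  then have "\<forall>j. \<exists>x. x \<in> {0..2 * pi} \<and> bad (1 / (real j + 1)) j x" by simp
  then have "\<exists>X. \<forall>j. X j \<in> {0..2 * pi} \<and> bad (1 / (real j + 1)) j (X j)" by (rule choice)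
  then obtain X where X: "\<And>j. X j \<in> {0..2 * pi}" "\<And>j. bad (1 / (real j + 1)) j (X j)" by blast
  obtain q r where r: "strict_mono r" "(X \<circ> r) \<longlonglongrightarrow> q"
    by (rule seq_compactE[OF compact_imp_seq_compact[OF compact_Icc[of 0 "2 * pi"]], of X])
      (use X(1) in simp_all)
  \<comment> \<open>The j-th centre has scale 1/(j+1) and threshold j; along the convergent
    subsequence both eventually beat any prescribed \<delta> and K.\<close>
  have bad_q: "bad \<delta> K q" if "\<delta> > 0" for \<delta> K
  proof -
    have "\<forall>\<^sub>F j in sequentially. dist ((X \<circ> r) j) q < \<delta> / 2"
      using tendstoD[OF r(2), of "\<delta> / 2"] \<open>\<delta> > 0\<close> by simp
    moreover have "\<forall>\<^sub>F j in sequentially. 1 / (real j + 1) < \<delta> / 2"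
      using \<open>\<delta> > 0\<close> by real_asymp
    ultimately have "\<forall>\<^sub>F j in sequentially. dist ((X \<circ> r) j) q < \<delta> / 2 \<and> 1 / (real j + 1) < \<delta> / 2 \<and> K \<le> j"
      using eventually_ge_at_top[of K] by eventually_elim blast
    then have "\<exists>j. dist ((X \<circ> r) j) q < \<delta> / 2 \<and> 1 / (real j + 1) < \<delta> / 2 \<and> K \<le> j"
      by (rule eventually_happens'[OF sequentially_bot])
    then obtain j where j: "dist (X (r j)) q < \<delta> / 2" "1 / (real j + 1) < \<delta> / 2" "K \<le> j"
      by auto
    have "j \<le> r j" using r(1) by (rule seq_suble)
    then have "1 / (real (r j) + 1) \<le> 1 / (real j + 1)" by (simp add: frac_le)
    then have sub: "ball (X (r j)) (1 / (real (r j) + 1)) \<subseteq> ball q \<delta>"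
      using j by (simp add: ball_subset_ball_iff)
    have "{r j<..} \<subseteq> {K<..}" using \<open>j \<le> r j\<close> j(3) by auto
    obtain J u v where J: "finite J" "J \<subseteq> {r j<..}"
      "\<forall>i\<in>J. u i \<in> ball (X (r j)) (1 / (real (r j) + 1)) \<and> v i \<in> ball (X (r j)) (1 / (real (r j) + 1))"
      "disjoint_family_on (\<lambda>i. open_segment (u i) (v i)) J"
      "\<epsilon> < (\<Sum>i\<in>J. log_weight p i * \<rho> (u i) (v i))"
      using X(2)[of "r j"] unfolding bad_def by blast
    have "J \<subseteq> {K<..}" by (rule subset_trans[OF J(2)]) (rule \<open>{r j<..} \<subseteq> {K<..}\<close>)
    moreover have "\<forall>i\<in>J. u i \<in> ball q \<delta> \<and> v i \<in> ball q \<delta>" using J(3) sub by blast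
    ultimately show ?thesis unfolding bad_def using J(1,4,5) by blast
  qed
  \<comment> \<open>At most two intervals will have to be dropped; with indices from K0 on each of
    them costs at most \<epsilon>/4. \<open>R + 1\<close> replaces R because R may be 0.\<close>
  have "R + 1 > 0" using R_nonneg by simp
  then have "0 < \<epsilon> / (4 * (R + 1))" using \<open>\<epsilon> > 0\<close> by simp
  with log_weight_tendsto_0[of p] have "\<forall>\<^sub>F n in sequentially. log_weight p n < \<epsilon> / (4 * (R + 1))"
    by (rule order_tendstoD)
  then obtain K0 where K0: "\<And>n. n \<ge> K0 \<Longrightarrow> log_weight p n < \<epsilon> / (4 * (R + 1))"
    unfolding eventually_sequentially by blast
  \<comment> \<open>A finite family whose closed segments avoid q keeps a positive distance from q,
    which leaves room for another family closer to q.\<close>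
  have apart: "\<exists>J u v. finite J \<and> J \<subseteq> {K<..} \<and> (\<forall>i\<in>J. u i \<in> ball q \<delta> \<and> v i \<in> ball q \<delta>) \<and>
      disjoint_family_on (\<lambda>i. open_segment (u i) (v i)) J \<and> (\<forall>i\<in>J. q \<notin> closed_segment (u i) (v i)) \<and>
      \<epsilon> / 2 \<le> (\<Sum>i\<in>J. log_weight p i * \<rho> (u i) (v i))" if "\<delta> > 0" for \<delta> K
  proof -
    obtain J u v where J: "finite J" "J \<subseteq> {max K K0<..}" "\<forall>i\<in>J. u i \<in> ball q \<delta> \<and> v i \<in> ball q \<delta>"
      and disj: "disjoint_family_on (\<lambda>i. open_segment (u i) (v i)) J"
      and gt: "\<epsilon> < (\<Sum>i\<in>J. log_weight p i * \<rho> (u i) (v i))"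
      using bad_q[OF \<open>\<delta> > 0\<close>, of "max K K0"] unfolding bad_def by (elim exE conjE)
    let ?f = "\<lambda>i. log_weight p i * \<rho> (u i) (v i)"
    define J' where "J' = {i\<in>J. q \<notin> closed_segment (u i) (v i)}"
    \<comment> \<open>Among the segments touching q, \<open>B1\<close> has those with points just to
      the left of q and \<open>B2\<close> those starting at q. Disjointness allows one of each kind;
      what else touches q is degenerate and contributes 0 by \<open>refl\<close>.\<close>
    define B1 where "B1 = {i\<in>J. min (u i) (v i) < q \<and> q \<le> max (u i) (v i)}"
    define B2 where "B2 = {i\<in>J. min (u i) (v i) = q \<and> u i \<noteq> v i}"
    have clash: False if "i \<in> J" "j \<in> J" "i \<noteq> j" "z \<in> open_segment (u i) (v i)" "z \<in> open_segment (u j) (v j)"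
      for i j z using disjoint_family_onD[OF disj, of i j] that by blast
    have seg: "z \<in> open_segment x y \<longleftrightarrow> min x y < z \<and> z < max x y" for x y z :: real
      by (auto simp: open_segment_eq_real_ivl)
    have cseg: "z \<in> closed_segment x y \<longleftrightarrow> min x y \<le> z \<and> z \<le> max x y" for x y z :: real
      by (auto simp: closed_segment_eq_real_ivl)
    have "i = j" if ij: "i \<in> B1" "j \<in> B1" for i j
    proof (rule ccontr)
      assume "i \<noteq> j"
      obtain z where "max (min (u i) (v i)) (min (u j) (v j)) < z" "z < q"
        using dense[of "max (min (u i) (v i)) (min (u j) (v j))" q] ij
        unfolding B1_def mem_Collect_eq max_less_iff_conj by blast
      then show False
        using clash[of i j z] \<open>i \<noteq> j\<close> ij by (auto simp: B1_def seg)
    qed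
    then have "card B1 \<le> Suc 0" using J(1) by (subst card_le_Suc0_iff_eq) (auto simp: B1_def)
    have "i = j" if ij: "i \<in> B2" "j \<in> B2" for i j
    proof (rule ccontr)
      assume "i \<noteq> j"
      have "q < min (max (u i) (v i)) (max (u j) (v j))" using ij by (auto simp: B2_def)
      then obtain z where "q < z" "z < min (max (u i) (v i)) (max (u j) (v j))"
        using dense by blast
      then show False
        using clash[of i j z] \<open>i \<noteq> j\<close> ij by (auto simp: B2_def seg)
    qed
    then have "card B2 \<le> Suc 0" using J(1) by (subst card_le_Suc0_iff_eq) (auto simp: B2_def)
    with \<open>card B1 \<le> Suc 0\<close> have card: "card (B1 \<union> B2) \<le> 2" using card_Un_le[of B1 B2] by linarith
    have "(\<Sum>i\<in>J. ?f i) = (\<Sum>i\<in>J' \<union> (B1 \<union> B2). ?f i)"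
    proof (rule sum.mono_neutral_right)
      have "u i = v i" if "i \<in> J - (J' \<union> (B1 \<union> B2))" for i
        using that by (auto simp: J'_def B1_def B2_def cseg)
      then show "\<forall>i\<in>J - (J' \<union> (B1 \<union> B2)). ?f i = 0" by (simp add: refl)
    qed (use J(1) in \<open>auto simp: J'_def B1_def B2_def\<close>)
    also have "\<dots> = (\<Sum>i\<in>J'. ?f i) + (\<Sum>i\<in>B1 \<union> B2. ?f i)"
      by (rule sum.union_disjoint) (use J(1) in \<open>auto simp: J'_def B1_def B2_def cseg\<close>)
    also have "(\<Sum>i\<in>B1 \<union> B2. ?f i) \<le> of_nat (card (B1 \<union> B2)) * (\<epsilon> / 4)"
    proof (rule sum_bounded_above)
      fix i assume "i \<in> B1 \<union> B2"
      then have "i \<ge> K0" using J(2) by (auto simp: B1_def B2_def)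
      have "?f i \<le> \<epsilon> / (4 * (R + 1)) * (R + 1)"
        using K0[OF \<open>i \<ge> K0\<close>] le_R[of "u i" "v i"] nonneg[of "u i" "v i"] R_nonneg \<open>\<epsilon> > 0\<close>
        by (intro mult_mono) auto
      also have "\<dots> = \<epsilon> / 4" using \<open>R + 1 > 0\<close> by (simp add: field_simps)
      finally show "?f i \<le> \<epsilon> / 4" .
    qed
    also have "\<dots> \<le> of_nat 2 * (\<epsilon> / 4)" using card \<open>\<epsilon> > 0\<close> by (intro mult_right_mono of_nat_mono) auto
    finally have "\<epsilon> / 2 \<le> (\<Sum>i\<in>J'. ?f i)" using gt by simp
    then show ?thesis
      using J disj by - (rule exI[of _ J'], rule exI[of _ u], rule exI[of _ v], auto simp: J'_def disjoint_family_on_def)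
  qed
  \<comment> \<open>The families are stacked towards q: each new one lies in a ball that misses all
    earlier segments and uses larger indices, so n of them form one admissible family. The radius pi
    keeps everything in a single period window, as \<open>variation\<close> demands.\<close>
  have "\<exists>J u v. finite J \<and> 0 \<notin> J \<and> (\<forall>i\<in>J. u i \<in> ball q pi \<and> v i \<in> ball q pi) \<and>
      disjoint_family_on (\<lambda>i. open_segment (u i) (v i)) J \<and> (\<forall>i\<in>J. q \<notin> closed_segment (u i) (v i)) \<and>
      real n * (\<epsilon> / 2) \<le> (\<Sum>i\<in>J. log_weight p i * \<rho> (u i) (v i))" for n
  proof (induction n)
    case 0
    show ?case by (rule exI[of _ "{}"]) (simp add: disjoint_family_on_def)
  next
    case (Suc n)
    then obtain J u v where J: "finite J" "0 \<notin> J" "\<forall>i\<in>J. u i \<in> ball q pi \<and> v i \<in> ball q pi"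
      "disjoint_family_on (\<lambda>i. open_segment (u i) (v i)) J" "\<forall>i\<in>J. q \<notin> closed_segment (u i) (v i)"
      "real n * (\<epsilon> / 2) \<le> (\<Sum>i\<in>J. log_weight p i * \<rho> (u i) (v i))"
      by blast
    have "closed (\<Union>i\<in>J. closed_segment (u i) (v i))" using J(1) by (intro closed_UN) auto
    then obtain e where e: "e > 0" "ball q e \<subseteq> - (\<Union>i\<in>J. closed_segment (u i) (v i))"
      using J(5) openE[of "- (\<Union>i\<in>J. closed_segment (u i) (v i))" q]
      unfolding closed_def by blast
    obtain J2 u2 v2 where J2: "finite J2" "J2 \<subseteq> {Max (insert 0 J)<..}"
      "\<forall>i\<in>J2. u2 i \<in> ball q (min e pi) \<and> v2 i \<in> ball q (min e pi)"
      "disjoint_family_on (\<lambda>i. open_segment (u2 i) (v2 i)) J2"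
      "\<forall>i\<in>J2. q \<notin> closed_segment (u2 i) (v2 i)"
      "\<epsilon> / 2 \<le> (\<Sum>i\<in>J2. log_weight p i * \<rho> (u2 i) (v2 i))"
      using apart[of "min e pi" "Max (insert 0 J)"] e(1) pi_gt_zero unfolding min_less_iff_conj by blast
    define u' where "u' = (\<lambda>i. if i \<in> J then u i else u2 i)"
    define v' where "v' = (\<lambda>i. if i \<in> J then v i else v2 i)"
    have sep: "i \<notin> J2" if "i \<in> J" for i
    proof -
      have "i \<le> Max (insert 0 J)" using that J(1) by (intro Max_ge) auto
      then show ?thesis using J2(2) by auto
    qed
    have u'v'[simp]: "i \<in> J \<Longrightarrow> u' i = u i" "i \<in> J \<Longrightarrow> v' i = v i"
      "i \<in> J2 \<Longrightarrow> u' i = u2 i" "i \<in> J2 \<Longrightarrow> v' i = v2 i" for i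
      using sep by (auto simp: u'_def v'_def)
    have cross: "open_segment (u i) (v i) \<inter> open_segment (u2 j) (v2 j) = {}" if "i \<in> J" "j \<in> J2" for i j
    proof -
      have "closed_segment (u2 j) (v2 j) \<subseteq> ball q e"
        using J2(3) that by (intro closed_segment_subset) auto
      then have "open_segment (u2 j) (v2 j) \<subseteq> ball q e"
        using segment_open_subset_closed[of "u2 j" "v2 j"] by blast
      moreover have "open_segment (u i) (v i) \<subseteq> (\<Union>i\<in>J. closed_segment (u i) (v i))"
        using segment_open_subset_closed[of "u i" "v i"] that(1) by blast
      ultimately show ?thesis using e(2) by blast
    qed
    have "disjoint_family_on (\<lambda>i. open_segment (u' i) (v' i)) (J \<union> J2)"
      unfolding disjoint_family_on_def
    proof (intro ballI impI)
      fix i j assume "i \<in> J \<union> J2" "j \<in> J \<union> J2" "i \<noteq> j"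
      then show "open_segment (u' i) (v' i) \<inter> open_segment (u' j) (v' j) = {}"
        using disjoint_family_onD[OF J(4)] disjoint_family_onD[OF J2(4)] cross[of i j] cross[of j i]
        by (elim UnE) (simp_all add: Int_commute)
    qed
    moreover have "(\<Sum>i\<in>J \<union> J2. log_weight p i * \<rho> (u' i) (v' i)) =
        (\<Sum>i\<in>J. log_weight p i * \<rho> (u i) (v i)) + (\<Sum>i\<in>J2. log_weight p i * \<rho> (u2 i) (v2 i))"
      using J(1) J2(1) sep by (subst sum.union_disjoint) auto
    moreover have "0 \<notin> J \<union> J2" using J(2) J2(2) by auto
    ultimately show ?case
      using J J2 by - (rule exI[of _ "J \<union> J2"], rule exI[of _ u'], rule exI[of _ v'], auto simp: algebra_simps)
  qed
  note many = this
  obtain n where n: "V < real n * (\<epsilon> / 2)"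
    using \<open>\<epsilon> > 0\<close> reals_Archimedean3[of "\<epsilon> / 2"] by auto
  obtain J u v where J: "finite J" "0 \<notin> J" "\<forall>i\<in>J. u i \<in> ball q pi \<and> v i \<in> ball q pi"
      "disjoint_family_on (\<lambda>i. open_segment (u i) (v i)) J"
      "real n * (\<epsilon> / 2) \<le> (\<Sum>i\<in>J. log_weight p i * \<rho> (u i) (v i))"
    using many[of n] by (elim exE conjE)
  have "(\<Sum>i\<in>J. log_weight p i * \<rho> (u i) (v i)) \<le> V"
    by (rule variation[where c="q - pi"]) (use J in \<open>auto simp: dist_real_def\<close>)
  with J(5) n show False by linarith
qed


end

section \<open>Cells: the periods of sin((N + 1/2) u) on a half axis\<close>

definition cell :: "nat \<Rightarrow> nat \<Rightarrow> real set" where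
  "cell N k = {u. real k * (4 * pi / (2 * real N + 1)) < u \<and>
     u \<le> (real k + 1) * (4 * pi / (2 * real N + 1)) \<and> u \<le> pi}"

lemma cell_pos: "u \<in> cell N k \<Longrightarrow> 0 < u"
  by (auto simp: cell_def intro: le_less_trans[rotated])

lemma cell_le_pi: "u \<in> cell N k \<Longrightarrow> u \<le> pi"
  by (simp add: cell_def)

lemma cell_inj:
  assumes "u \<in> cell N k" "u \<in> cell N k'"
  shows "k = k'"
proof -
  have False if "a < b" "u \<in> cell N a" "u \<in> cell N b" for a b
  proof -
    have "real a + 1 \<le> real b" using that(1) by linarith
    then have "(real a + 1) * (4 * pi / (2 * real N + 1)) \<le> real b * (4 * pi / (2 * real N + 1))"
      by (intro mult_right_mono) auto
    then show False using that by (simp add: cell_def)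
  qed
  then show ?thesis using assms by (metis linorder_neqE_nat)
qed

text \<open>Together with \<open>cell_inj\<close> this makes the cells a partition of
  \<open>{0<..pi}\<close>. The cell with index \<open>N div 2\<close> is the last one, and it is the
  one that pi cuts off before a full period is completed.\<close>

lemma ex_cell:
  assumes "0 < u" "u \<le> pi"
  obtains k where "k \<le> N div 2" "u \<in> cell N k"
proof -
  define l where "l = 4 * pi / (2 * real N + 1)"
  have "l > 0" by (simp add: l_def)
  \<comment> \<open>Cells are open on the left and closed on the right, hence the ceiling minus
    one.\<close>
  define k where "k = nat (\<lceil>u / l\<rceil> - 1)"
  have "\<lceil>u / l\<rceil> \<ge> 1" using assms \<open>l > 0\<close> by simp
  then have k: "real k = of_int \<lceil>u / l\<rceil> - 1" by (simp add: k_def)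
  have "real k < u / l" "u / l \<le> real k + 1" unfolding k by linarith+
  then have kl: "real k * l < u" "u \<le> (real k + 1) * l" using \<open>l > 0\<close> by (simp_all add: field_simps)
  then have "u \<in> cell N k" using assms by (simp add: cell_def l_def)
  have "real k * l < pi" using kl(1) assms(2) by linarith
  then have "pi * (real k * 4) < pi * (2 * real N + 1)" by (simp add: l_def field_simps)
  then have "real k * 4 < 2 * real N + 1" by (simp only: mult_less_cancel_left_pos[OF pi_gt_zero])
  then have "4 * k < 2 * N + 1" by linarith
  then have "k \<le> N div 2" by linarith
  then show ?thesis using that \<open>u \<in> cell N k\<close> by blast
qed

text \<open>Cells are intervals and \<sigma> is a reflection or the identity. Combined with
  \<open>cell_inj\<close>, this makes segments taken from different cells disjoint.\<close>

lemma cell_convex: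
  assumes "u \<in> cell N k" "v \<in> cell N k" "\<bar>\<sigma>\<bar> = 1" "z \<in> open_segment (x + \<sigma> * u) (x + \<sigma> * v)"
  shows "\<sigma> * (z - x) \<in> cell N k"
proof -
  have "\<sigma> = 1 \<or> \<sigma> = -1" using assms(3) by linarith
  then show ?thesis
    using assms by (auto simp: cell_def open_segment_eq_real_ivl split: if_splits)
qed

text \<open>Cells within distance \<eta> of 0 are covered by
  \<open>uniformly_small_variation\<close>. Beyond that distance 1/(k+1) is at most l/\<eta>, with l
  the cell length, so all weights are O(log^p N / N), while \<open>sum_gauge_le\<close> bounds the
  sum of the increments over all cells by O(N / log^(p+1) N). The product is O(1 / log N), uniformly
  in x, \<sigma> and the chosen points.\<close>

lemma (in log_gauge) cell_variation_small:
  assumes "\<epsilon> > 0"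
  obtains M N0 where "\<And>N x \<sigma> u v. \<lbrakk>N \<ge> N0; \<bar>\<sigma>\<bar> = 1;
      \<And>k. k \<le> N div 2 \<Longrightarrow> u k \<in> cell N k \<and> v k \<in> cell N k\<rbrakk>
    \<Longrightarrow> (\<Sum>k=M..N div 2. log_weight p (Suc k) * \<rho> (x + \<sigma> * u k) (x + \<sigma> * v k)) \<le> \<epsilon>"
proof (rule uniformly_small_variation)
  show "\<epsilon> / 2 > 0" using assms by simp
next
  fix \<eta> :: real and M :: nat
  assume \<eta>: "\<eta> > 0"
    and small: "\<And>x J u v. \<lbrakk>finite J; J \<subseteq> {M<..}; \<And>i. i \<in> J \<Longrightarrow> u i \<in> ball x \<eta> \<and> v i \<in> ball x \<eta>;
      disjoint_family_on (\<lambda>i. open_segment (u i) (v i)) J\<rbrakk>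
      \<Longrightarrow> (\<Sum>i\<in>J. log_weight p i * \<rho> (u i) (v i)) \<le> \<epsilon> / 2"
  define E where "E = (\<lambda>N. ln (real N + 2) ^ p * (4 * pi / (2 * real N + 1)) / \<eta> *
      ((real N / 2 + 1) * V * real (Suc p) / ln (real N / 2 + 1) ^ Suc p))"
  have "E \<longlonglongrightarrow> 0"
  proof (rule Lim_null_comparison)
    let ?C = "2 ^ p * 4 * pi / \<eta> * V * real (Suc p)"
    show "\<forall>\<^sub>F N in sequentially. norm (E N) \<le> ?C / ln (real N / 2 + 1)"
    proof (rule eventually_sequentiallyI[of 2])
      fix N :: nat assume "N \<ge> 2"
      define L where "L = ln (real N / 2 + 1)"
      have "L > 0" using \<open>N \<ge> 2\<close> by (simp add: L_def)
      \<comment> \<open>Bounding ln(N + 2) by twice ln(N/2 + 1) lets p of the p + 1 logarithms in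
        the denominator cancel.\<close>
      have "real N + 2 \<le> (real N / 2 + 1)\<^sup>2"
        using \<open>N \<ge> 2\<close> mult_mono[of 2 "real N" 2 "real N"] by (simp add: power2_eq_square field_simps)
      then have "ln (real N + 2) \<le> ln ((real N / 2 + 1)\<^sup>2)" by (subst ln_le_cancel_iff) auto
      then have "ln (real N + 2) \<le> 2 * L" by (simp add: L_def ln_realpow)
      then have "ln (real N + 2) ^ p \<le> (2 * L) ^ p" by (intro power_mono) auto
      then have 1: "ln (real N + 2) ^ p / L ^ Suc p \<le> 2 ^ p / L"
        using \<open>L > 0\<close> by (simp add: power_mult_distrib divide_simps)
      have 2: "(real N / 2 + 1) / (2 * real N + 1) \<le> 1" by (simp add: field_simps)
      have "norm (E N) = E N"
        using \<open>L > 0\<close> \<eta> V_nonneg by (simp add: E_def flip: L_def)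
      also have "E N = (ln (real N + 2) ^ p / L ^ Suc p) * ((real N / 2 + 1) / (2 * real N + 1)) *
          (4 * pi / \<eta> * V * real (Suc p))"
        by (simp add: E_def mult_ac flip: L_def)
      also have "\<dots> \<le> (2 ^ p / L) * 1 * (4 * pi / \<eta> * V * real (Suc p))"
        using 1 2 \<open>L > 0\<close> \<eta> V_nonneg by (intro mult_mono mult_nonneg_nonneg) auto
      also have "\<dots> = ?C / L" by (simp add: mult_ac)
      finally show "norm (E N) \<le> ?C / ln (real N / 2 + 1)" by (simp add: L_def)
    qed
    show "(\<lambda>N. ?C / ln (real N / 2 + 1)) \<longlonglongrightarrow> 0"
      by (intro tendsto_divide_0[OF tendsto_const] filterlim_at_top_imp_at_infinity) real_asymp
  qed
  then have "\<forall>\<^sub>F N in sequentially. E N < \<epsilon> / 2"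
    by (rule order_tendstoD) (use assms in simp)
  then obtain N1 where N1: "\<And>N. N \<ge> N1 \<Longrightarrow> E N < \<epsilon> / 2" by (auto simp: eventually_sequentially)
  show ?thesis
  proof (rule that[of "max N1 1" M])
    fix N :: nat and x \<sigma> :: real and u v :: "nat \<Rightarrow> real"
    assume N: "N \<ge> max N1 1" and \<sigma>: "\<bar>\<sigma>\<bar> = 1"
      and uv: "\<And>k. k \<le> N div 2 \<Longrightarrow> u k \<in> cell N k \<and> v k \<in> cell N k"
    define a where "a = (\<lambda>k. x + \<sigma> * u k)"
    define b where "b = (\<lambda>k. x + \<sigma> * v k)"
    define n where "n = N div 2 + 1"
    define l where "l = 4 * pi / (2 * real N + 1)"
    have "l > 0" by (simp add: l_def)
    have disj: "disjoint_family_on (\<lambda>k. open_segment (a k) (b k)) {..<n}"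
      unfolding disjoint_family_on_def
    proof (intro ballI impI)
      fix i j assume ij: "i \<in> {..<n}" "j \<in> {..<n}" "i \<noteq> j"
      have False if "z \<in> open_segment (a i) (b i)" "z \<in> open_segment (a j) (b j)" for z
        using cell_inj[OF cell_convex[of "u i" N i "v i"] cell_convex[of "u j" N j "v j"]]
          that ij uv[of i] uv[of j] \<sigma> by (auto simp: a_def b_def n_def)
      then show "open_segment (a i) (b i) \<inter> open_segment (a j) (b j) = {}" by blast
    qed
    \<comment> \<open>Cell k receives the weight index k + 1, so k \<ge> M means an index beyond the
      threshold M. \<open>?A\<close> collects the cells inside the ball of radius \<eta>.\<close>
    let ?A = "{k\<in>{M..N div 2}. (real k + 1) * l < \<eta>}"
    let ?B = "{M..N div 2} - ?A"
    have near: "(\<Sum>k\<in>?A. log_weight p (Suc k) * \<rho> (a k) (b k)) \<le> \<epsilon> / 2"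
    proof -
      have "(\<Sum>i\<in>Suc ` ?A. log_weight p i * \<rho> (a (i - 1)) (b (i - 1))) \<le> \<epsilon> / 2"
      proof (rule small)
        show "disjoint_family_on (\<lambda>i. open_segment (a (i - 1)) (b (i - 1))) (Suc ` ?A)"
          using disj by (auto simp: disjoint_family_on_def n_def)
        fix i assume "i \<in> Suc ` ?A"
        then obtain k where k: "i = Suc k" "k \<le> N div 2" "(real k + 1) * l < \<eta>" by auto
        have "u k \<le> (real k + 1) * l" "v k \<le> (real k + 1) * l"
          using uv[OF k(2)] by (simp_all add: cell_def l_def)
        moreover have "0 < u k" "0 < v k" using uv[OF k(2)] cell_pos by blast+
        ultimately show "a (i - 1) \<in> ball x \<eta> \<and> b (i - 1) \<in> ball x \<eta>"
          using k \<sigma> by (simp add: a_def b_def dist_real_def abs_mult)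
      qed auto
      then show ?thesis by (simp add: sum.reindex)
    qed
    \<comment> \<open>All points lie on one side of x within distance pi; the period window starts
      at x or ends there accordingly.\<close>
    let ?c = "if \<sigma> = 1 then x else x - 2 * pi"
    have "a k \<in> {?c..?c + 2 * pi} \<and> b k \<in> {?c..?c + 2 * pi}" if "k < n" for k
    proof -
      have "\<sigma> = 1 \<or> \<sigma> = -1" using \<sigma> by linarith
      moreover have "k \<le> N div 2" using that by (simp add: n_def)
      then have "0 < u k" "0 < v k" "u k \<le> pi" "v k \<le> pi"
        using uv cell_pos cell_le_pi by blast+
      ultimately show ?thesis by (auto simp: a_def b_def)
    qed
    then have avg: "(\<Sum>i=1..n. log_weight p i) * (\<Sum>k<n. \<rho> (a k) (b k)) \<le> real n * V"
      by (rule sum_gauge_le[OF _ disj])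
    have "n \<ge> 1" and n_le: "real n \<le> real N / 2 + 1" and n_ge: "real N / 2 \<le> real n"
      by (simp_all add: n_def)
    have "0 < ln (real N / 2 + 1)" using N by simp
    then have lnpos: "0 < ln (real N / 2 + 1) ^ Suc p" by simp
    have "ln (real N / 2 + 1) ^ Suc p \<le> ln (real n + 1) ^ Suc p"
      using n_ge \<open>0 < ln (real N / 2 + 1)\<close> by (intro power_mono) auto
    also have "\<dots> \<le> real (Suc p) * (\<Sum>i=1..n. log_weight p i)"
      by (rule ln_power_le_sum_log_weight)
    finally have W: "ln (real N / 2 + 1) ^ Suc p \<le> real (Suc p) * (\<Sum>i=1..n. log_weight p i)" .
    have "ln (real N / 2 + 1) ^ Suc p * (\<Sum>k<n. \<rho> (a k) (b k)) \<le>
        real (Suc p) * (\<Sum>i=1..n. log_weight p i) * (\<Sum>k<n. \<rho> (a k) (b k))"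
      by (intro mult_right_mono W sum_nonneg nonneg)
    also have "\<dots> \<le> real (Suc p) * (real n * V)"
      using avg by (simp add: mult.assoc mult_left_mono del: of_nat_Suc)
    also have "\<dots> \<le> real (Suc p) * ((real N / 2 + 1) * V)"
      using n_le V_nonneg by (intro mult_left_mono mult_right_mono) auto
    finally have sum_le: "(\<Sum>k<n. \<rho> (a k) (b k)) \<le>
        (real N / 2 + 1) * V * real (Suc p) / ln (real N / 2 + 1) ^ Suc p"
      using lnpos by (simp add: pos_le_divide_eq mult_ac del: of_nat_Suc power_Suc)
    have weight_far: "log_weight p (Suc k) \<le> ln (real N + 2) ^ p * l / \<eta>" if "k \<in> ?B" for k
    proof -
      have "(real k + 1) * l \<ge> \<eta>" using that by auto
      then have 1: "1 / (real k + 1) \<le> l / \<eta>" using \<eta> by (simp add: field_simps)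
      have "k \<le> N" using that by auto
      then have "ln (real k + 2) ^ p \<le> ln (real N + 2) ^ p" by (intro power_mono) auto
      then have "ln (real k + 2) ^ p * (1 / (real k + 1)) \<le> ln (real N + 2) ^ p * (l / \<eta>)"
        using 1 by (intro mult_mono) auto
      then show ?thesis by (simp add: log_weight_def add_ac)
    qed
    have "(\<Sum>k\<in>?B. log_weight p (Suc k) * \<rho> (a k) (b k)) \<le>
        (\<Sum>k\<in>?B. ln (real N + 2) ^ p * l / \<eta> * \<rho> (a k) (b k))"
      by (intro sum_mono mult_right_mono weight_far nonneg)
    also have "\<dots> = ln (real N + 2) ^ p * l / \<eta> * (\<Sum>k\<in>?B. \<rho> (a k) (b k))"
      by (rule sum_distrib_left[symmetric])
    also have "\<dots> \<le> ln (real N + 2) ^ p * l / \<eta> * (\<Sum>k<n. \<rho> (a k) (b k))"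
      using \<open>l > 0\<close> \<eta> by (intro mult_left_mono sum_mono2 nonneg) (auto simp: n_def)
    also have "\<dots> \<le> E N"
      unfolding E_def l_def[symmetric] using \<open>l > 0\<close> \<eta> by (intro mult_left_mono sum_le) auto
    also have "\<dots> \<le> \<epsilon> / 2" using N1[of N] N by simp
    finally have far: "(\<Sum>k\<in>?B. log_weight p (Suc k) * \<rho> (a k) (b k)) \<le> \<epsilon> / 2" .
    have "(\<Sum>k=M..N div 2. log_weight p (Suc k) * \<rho> (a k) (b k)) =
        (\<Sum>k\<in>?B. log_weight p (Suc k) * \<rho> (a k) (b k)) + (\<Sum>k\<in>?A. log_weight p (Suc k) * \<rho> (a k) (b k))"
      by (rule sum.subset_diff) auto
    then show "(\<Sum>k=M..N div 2. log_weight p (Suc k) * \<rho> (x + \<sigma> * u k) (x + \<sigma> * v k)) \<le> \<epsilon>"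
      using near far by (simp add: a_def b_def)
  qed
qed

section \<open>The Dirichlet kernel\<close>

text \<open>Normalised as the sum of exp(iku) over -N \<le> k \<le> N, twice the form that begins
  with 1/2; its integral over a period is 2 pi.\<close>

definition dirichlet :: "nat \<Rightarrow> real \<Rightarrow> real" where
  "dirichlet N u = 1 + 2 * (\<Sum>k=1..N. cos (real k * u))"

lemma dirichlet_minus [simp]: "dirichlet N (- u) = dirichlet N u"
  by (simp add: dirichlet_def)

lemma continuous_on_dirichlet [continuous_intros]: "continuous_on A (dirichlet N)"
  unfolding dirichlet_def by (intro continuous_intros)

lemma borel_measurable_dirichlet [measurable]: "dirichlet N \<in> borel_measurable borel"
  by (intro borel_measurable_continuous_onI continuous_intros)

lemma abs_dirichlet_le: "\<bar>dirichlet N u\<bar> \<le> 2 * real N + 1"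
proof -
  have "\<bar>\<Sum>k=1..N. cos (real k * u)\<bar> \<le> (\<Sum>k=1..N. 1)"
    by (rule order_trans[OF sum_abs]) (intro sum_mono abs_cos_le_one)
  then show ?thesis by (simp add: dirichlet_def)
qed

lemma sin_half_mult_dirichlet: "sin (u / 2) * dirichlet N u = sin ((real N + 1 / 2) * u)"
proof (induction N)
  case (Suc N)
  have "2 * sin (u / 2) * cos (real (Suc N) * u) =
      sin (u / 2 + real (Suc N) * u) + sin (u / 2 - real (Suc N) * u)"
    unfolding sin_add sin_diff by simp
  also have "u / 2 - real (Suc N) * u = - ((real N + 1 / 2) * u)" by (simp add: algebra_simps)
  also have "u / 2 + real (Suc N) * u = (real (Suc N) + 1 / 2) * u" by (simp add: algebra_simps)
  finally have "2 * sin (u / 2) * cos (real (Suc N) * u) =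
      sin ((real (Suc N) + 1 / 2) * u) - sin ((real N + 1 / 2) * u)" by simp
  moreover have "sin (u / 2) * dirichlet (Suc N) u =
      sin (u / 2) * dirichlet N u + 2 * sin (u / 2) * cos (real (Suc N) * u)"
    by (simp add: dirichlet_def algebra_simps)
  ultimately show ?case using Suc by simp
qed (simp add: dirichlet_def)

lemma sum_exp_eq_dirichlet:
  "(\<Sum>k=-int N..int N. exp (\<i> * of_real (of_int k * u))) = of_real (dirichlet N u)"
proof (induction N)
  case (Suc N)
  have "{- int (Suc N)..int (Suc N)} = insert (int (Suc N)) (insert (- int (Suc N)) {- int N..int N})"
    by auto
  then have "(\<Sum>k=-int (Suc N)..int (Suc N). exp (\<i> * of_real (of_int k * u))) =
      exp (\<i> * of_real (real (Suc N) * u)) + (exp (\<i> * of_real (- (real (Suc N) * u))) + of_real (dirichlet N u))"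
    using Suc by (simp add: algebra_simps minus_add_distrib)
  also have "\<dots> = cis (real (Suc N) * u) + (cis (- (real (Suc N) * u)) + of_real (dirichlet N u))"
    by (simp only: cis_conv_exp)
  also have "\<dots> = of_real (dirichlet N u + 2 * cos (real (Suc N) * u))"
    by (simp only: complex_eq_iff plus_complex.sel cis.sel Re_complex_of_real Im_complex_of_real cos_minus sin_minus) simp
  also have "dirichlet N u + 2 * cos (real (Suc N) * u) = dirichlet (Suc N) u"
    by (simp add: dirichlet_def)
  finally show ?case .
qed (simp add: dirichlet_def)

text \<open>Jordan's inequality: a concave function lies above its chord.\<close>

lemma sin_ge_two_over_pi:
  assumes "0 \<le> x" "x \<le> pi / 2"
  shows "2 * x / pi \<le> sin x"
proof -
  have "concave_on {0..pi / 2} sin"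
  proof (rule f''_le0_imp_concave)
    show "(sin has_real_derivative cos x) (at x)" "(cos has_real_derivative - sin x) (at x)" for x :: real
      by (auto intro!: derivative_eq_intros)
    show "- sin x \<le> 0" if "x \<in> {0..pi / 2}" for x using that by (simp add: sin_ge_zero)
  qed auto
  then have "(1 - 2 * x / pi) * sin 0 + (2 * x / pi) * sin (pi / 2) \<le>
      sin ((1 - 2 * x / pi) *\<^sub>R 0 + (2 * x / pi) *\<^sub>R (pi / 2))"
    using assms by (intro concave_onD) (auto simp: field_simps)
  then show ?thesis by simp
qed

lemma abs_sin_diff_le: "\<bar>sin x - sin y\<bar> \<le> \<bar>x - y :: real\<bar>"
proof -
  have "\<bar>sin x - sin y\<bar> = 2 * \<bar>sin ((x - y) / 2)\<bar> * \<bar>cos ((x + y) / 2)\<bar>"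
    by (simp add: sin_diff_sin abs_mult)
  also have "\<dots> \<le> 2 * \<bar>(x - y) / 2\<bar> * 1"
    by (intro mult_mono abs_cos_le_one abs_sin_x_le_abs_x) auto
  finally show ?thesis by simp
qed

lemma sin_half_ge: "0 \<le> u \<Longrightarrow> u \<le> pi \<Longrightarrow> u / pi \<le> sin (u / 2)"
  using sin_ge_two_over_pi[of "u / 2"] by simp

lemma abs_dirichlet_le_inverse:
  assumes "0 < u" "u \<le> pi"
  shows "\<bar>dirichlet N u\<bar> \<le> pi / u"
proof -
  have "u / pi * \<bar>dirichlet N u\<bar> \<le> sin (u / 2) * \<bar>dirichlet N u\<bar>"
    by (intro mult_right_mono sin_half_ge) (use assms in auto)
  also have "\<dots> = \<bar>sin (u / 2) * dirichlet N u\<bar>"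
    using assms by (simp add: abs_mult sin_ge_zero)
  also have "\<dots> \<le> 1" unfolding sin_half_mult_dirichlet by (rule abs_sin_le_one)
  finally show ?thesis using assms by (simp add: field_simps)
qed

section \<open>The Dirichlet kernel on a single cell\<close>

definition cell_kernel :: "real \<Rightarrow> nat \<Rightarrow> nat \<Rightarrow> real \<Rightarrow> real" where
  "cell_kernel \<sigma> N k u = indicator (cell N k) (\<sigma> * u) * dirichlet N u"

lemma cell_borel [measurable]: "cell N k \<in> sets borel"
  unfolding cell_def by measurable

lemma borel_measurable_cell_kernel [measurable]: "cell_kernel \<sigma> N k \<in> borel_measurable borel"
  unfolding cell_kernel_def by measurable

lemma cell_kernel_reflect: "\<bar>\<sigma>\<bar> = 1 \<Longrightarrow> cell_kernel \<sigma> N k u = cell_kernel 1 N k (\<sigma> * u)"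
  by (cases "\<sigma> = 1") (auto simp: cell_kernel_def abs_if split: if_splits)

lemma
  assumes "\<bar>\<sigma>\<bar> = 1"
  shows integrable_cell_kernel: "integrable lborel (cell_kernel \<sigma> N k)"
    and integral_abs_cell_kernel: "(\<integral>u. \<bar>cell_kernel \<sigma> N k u\<bar> \<partial>lborel) \<le> 4 * pi / (real k + 1)"
    and integral_cell_kernel: "k < N div 2 \<Longrightarrow> \<bar>\<integral>u. cell_kernel \<sigma> N k u \<partial>lborel\<bar> \<le> 32 / (real k + 1)\<^sup>2"
proof -
  define l where "l = 4 * pi / (2 * real N + 1)"
  have "l > 0" by (simp add: l_def)
  define C where "C = (if k = 0 then 2 * real N + 1 else pi / (real k * l))"
  have "C \<ge> 0" using \<open>l > 0\<close> by (simp add: C_def)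
  let ?I = "{real k * l..(real k + 1) * l}"
  have box: "has_bochner_integral lborel (\<lambda>u. D * indicator ?I u) (D * l)" for D :: real
  proof -
    have "has_bochner_integral lborel (indicator ?I) (measure lborel ?I :: real)"
      using \<open>l > 0\<close> by (intro has_bochner_integral_real_indicator) auto
    then have "has_bochner_integral lborel (\<lambda>u. D * indicator ?I u) (D * measure lborel ?I)"
      by (rule has_bochner_integral_mult_right)
    then show ?thesis using \<open>l > 0\<close> by (simp add: algebra_simps)
  qed
  note ibox = integrable.intros[OF box] and Ibox = has_bochner_integral_integral_eq[OF box]
  have bound: "\<bar>cell_kernel 1 N k u\<bar> \<le> C * indicator ?I u" for u
  proof (cases "u \<in> cell N k")
    case True
    then have u: "real k * l < u" "u \<le> (real k + 1) * l" "u \<le> pi" "0 < u"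
      using cell_pos[OF True] True unfolding cell_def l_def by auto
    have "\<bar>dirichlet N u\<bar> \<le> C"
    proof (cases "k = 0")
      case False
      have "\<bar>dirichlet N u\<bar> \<le> pi / u" using u by (intro abs_dirichlet_le_inverse) auto
      also have "\<dots> \<le> pi / (real k * l)" using u False \<open>l > 0\<close> by (intro divide_left_mono) auto
      finally show ?thesis using False by (simp add: C_def)
    qed (use abs_dirichlet_le in \<open>simp add: C_def\<close>)
    then show ?thesis using True u by (simp add: cell_kernel_def abs_mult)
  qed (use \<open>C \<ge> 0\<close> in \<open>simp add: cell_kernel_def\<close>)
  have int1: "integrable lborel (cell_kernel 1 N k)"
    by (rule Bochner_Integration.integrable_bound[OF ibox[of C]])
      (use bound \<open>C \<ge> 0\<close> in \<open>auto simp: abs_mult\<close>)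
  have refl: "cell_kernel \<sigma> N k = (\<lambda>u. cell_kernel 1 N k (0 + \<sigma> * u))"
    using cell_kernel_reflect[OF assms] by auto
  have "\<sigma> \<noteq> 0" using assms by auto
  show "integrable lborel (cell_kernel \<sigma> N k)"
    unfolding refl by (rule lborel_integrable_real_affine[OF int1 \<open>\<sigma> \<noteq> 0\<close>])
  have same: "(\<integral>u. F (cell_kernel \<sigma> N k u) \<partial>lborel) = (\<integral>u. F (cell_kernel 1 N k u) \<partial>lborel)"
    for F :: "real \<Rightarrow> real"
    using lborel_integral_real_affine[OF \<open>\<sigma> \<noteq> 0\<close>, of "\<lambda>u. F (cell_kernel 1 N k u)" 0] assms
    by (simp add: refl)
  have "(\<integral>u. \<bar>cell_kernel 1 N k u\<bar> \<partial>lborel) \<le> (\<integral>u. C * indicator ?I u \<partial>lborel)"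
    by (intro integral_mono integrable_abs int1 ibox bound)
  also have "\<dots> = C * l" by (rule Ibox)
  also have "\<dots> \<le> 4 * pi / (real k + 1)"
  proof (cases "k = 0")
    case True
    then show ?thesis by (simp add: C_def l_def)
  next
    case False
    then show ?thesis using \<open>l > 0\<close> by (simp add: C_def field_simps)
  qed
  finally have abs1: "(\<integral>u. \<bar>cell_kernel 1 N k u\<bar> \<partial>lborel) \<le> 4 * pi / (real k + 1)" .
  then show "(\<integral>u. \<bar>cell_kernel \<sigma> N k u\<bar> \<partial>lborel) \<le> 4 * pi / (real k + 1)"
    using same[of abs] by simp
  assume "k < N div 2"
  have "\<bar>\<integral>u. cell_kernel 1 N k u \<partial>lborel\<bar> \<le> 32 / (real k + 1)\<^sup>2"
  proof (cases "k = 0")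
    case True
    have "\<bar>\<integral>u. cell_kernel 1 N k u \<partial>lborel\<bar> \<le> (\<integral>u. \<bar>cell_kernel 1 N k u\<bar> \<partial>lborel)"
      by (rule integral_abs_bound)
    also have "\<dots> \<le> 16" using abs1 True pi_less_4 by simp
    finally show ?thesis using True by simp
  next
    case False
    \<comment> \<open>Below \<open>N div 2\<close> the cell is a full period, which the cancellation
      requires.\<close>
    have kpi: "(real k + 1) * l \<le> pi"
    proof -
      have "real k + 1 \<le> real N / 2" using \<open>k < N div 2\<close> by linarith
      then have "(real k + 1) * l \<le> real N / 2 * l" using \<open>l > 0\<close> by (intro mult_right_mono) auto
      also have "\<dots> \<le> pi" by (simp add: l_def field_simps)
      finally show ?thesis .
    qed
    define a where "a = real k * l"
    have "a > 0" using False \<open>l > 0\<close> by (simp add: a_def)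
    have al: "(real k + 1) * l = a + l" by (simp add: a_def algebra_simps)
    have "a \<le> pi" using kpi \<open>l > 0\<close> unfolding al by linarith
    define c where "c = 1 / sin (a / 2)"
    have sina: "a / pi \<le> sin (a / 2)" using \<open>a > 0\<close> \<open>a \<le> pi\<close> by (intro sin_half_ge) auto
    have "a / pi > 0" using \<open>a > 0\<close> by simp
    define \<nu> where "\<nu> = real N + 1 / 2"
    have "\<nu> > 0" by (simp add: \<nu>_def)
    let ?s = "\<lambda>u. sin (\<nu> * u)"
    let ?F = "\<lambda>u. - cos (\<nu> * u) / \<nu>"
    have "has_bochner_integral lborel (\<lambda>u. ?s u * indicator {a..a + l} u) (?F (a + l) - ?F a)"
    proof (rule has_bochner_integral_FTC_Icc_real)
      show "(?F has_real_derivative ?s u) (at u)" for u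
        using \<open>\<nu> > 0\<close> by (auto intro!: derivative_eq_intros)
      show "isCont ?s u" for u by (intro continuous_intros)
    qed (use \<open>l > 0\<close> in auto)
    moreover have "\<nu> * (a + l) = \<nu> * a + 2 * pi"
      by (simp add: l_def \<nu>_def field_simps)
    ultimately have "has_bochner_integral lborel (\<lambda>u. ?s u * indicator {a..a + l} u) 0" by simp
    from has_bochner_integral_mult_right[OF this, of c]
    have s_int: "has_bochner_integral lborel (\<lambda>u. c * (?s u * indicator {a..a + l} u)) 0" by simp
    define D where "D = (l / 2) * (pi / a)\<^sup>2"
    have "D \<ge> 0" using \<open>l > 0\<close> by (simp add: D_def)
    \<comment> \<open>The end point a lies in the closed interval of integration but not in the
      half-open cell; as a single point it is negligible.\<close>
    have diff: "\<bar>cell_kernel 1 N k u - c * (?s u * indicator {a..a + l} u)\<bar> \<le> D * indicator ?I u"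
      if "u \<noteq> a" for u
    proof (cases "u \<in> {a..a + l}")
      case True
      then have u: "a < u" "u \<le> a + l" "u \<le> pi" using that kpi unfolding al by auto
      then have cell: "u \<in> cell N k"
        unfolding cell_def l_def[symmetric] using al by (simp add: a_def)
      have "sin (a / 2) \<le> sin (u / 2)"
        using u \<open>a > 0\<close> by (intro sin_monotone_2pi_le) auto
      then have pos: "a / pi \<le> sin (u / 2)" using sina by linarith
      have "\<bar>sin (u / 2) - sin (a / 2)\<bar> \<le> \<bar>u / 2 - a / 2\<bar>"
        by (rule abs_sin_diff_le)
      then have sd: "\<bar>sin (a / 2) - sin (u / 2)\<bar> \<le> l / 2" using u by linarith
      have nz: "sin (u / 2) > 0" "sin (a / 2) > 0" using pos sina \<open>a / pi > 0\<close> by linarith+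
      have "sin (u / 2) * dirichlet N u = ?s u" by (simp add: \<nu>_def sin_half_mult_dirichlet)
      then have "dirichlet N u = ?s u / sin (u / 2)"
        using nz by (simp add: nonzero_eq_divide_eq mult.commute)
      then have "cell_kernel 1 N k u - c * (?s u * indicator {a..a + l} u) =
          ?s u * ((sin (a / 2) - sin (u / 2)) / (sin (u / 2) * sin (a / 2)))"
        using cell True nz by (simp add: cell_kernel_def c_def field_simps)
      then have "\<bar>cell_kernel 1 N k u - c * (?s u * indicator {a..a + l} u)\<bar> =
          \<bar>?s u\<bar> * (\<bar>sin (a / 2) - sin (u / 2)\<bar> / (sin (u / 2) * sin (a / 2)))"
        using nz by (simp add: abs_mult)
      also have "\<dots> \<le> 1 * ((l / 2) / (a / pi * (a / pi)))"
        using pos sina \<open>a > 0\<close> sd \<open>l > 0\<close> nz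
        by (intro mult_mono frac_le mult_pos_pos mult_nonneg_nonneg divide_nonneg_nonneg) auto
      also have "\<dots> = D" by (simp add: D_def power2_eq_square)
      finally show ?thesis using True al by (simp add: a_def)
    next
      case False
      then have "u \<notin> cell N k" unfolding cell_def l_def[symmetric] using al by (auto simp: a_def)
      then show ?thesis using False \<open>D \<ge> 0\<close> by (simp add: cell_kernel_def)
    qed
    have "(\<integral>u. cell_kernel 1 N k u \<partial>lborel) =
        (\<integral>u. cell_kernel 1 N k u - c * (?s u * indicator {a..a + l} u) \<partial>lborel)"
      by (subst Bochner_Integration.integral_diff[OF int1 integrable.intros[OF s_int]])
        (simp only: has_bochner_integral_integral_eq[OF s_int] diff_zero)
    also have "\<bar>\<dots>\<bar> \<le> (\<integral>u. \<bar>cell_kernel 1 N k u - c * (?s u * indicator {a..a + l} u)\<bar> \<partial>lborel)"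
      by (rule integral_abs_bound)
    also have "\<dots> \<le> (\<integral>u. D * indicator ?I u \<partial>lborel)"
    proof (rule integral_mono_AE)
      show "integrable lborel (\<lambda>u. \<bar>cell_kernel 1 N k u - c * (?s u * indicator {a..a + l} u)\<bar>)"
        by (intro integrable_abs Bochner_Integration.integrable_diff int1 integrable.intros[OF s_int])
      show "integrable lborel (\<lambda>u. D * indicator ?I u)"
        by (rule ibox)
      show "AE u in lborel. \<bar>cell_kernel 1 N k u - c * (?s u * indicator {a..a + l} u)\<bar> \<le> D * indicator ?I u"
        using AE_lborel_singleton[of a] by eventually_elim (rule diff)
    qed
    also have "\<dots> = D * l" by (rule Ibox)
    also have "\<dots> = pi\<^sup>2 / (2 * (real k)\<^sup>2)"
      using False \<open>l > 0\<close> by (simp add: D_def a_def power2_eq_square field_simps)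
    \<comment> \<open>From pi < 4 one gets 8/k^2, and k + 1 \<le> 2k turns this into
      32/(k+1)^2.\<close>
    also have "\<dots> \<le> 4\<^sup>2 / (2 * (real k)\<^sup>2)"
      using pi_less_4 by (intro divide_right_mono power_mono) auto
    also have "\<dots> \<le> 32 / (real k + 1)\<^sup>2"
    proof -
      have "(real k + 1)\<^sup>2 \<le> (2 * real k)\<^sup>2" using False by (intro power_mono) auto
      then show ?thesis using False by (simp add: field_simps)
    qed
    finally show ?thesis .
  qed
  then show "\<bar>\<integral>u. cell_kernel \<sigma> N k u \<partial>lborel\<bar> \<le> 32 / (real k + 1)\<^sup>2"
    using same[of "\<lambda>x. x"] by simp
qed

text \<open>Every sin(ku) vanishes at 0 and at pi, so only the constant term counts. That both
  halves of the period carry the same mass pi is the origin of the unweighted average over octants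
  in \<open>octant_mean\<close>.\<close>

lemma integral_dirichlet_half:
  assumes "\<bar>\<sigma>\<bar> = 1"
  shows "has_bochner_integral lborel (\<lambda>u. indicator {0<..pi} (\<sigma> * u) * dirichlet N u) pi"
proof -
  let ?F = "\<lambda>u. u + 2 * (\<Sum>k=1..N. sin (real k * u) / real k)"
  have "has_bochner_integral lborel (\<lambda>u. dirichlet N u * indicator {0..pi} u) (?F pi - ?F 0)"
  proof (rule has_bochner_integral_FTC_Icc_real)
    show "(?F has_real_derivative dirichlet N u) (at u)" for u
      unfolding dirichlet_def by (auto intro!: derivative_eq_intros sum.cong)
    show "isCont (dirichlet N) u" for u
      using continuous_on_dirichlet[of UNIV] by (simp add: continuous_on_eq_continuous_at)
  qed auto
  then have "has_bochner_integral lborel (\<lambda>u. dirichlet N u * indicator {0..pi} u) pi" by simp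
  moreover have "AE u in lborel. dirichlet N u * indicator {0..pi} u = indicator {0<..pi} u * dirichlet N u"
    using AE_lborel_singleton[of 0] by eventually_elim (auto split: split_indicator)
  ultimately have 1: "has_bochner_integral lborel (\<lambda>u. indicator {0<..pi} u * dirichlet N u) pi"
    by (subst has_bochner_integral_cong_AE[symmetric, rotated 2]) auto
  have "\<sigma> = 1 \<or> \<sigma> = -1" using assms by linarith
  then show ?thesis
  proof
    assume "\<sigma> = -1"
    with lborel_has_bochner_integral_real_affine_iff[of "-1" "\<lambda>u. indicator {0<..pi} u * dirichlet N u" pi 0] 1
    show ?thesis by simp
  qed (use 1 in simp)
qed

section \<open>Integrals of products over boxes\<close>

lemma borel_measurable_vec_lambda:
  fixes f :: "'a \<Rightarrow> 'n::finite \<Rightarrow> real"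
  assumes "\<And>i. (\<lambda>x. f x i) \<in> borel_measurable M"
  shows "(\<lambda>x. \<chi> i. f x i) \<in> borel_measurable M"
  by (subst borel_measurable_euclidean_space) (use assms in \<open>auto simp: Basis_vec_def inner_axis\<close>)

lemma vec_lambda_measurable_PiM [measurable]:
  "vec_lambda \<in> borel_measurable (Pi\<^sub>M (UNIV :: 'n::finite set) (\<lambda>_. lborel :: real measure))"
proof -
  have "(\<lambda>\<omega>. \<omega> i) \<in> borel_measurable (Pi\<^sub>M (UNIV :: 'n set) (\<lambda>_. lborel :: real measure))" for i
    using measurable_component_singleton[of i UNIV "\<lambda>_::'n. lborel :: real measure"] by simp
  from borel_measurable_vec_lambda[of "\<lambda>\<omega>. \<omega>", OF this] show ?thesis by simp
qed

text \<open>Presents Lebesgue measure on vectors as a product measure over the index type, so that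
  Fubini applies to one coordinate at a time.\<close>

lemma lborel_vec_eq:
  "(lborel :: (real ^ 'n::finite) measure) = distr (Pi\<^sub>M UNIV (\<lambda>_. lborel)) borel (\<lambda>\<omega>. \<chi> i. \<omega> i)"
proof (rule lborel_eqI)
  interpret product_sigma_finite "\<lambda>_::'n. lborel :: real measure" by standard
  fix l u :: "real ^ 'n"
  assume le: "\<And>b. b \<in> Basis \<Longrightarrow> l \<bullet> b \<le> u \<bullet> b"
  have le': "l $ i \<le> u $ i" for i
    using le[of "axis i 1"] by (auto simp: Basis_vec_def inner_axis)
  have "(\<lambda>\<omega>. \<chi> i. \<omega> i) -` box l u \<inter> space (Pi\<^sub>M UNIV (\<lambda>_. lborel)) = Pi\<^sub>E UNIV (\<lambda>i. {l $ i<..<u $ i})"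
    by (auto simp: mem_box_cart space_PiM PiE_def Pi_def extensional_def)
  then have "emeasure (distr (Pi\<^sub>M UNIV (\<lambda>_. lborel)) borel (\<lambda>\<omega>. \<chi> i. \<omega> i)) (box l u) =
      emeasure (Pi\<^sub>M UNIV (\<lambda>_. lborel)) (Pi\<^sub>E UNIV (\<lambda>i. {l $ i<..<u $ i}))"
    by (subst emeasure_distr) auto
  also have "\<dots> = (\<Prod>i\<in>UNIV. ennreal (u $ i - l $ i))"
    using le' by (subst emeasure_PiM) auto
  also have "\<dots> = ennreal (\<Prod>i\<in>UNIV. u $ i - l $ i)"
    using le' by (intro prod_ennreal) auto
  also have "(\<Prod>i\<in>UNIV. u $ i - l $ i) = (\<Prod>b\<in>Basis. (u - l) \<bullet> b)"
  proof -
    have B: "Basis = range (\<lambda>i::'n. axis i (1::real))" by (auto simp: Basis_vec_def)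
    have "inj (\<lambda>i::'n. axis i (1::real))" by (auto simp: inj_def axis_eq_axis)
    then show ?thesis unfolding B by (simp add: prod.reindex inner_axis)
  qed
  finally show "emeasure (distr (Pi\<^sub>M UNIV (\<lambda>_. lborel)) borel (\<lambda>\<omega>. \<chi> i. \<omega> i)) (box l u) =
      ennreal (\<Prod>b\<in>Basis. (u - l) \<bullet> b)" .
qed simp

context
  fixes \<phi> :: "'n::finite \<Rightarrow> real \<Rightarrow> real"
  assumes \<phi>: "\<And>j. integrable lborel (\<phi> j)"
begin

interpretation product_sigma_finite "\<lambda>_::'n. lborel :: real measure" by standard

lemma measurable_phi: "\<phi> j \<in> borel_measurable borel"
  using borel_measurable_integrable[OF \<phi>] by simp

lemma integrable_prod_vec: "integrable lborel (\<lambda>x::real ^ 'n. \<Prod>j\<in>UNIV. \<phi> j (x $ j))"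
  unfolding lborel_vec_eq using measurable_phi
  by (subst integrable_distr_eq) (auto intro!: product_integrable_prod \<phi>)

lemma integral_prod_vec:
  "(\<integral>x. (\<Prod>j\<in>UNIV. \<phi> j (x $ j)) \<partial>(lborel :: (real ^ 'n) measure)) = (\<Prod>j\<in>UNIV. integral\<^sup>L lborel (\<phi> j))"
  unfolding lborel_vec_eq using measurable_phi
  by (subst integral_distr) (auto intro!: product_integral_prod \<phi>)

end

text \<open>The bound on g is asked for only where no factor vanishes; with cell kernels as factors
  it becomes a local bound on one product cell.\<close>

lemma
  fixes g :: "real ^ 'n::finite \<Rightarrow> complex" and \<phi> :: "'n \<Rightarrow> real \<Rightarrow> real"
  assumes \<phi>: "\<And>j. integrable lborel (\<phi> j)" and g [measurable]: "g \<in> borel_measurable borel"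
    and G: "\<And>x. (\<And>j. \<phi> j (x $ j) \<noteq> 0) \<Longrightarrow> norm (g x) \<le> G"
  shows integrable_mult_prod: "integrable lborel (\<lambda>x. g x * of_real (\<Prod>j\<in>UNIV. \<phi> j (x $ j)))"
    and norm_integral_mult_prod_le:
      "norm (\<integral>x. g x * of_real (\<Prod>j\<in>UNIV. \<phi> j (x $ j)) \<partial>lborel) \<le> G * (\<Prod>j\<in>UNIV. \<integral>u. \<bar>\<phi> j u\<bar> \<partial>lborel)"
proof -
  have [measurable]: "\<phi> j \<in> borel_measurable borel" for j by (rule measurable_phi[of \<phi>, OF \<phi>])
  have abs: "integrable lborel (\<lambda>u. \<bar>\<phi> j u\<bar>)" for j using \<phi> by auto
  have bound: "norm (g x * of_real (\<Prod>j\<in>UNIV. \<phi> j (x $ j))) \<le> G * (\<Prod>j\<in>UNIV. \<bar>\<phi> j (x $ j)\<bar>)" for x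
  proof (cases "\<forall>j. \<phi> j (x $ j) \<noteq> 0")
    case True
    then have "norm (g x) \<le> G" using G by blast
    then show ?thesis by (simp add: norm_mult mult_right_mono prod_nonneg flip: prod_norm)
  next
    case False
    then have "(\<Prod>j\<in>UNIV. \<phi> j (x $ j)) = 0" by auto
    then show ?thesis by (simp only: flip: abs_prod) simp
  qed
  have intb: "integrable lborel (\<lambda>x::real ^ 'n. G * (\<Prod>j\<in>UNIV. \<bar>\<phi> j (x $ j)\<bar>))"
    by (intro integrable_mult_right integrable_prod_vec abs)
  have meas: "(\<lambda>x::real ^ 'n. \<phi> j (x $ j)) \<in> borel_measurable borel" for j
    by measurable
  show int: "integrable lborel (\<lambda>x. g x * of_real (\<Prod>j\<in>UNIV. \<phi> j (x $ j)))"
    by (rule Bochner_Integration.integrable_bound[OF intb])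
      (use meas in \<open>auto intro!: AE_I2 order_trans[OF bound] simp del: of_real_prod\<close>)
  have "norm (\<integral>x. g x * of_real (\<Prod>j\<in>UNIV. \<phi> j (x $ j)) \<partial>lborel) \<le>
      (\<integral>x. G * (\<Prod>j\<in>UNIV. \<bar>\<phi> j (x $ j)\<bar>) \<partial>lborel)"
    by (rule Bochner_Integration.integral_norm_bound_integral[OF int intb bound])
  also have "\<dots> = G * (\<Prod>j\<in>UNIV. \<integral>u. \<bar>\<phi> j u\<bar> \<partial>lborel)"
    using integral_prod_vec[of "\<lambda>j u. \<bar>\<phi> j u\<bar>", OF abs] by simp
  finally show "norm (\<integral>x. g x * of_real (\<Prod>j\<in>UNIV. \<phi> j (x $ j)) \<partial>lborel) \<le>
      G * (\<Prod>j\<in>UNIV. \<integral>u. \<bar>\<phi> j u\<bar> \<partial>lborel)" .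
qed

text \<open>Freezing the coordinate \<open>s\<close> of \<open>g\<close> costs at most the oscillation \<open>\<omega>\<close>; the frozen function
  only sees the mean of \<open>\<phi> s\<close>.\<close>

lemma norm_integral_mult_prod_osc:
  fixes g :: "real ^ 'n::finite \<Rightarrow> complex" and \<phi> :: "'n \<Rightarrow> real \<Rightarrow> real"
  assumes \<phi>: "\<And>j. integrable lborel (\<phi> j)" and g [measurable]: "g \<in> borel_measurable borel"
    and G: "\<And>x. norm (g x) \<le> G"
    and osc: "\<And>x u v. \<phi> s u \<noteq> 0 \<Longrightarrow> \<phi> s v \<noteq> 0 \<Longrightarrow>
      norm (g (\<chi> j. if j = s then u else x $ j) - g (\<chi> j. if j = s then v else x $ j)) \<le> \<omega>"
  shows "norm (\<integral>x. g x * of_real (\<Prod>j\<in>UNIV. \<phi> j (x $ j)) \<partial>lborel) \<le>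
    (\<Prod>j\<in>UNIV - {s}. \<integral>u. \<bar>\<phi> j u\<bar> \<partial>lborel) * (G * \<bar>\<integral>u. \<phi> s u \<partial>lborel\<bar> + \<omega> * (\<integral>u. \<bar>\<phi> s u\<bar> \<partial>lborel))"
\<comment> \<open>If the s-th factor vanishes identically, both sides are 0. Otherwise a point c of
  its support serves for freezing the coordinate s.\<close>
proof (cases "\<exists>c. \<phi> s c \<noteq> 0")
  case True
  then obtain c where c: "\<phi> s c \<noteq> 0" ..
  interpret product_sigma_finite "\<lambda>_::'n. lborel :: real measure" by standard
  have [measurable]: "\<phi> j \<in> borel_measurable borel" for j by (rule measurable_phi[of \<phi>, OF \<phi>])
  let ?P = "\<lambda>x::real ^ 'n. of_real (\<Prod>j\<in>UNIV. \<phi> j (x $ j)) :: complex"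
  define h where "h = (\<lambda>x::real ^ 'n. g (\<chi> j. if j = s then c else x $ j))"
  have h [measurable]: "h \<in> borel_measurable borel" unfolding h_def
    by (rule measurable_compose[OF _ g], rule borel_measurable_vec_lambda) measurable
  have diff: "norm (g x - h x) \<le> \<omega>" if "\<And>j. \<phi> j (x $ j) \<noteq> 0" for x
  proof -
    have "(\<chi> j. if j = s then x $ s else x $ j) = x" by (simp add: vec_eq_iff)
    then show ?thesis using osc[of "x $ s" c x] that c by (simp add: h_def)
  qed
  have 1: "norm (\<integral>x. (g x - h x) * ?P x \<partial>lborel) \<le> \<omega> * (\<Prod>j\<in>UNIV. \<integral>u. \<bar>\<phi> j u\<bar> \<partial>lborel)"
    by (intro norm_integral_mult_prod_le \<phi> borel_measurable_diff g h diff)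
  have int_g: "integrable lborel (\<lambda>x. g x * ?P x)" by (rule integrable_mult_prod[OF \<phi> g G])
  have int_h: "integrable lborel (\<lambda>x. h x * ?P x)"
    by (rule integrable_mult_prod[OF \<phi> h, where G=G]) (simp add: h_def G)
  define H where "H = (\<lambda>\<omega>::'n \<Rightarrow> real. g (\<chi> j. if j = s then c else \<omega> j) * of_real (\<Prod>j\<in>UNIV - {s}. \<phi> j (\<omega> j)))"
  have ins: "insert s (UNIV - {s}) = (UNIV :: 'n set)" by auto
  have "(\<integral>x. h x * ?P x \<partial>lborel) = (\<integral>\<omega>. h (\<chi> i. \<omega> i) * ?P (\<chi> i. \<omega> i) \<partial>Pi\<^sub>M UNIV (\<lambda>_. lborel))"
    unfolding lborel_vec_eq using borel_measurable_integrable[OF int_h] by (subst integral_distr) auto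
  also have "\<dots> = (\<integral>\<omega>. h (\<chi> i. \<omega> i) * ?P (\<chi> i. \<omega> i) \<partial>Pi\<^sub>M (insert s (UNIV - {s})) (\<lambda>_. lborel))"
    by (simp only: ins)
  also have "\<dots> = (\<integral>\<omega>. (\<integral>y. h (\<chi> i. (fun_upd \<omega> s y) i) * ?P (\<chi> i. (fun_upd \<omega> s y) i) \<partial>lborel) \<partial>Pi\<^sub>M (UNIV - {s}) (\<lambda>_. lborel))"
  proof (rule product_integral_insert)
    show "integrable (Pi\<^sub>M (insert s (UNIV - {s})) (\<lambda>_. lborel)) (\<lambda>\<omega>. h (\<chi> i. \<omega> i) * ?P (\<chi> i. \<omega> i))"
      unfolding ins using int_h borel_measurable_integrable[OF int_h]
      unfolding lborel_vec_eq by (subst (asm) integrable_distr_eq) auto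
  qed auto
  also have "\<dots> = (\<integral>\<omega>. H \<omega> * of_real (\<integral>y. \<phi> s y \<partial>lborel) \<partial>Pi\<^sub>M (UNIV - {s}) (\<lambda>_. lborel))"
  proof (rule Bochner_Integration.integral_cong[OF HOL.refl])
    fix \<omega> :: "'n \<Rightarrow> real"
    have "h (\<chi> i. (fun_upd \<omega> s y) i) * ?P (\<chi> i. (fun_upd \<omega> s y) i) = H \<omega> * of_real (\<phi> s y)" for y
    proof -
      have "(\<Prod>j\<in>UNIV. \<phi> j ((\<chi> i. (fun_upd \<omega> s y) i) $ j)) = \<phi> s y * (\<Prod>j\<in>UNIV - {s}. \<phi> j (\<omega> j))"
        by (subst prod.remove[of _ s]) (auto intro!: prod.cong)
      moreover have "(\<chi> j. if j = s then c else (\<chi> i. (fun_upd \<omega> s y) i) $ j) = (\<chi> j. if j = s then c else \<omega> j)"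
        by (simp add: vec_eq_iff)
      ultimately show ?thesis unfolding h_def H_def by (simp only: of_real_mult mult_ac)
    qed
    then show "(\<integral>y. h (\<chi> i. (fun_upd \<omega> s y) i) * ?P (\<chi> i. (fun_upd \<omega> s y) i) \<partial>lborel) =
        H \<omega> * of_real (\<integral>y. \<phi> s y \<partial>lborel)"
      by simp
  qed
  also have "norm \<dots> \<le> (\<integral>\<omega>. norm (H \<omega> * of_real (\<integral>y. \<phi> s y \<partial>lborel)) \<partial>Pi\<^sub>M (UNIV - {s}) (\<lambda>_. lborel))"
    by (rule integral_norm_bound)
  also have "\<dots> \<le> (\<integral>\<omega>. G * \<bar>\<integral>y. \<phi> s y \<partial>lborel\<bar> * (\<Prod>j\<in>UNIV - {s}. \<bar>\<phi> j (\<omega> j)\<bar>) \<partial>Pi\<^sub>M (UNIV - {s}) (\<lambda>_. lborel))"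
  proof (rule integral_mono')
    show "integrable (Pi\<^sub>M (UNIV - {s}) (\<lambda>_. lborel))
        (\<lambda>\<omega>. G * \<bar>\<integral>y. \<phi> s y \<partial>lborel\<bar> * (\<Prod>j\<in>UNIV - {s}. \<bar>\<phi> j (\<omega> j)\<bar>))"
      by (intro integrable_mult_right product_integrable_prod) (auto simp: \<phi>)
    fix \<omega> :: "'n \<Rightarrow> real"
    have "norm (H \<omega>) \<le> G * (\<Prod>j\<in>UNIV - {s}. \<bar>\<phi> j (\<omega> j)\<bar>)"
      using G by (simp add: H_def norm_mult mult_right_mono prod_nonneg flip: prod_norm)
    then have "norm (H \<omega>) * \<bar>\<integral>y. \<phi> s y \<partial>lborel\<bar> \<le>
        (G * (\<Prod>j\<in>UNIV - {s}. \<bar>\<phi> j (\<omega> j)\<bar>)) * \<bar>\<integral>y. \<phi> s y \<partial>lborel\<bar>"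
      by (rule mult_right_mono) simp
    then show "norm (H \<omega> * of_real (\<integral>y. \<phi> s y \<partial>lborel)) \<le>
        G * \<bar>\<integral>y. \<phi> s y \<partial>lborel\<bar> * (\<Prod>j\<in>UNIV - {s}. \<bar>\<phi> j (\<omega> j)\<bar>)"
      by (simp add: norm_mult mult_ac)
    have "G \<ge> 0" using G[of 0] norm_ge_zero order_trans by blast
    then show "0 \<le> G * \<bar>\<integral>y. \<phi> s y \<partial>lborel\<bar> * (\<Prod>j\<in>UNIV - {s}. \<bar>\<phi> j (\<omega> j)\<bar>)"
      by (intro mult_nonneg_nonneg prod_nonneg) auto
  qed
  also have "\<dots> = G * \<bar>\<integral>y. \<phi> s y \<partial>lborel\<bar> * (\<Prod>j\<in>UNIV - {s}. \<integral>u. \<bar>\<phi> j u\<bar> \<partial>lborel)"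
    using product_integral_prod[of "UNIV - {s}" "\<lambda>j u. \<bar>\<phi> j u\<bar>"] \<phi> by simp
  finally have 2: "norm (\<integral>x. h x * ?P x \<partial>lborel) \<le>
      G * \<bar>\<integral>y. \<phi> s y \<partial>lborel\<bar> * (\<Prod>j\<in>UNIV - {s}. \<integral>u. \<bar>\<phi> j u\<bar> \<partial>lborel)" .
  have "(\<integral>x. g x * ?P x \<partial>lborel) = (\<integral>x. (g x - h x) * ?P x \<partial>lborel) + (\<integral>x. h x * ?P x \<partial>lborel)"
    using int_g int_h by (simp add: left_diff_distrib)
  then have "norm (\<integral>x. g x * ?P x \<partial>lborel) \<le>
      norm (\<integral>x. (g x - h x) * ?P x \<partial>lborel) + norm (\<integral>x. h x * ?P x \<partial>lborel)"
    by (simp only: norm_triangle_ineq)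
  also have "\<dots> \<le> \<omega> * (\<Prod>j\<in>UNIV. \<integral>u. \<bar>\<phi> j u\<bar> \<partial>lborel) +
      G * \<bar>\<integral>y. \<phi> s y \<partial>lborel\<bar> * (\<Prod>j\<in>UNIV - {s}. \<integral>u. \<bar>\<phi> j u\<bar> \<partial>lborel)"
    by (rule add_mono[OF 1 2])
  also have "(\<Prod>j\<in>UNIV. \<integral>u. \<bar>\<phi> j u\<bar> \<partial>lborel) =
      (\<integral>u. \<bar>\<phi> s u\<bar> \<partial>lborel) * (\<Prod>j\<in>UNIV - {s}. \<integral>u. \<bar>\<phi> j u\<bar> \<partial>lborel)"
    by (rule prod.remove) auto
  finally show ?thesis by (simp add: algebra_simps)
next
  case False
  then have "(\<Prod>j\<in>UNIV. \<phi> j (x $ j)) = 0" for x :: "real ^ 'n" by (intro prod_zero) auto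
  then have "(\<lambda>x. g x * of_real (\<Prod>j\<in>UNIV. \<phi> j (x $ j))) = (\<lambda>_. 0)" by (simp only: of_real_0 mult_zero_right)
  moreover have "\<phi> s = (\<lambda>_. 0)" using False by auto
  ultimately show ?thesis by (simp del: of_real_prod)
qed

section \<open>Functions of bounded \<open>\<Lambda>\<^sup>#\<close>-variation\<close>

lemma torus_periodic_axis:
  fixes f :: "real ^ 'n::finite \<Rightarrow> 'a"
  assumes "torus_periodic f"
  shows "f (x + axis i (2 * pi * of_int k)) = f x"
proof -
  have nat: "f (x + axis i (2 * pi * real m)) = f x" for m x
  proof (induction m)
    case 0
    have eq: "axis i (2 * pi * real 0) = (0 :: real ^ 'n)" by (simp add: vec_eq_iff axis_def)
    show ?case unfolding eq by simp
  next
    case (Suc m)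
    have eq: "x + axis i (2 * pi * real (Suc m)) = (x + axis i (2 * pi * real m)) + axis i (2 * pi)"
      by (simp add: vec_eq_iff axis_def algebra_simps)
    show ?case unfolding eq using assms Suc by (simp only: torus_periodic_def)
  qed
  show ?thesis
  proof (cases k rule: int_cases2)
    case (nonneg n)
    then show ?thesis using nat[of x n] by simp
  next
    case (nonpos n)
    have eq: "x + axis i (2 * pi * of_int k) + axis i (2 * pi * real n) = x"
      by (simp add: vec_eq_iff axis_def nonpos)
    show ?thesis using nat[of "x + axis i (2 * pi * of_int k)" n] unfolding eq by simp
  qed
qed

lemma torus_periodic_shift:
  fixes f :: "real ^ 'n::finite \<Rightarrow> 'a"
  assumes "torus_periodic f"
  shows "f (\<chi> j. x $ j + 2 * pi * of_int (k j)) = f x"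
proof -
  have "f (\<chi> j. if j \<in> A then x $ j + 2 * pi * of_int (k j) else x $ j) = f x" if "finite A" for A
    using that
  proof (induction A)
    case (insert i A)
    have "(\<chi> j. if j \<in> insert i A then x $ j + 2 * pi * of_int (k j) else x $ j) =
        (\<chi> j. if j \<in> A then x $ j + 2 * pi * of_int (k j) else x $ j) + axis i (2 * pi * of_int (k i))"
      using insert.hyps by (auto simp: vec_eq_iff axis_def)
    then show ?case using torus_periodic_axis[OF assms] insert.IH by simp
  qed simp
  from this[of UNIV] show ?thesis by simp
qed

definition reduce :: "real \<Rightarrow> real" where
  "reduce t = t + 2 * pi * of_int (- \<lfloor>t / (2 * pi)\<rfloor>)"

lemma reduce_bounds: "0 \<le> reduce t" "reduce t < 2 * pi"
  using floor_divide_lower[of "2 * pi" t] floor_divide_upper[of "2 * pi" t]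
  by (simp_all add: reduce_def algebra_simps)

lemma coord_increment_swap: "norm (coord_increment f s a b y) = norm (coord_increment f s b a y)"
  by (simp add: coord_increment_def norm_minus_commute)

lemma coord_increment_periodic:
  fixes f :: "real ^ 'n::finite \<Rightarrow> complex"
  assumes "torus_periodic f"
  shows "coord_increment f s (a + 2 * pi * of_int k) (b + 2 * pi * of_int l) (\<chi> j. y $ j + 2 * pi * of_int (m j)) =
    coord_increment f s a b y"
proof -
  have "f (\<chi> j. if j = s then c + 2 * pi * of_int n else (\<chi> j. y $ j + 2 * pi * of_int (m j)) $ j) =
      f (\<chi> j. if j = s then c else y $ j)" for c n
    using torus_periodic_shift[OF assms, of "\<chi> j. if j = s then c else y $ j" "\<lambda>j. if j = s then n else m j"]
    by (simp add: if_distrib cong: if_cong)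
  then show ?thesis by (simp add: coord_increment_def)
qed

locale log_sharp_BV =
  fixes p :: nat and f :: "real ^ 'n::finite \<Rightarrow> complex"
  assumes f_BV: "f \<in> sharp_BV (\<lambda>n. real n / ln (real n + 1) ^ p)"
begin

lemma torus_periodic_f: "torus_periodic f"
  using f_BV by (simp add: sharp_BV_def)

definition V0 :: real where
  "V0 = enn2real (sharp_variation (\<lambda>n. real n / ln (real n + 1) ^ p) f)"

text \<open>A family consisting of one interval with index 1 has the weight
  \<open>log_weight p 1\<close>, so this bounds every single increment.\<close>

definition R0 :: real where
  "R0 = V0 / log_weight p 1"

definition W0 :: real where
  "W0 = (SOME W. W > 0 \<and> (\<forall>n. log_weight p n \<le> W))"

lemma W0: "W0 > 0" "log_weight p n \<le> W0"
proof -
  have "\<exists>W. W > 0 \<and> (\<forall>n. log_weight p n \<le> W)" using log_weight_bounded[of p] by metis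
  from someI_ex[OF this] show "W0 > 0" "log_weight p n \<le> W0" unfolding W0_def by auto
qed

lemma V0_nonneg: "V0 \<ge> 0"
  by (simp add: V0_def)

lemma R0_nonneg: "R0 \<ge> 0"
  using V0_nonneg log_weight_nonneg[of p 1] by (simp add: R0_def)

lemma family_le_V0:
  assumes "\<And>i. i \<in> {1..m} \<Longrightarrow> 0 \<le> a i \<and> a i < b i \<and> b i < 2 * pi \<and> y i \<in> torus_cube"
    and "disjoint_family_on (\<lambda>i. {a i<..<b i}) {1..m}"
  shows "(\<Sum>i=1..m. log_weight p i * norm (coord_increment f s (a i) (b i) (y i))) \<le> V0"
proof -
  let ?L = "\<lambda>n. real n / ln (real n + 1) ^ p"
  have eq: "norm (coord_increment f s (a i) (b i) (y i)) / ?L i =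
      log_weight p i * norm (coord_increment f s (a i) (b i) (y i))" for i
    by (simp add: log_weight_def)
  have "ennreal (\<Sum>i=1..m. log_weight p i * norm (coord_increment f s (a i) (b i) (y i))) =
      (\<Sum>i=1..m. ennreal (norm (coord_increment f s (a i) (b i) (y i)) / ?L i))"
    unfolding eq by (intro sum_ennreal[symmetric] mult_nonneg_nonneg log_weight_nonneg norm_ge_zero)
  also have "\<dots> \<le> sharp_variation_in ?L s f"
    unfolding sharp_variation_in_def
    by (rule SUP_upper2[of "(m, a, b, y)"]) (use assms in auto)
  also have "\<dots> \<le> sharp_variation ?L f"
    unfolding sharp_variation_def by (rule member_le_sum) auto
  also have "\<dots> = ennreal V0"
    using f_BV by (simp add: V0_def sharp_BV_def)
  finally show ?thesis using V0_nonneg by (simp add: ennreal_le_iff)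
qed

lemma coord_increment_reduce:
  obtains y' where "y' \<in> torus_cube"
    "\<And>a b. coord_increment f s a b y' = coord_increment f s a b y"
    "\<And>a b. coord_increment f s (reduce a) (reduce b) y' = coord_increment f s a b y"
proof
  let ?m = "\<lambda>j. - \<lfloor>y $ j / (2 * pi)\<rfloor>"
  show "(\<chi> j. y $ j + 2 * pi * of_int (?m j)) \<in> torus_cube"
    using reduce_bounds by (simp add: torus_cube_def reduce_def)
  show "coord_increment f s a b (\<chi> j. y $ j + 2 * pi * of_int (?m j)) = coord_increment f s a b y" for a b
    using coord_increment_periodic[OF torus_periodic_f, of s a 0 b 0 y ?m] by simp
  show "coord_increment f s (reduce a) (reduce b) (\<chi> j. y $ j + 2 * pi * of_int (?m j)) =
      coord_increment f s a b y" for a b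
    unfolding reduce_def by (rule coord_increment_periodic[OF torus_periodic_f])
qed

lemma norm_coord_increment_le: "norm (coord_increment f s a b y) \<le> R0"
proof -
  obtain y' where y': "y' \<in> torus_cube"
    "coord_increment f s (reduce a) (reduce b) y' = coord_increment f s a b y"
    by (rule coord_increment_reduce) blast
  have le: "norm (coord_increment f s c d y') \<le> R0" if "0 \<le> c" "c < d" "d < 2 * pi" for c d
    using family_le_V0[of 1 "\<lambda>_. c" "\<lambda>_. d" "\<lambda>_. y'" s] that y'(1) log_weight_pos[of 1 p]
    by (simp add: disjoint_family_on_def R0_def field_simps)
  show ?thesis
  proof (cases "reduce a" "reduce b" rule: linorder_cases)
    case less
    then show ?thesis using le[of "reduce a" "reduce b"] reduce_bounds y'(2) by simp
  next
    case equal
    then have "coord_increment f s (reduce a) (reduce b) y' = 0" by (simp add: coord_increment_def)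
    then show ?thesis using R0_nonneg y'(2) by simp
  next
    case greater
    then show ?thesis using le[of "reduce b" "reduce a"] reduce_bounds y'(2)
      by (simp add: coord_increment_swap[of f s "reduce b"])
  qed
qed

text \<open>One interval of the family is given up; its place is used for the missing indices.\<close>

lemma subfamily_le:
  assumes J: "finite J" "0 \<notin> J"
    and ab: "\<And>i. i \<in> J \<Longrightarrow> 0 \<le> a i \<and> a i < b i \<and> b i < 2 * pi"
    and disj: "disjoint_family_on (\<lambda>i. {a i<..<b i}) J"
  shows "(\<Sum>i\<in>J. log_weight p i * norm (coord_increment f s (a i) (b i) (y i))) \<le> V0 + W0 * R0"
proof (cases "J = {}")
  case True
  then show ?thesis using V0_nonneg W0 R0_nonneg by simp
next
  case False
  then obtain i0 where i0: "i0 \<in> J" by blast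
  define m where "m = Max J"
  have Jm: "i \<in> {1..m}" if "i \<in> J" for i
  proof -
    have "i \<noteq> 0" using that J(2) by metis
    then show ?thesis using Max_ge[OF J(1) that] by (simp add: m_def)
  qed
  have "m \<ge> 1" using Jm[OF i0] by simp
  \<comment> \<open>The given-up interval is cut into m equal slots. Every index without an interval
    of its own takes the slot with its number, which completes the family to all of
    \<open>{1..m}\<close>.\<close>
  define h where "h = (b i0 - a i0) / real m"
  have "h > 0" using ab[OF i0] \<open>m \<ge> 1\<close> by (simp add: h_def)
  define K where "K = J - {i0}"
  define a' where "a' = (\<lambda>i. if i \<in> K then a i else a i0 + (real i - 1) * h)"
  define b' where "b' = (\<lambda>i. if i \<in> K then b i else a i0 + real i * h)"
  have "\<forall>i. \<exists>y'. y' \<in> torus_cube \<and> (\<forall>a b. coord_increment f s a b y' = coord_increment f s a b (y i))"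
    by (meson coord_increment_reduce)
  then obtain y' where y': "\<And>i. y' i \<in> torus_cube"
    "\<And>i a b. coord_increment f s a b (y' i) = coord_increment f s a b (y i)"
    by metis
  have slot: "a i0 \<le> a' i \<and> b' i \<le> b i0" if "i \<in> {1..m}" "i \<notin> K" for i
  proof -
    have "real i * h \<le> real m * h" using that \<open>h > 0\<close> by (intro mult_right_mono) auto
    then have "real i * h \<le> b i0 - a i0" using \<open>m \<ge> 1\<close> by (simp add: h_def)
    then show ?thesis using that \<open>h > 0\<close> by (simp add: a'_def b'_def)
  qed
  have ord: "a' i < b' i" if "i \<in> {1..m}" for i
    using ab[of i] \<open>h > 0\<close> by (simp add: a'_def b'_def K_def left_diff_distrib)
  have rng: "0 \<le> a' i \<and> b' i < 2 * pi" if "i \<in> {1..m}" for i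
  proof (cases "i \<in> K")
    case True
    then show ?thesis using ab[of i] by (simp add: a'_def b'_def K_def)
  next
    case False
    then show ?thesis using slot[OF that False] ab[OF i0] by linarith
  qed
  have disj': "disjoint_family_on (\<lambda>i. {a' i<..<b' i}) {1..m}"
    unfolding disjoint_family_on_def
  proof (intro ballI impI)
    have KK: "{a' i<..<b' i} \<inter> {a' j<..<b' j} = {}" if "i \<in> K" "j \<in> K" "i \<noteq> j" for i j
      using disjoint_family_onD[OF disj, of i j] that by (simp add: a'_def b'_def K_def)
    have KF: "{a' i<..<b' i} \<inter> {a' j<..<b' j} = {}" if "i \<in> K" "j \<in> {1..m}" "j \<notin> K" for i j
    proof -
      have "{a' j<..<b' j} \<subseteq> {a i0<..<b i0}" using slot[OF that(2,3)] by auto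
      moreover have "{a i<..<b i} \<inter> {a i0<..<b i0} = {}"
        using that i0 by (intro disjoint_family_onD[OF disj]) (auto simp: K_def)
      moreover have "{a' i<..<b' i} = {a i<..<b i}" using that(1) by (simp add: a'_def b'_def)
      ultimately show ?thesis by blast
    qed
    have FF: "{a' i<..<b' i} \<inter> {a' j<..<b' j} = {}" if "i \<notin> K" "j \<notin> K" "i < j" for i j
    proof -
      have "real i * h \<le> (real j - 1) * h" using that(3) \<open>h > 0\<close> by (intro mult_right_mono) auto
      then have "b' i \<le> a' j" using that by (simp add: a'_def b'_def)
      then show ?thesis by auto
    qed
    fix i j assume ij: "i \<in> {1..m}" "j \<in> {1..m}" "i \<noteq> j"
    consider "i \<in> K" "j \<in> K" | "i \<in> K" "j \<notin> K" | "i \<notin> K" "j \<in> K"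
      | "i \<notin> K" "j \<notin> K" "i < j" | "i \<notin> K" "j \<notin> K" "j < i" using ij(3) by linarith
    then show "{a' i<..<b' i} \<inter> {a' j<..<b' j} = {}"
      using KK[of i j] KF[of i j] KF[of j i] FF[of i j] FF[of j i] ij by cases (simp_all add: Int_commute)
  qed
  have "(\<Sum>i\<in>K. log_weight p i * norm (coord_increment f s (a i) (b i) (y i))) =
      (\<Sum>i\<in>K. log_weight p i * norm (coord_increment f s (a' i) (b' i) (y' i)))"
    by (intro sum.cong HOL.refl) (simp add: a'_def b'_def y'(2))
  also have "\<dots> \<le> (\<Sum>i=1..m. log_weight p i * norm (coord_increment f s (a' i) (b' i) (y' i)))"
    using Jm by (intro sum_mono2) (auto simp: K_def intro: mult_nonneg_nonneg log_weight_nonneg)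
  also have "\<dots> \<le> V0"
    using ord rng y'(1) by (intro family_le_V0 disj') auto
  finally have "(\<Sum>i\<in>K. log_weight p i * norm (coord_increment f s (a i) (b i) (y i))) \<le> V0" .
  moreover have "log_weight p i0 * norm (coord_increment f s (a i0) (b i0) (y i0)) \<le> W0 * R0"
    using W0 by (intro mult_mono norm_coord_increment_le) (auto intro: less_imp_le)
  ultimately show ?thesis
    using J(1) i0 by (simp add: sum.remove[of J i0] K_def)
qed

text \<open>A period window may straddle the seam of \<open>{0..<2 * pi}\<close>. After c has been
  moved into that interval, segments left of the seam stay and those right of it move back by one
  period, where they end below the shifted c. The single segment across the seam costs
  \<open>W0 * R0\<close>, and \<open>subfamily_le\<close> costs the same amount once more.\<close>

lemma family_segments_le:
  assumes J: "finite J" "0 \<notin> J"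
    and ab: "\<And>i. i \<in> J \<Longrightarrow> a i \<in> {c..c + 2 * pi} \<and> b i \<in> {c..c + 2 * pi}"
    and disj: "disjoint_family_on (\<lambda>i. open_segment (a i) (b i)) J"
  shows "(\<Sum>i\<in>J. log_weight p i * norm (coord_increment f s (a i) (b i) (y i))) \<le> V0 + 2 * W0 * R0"
proof -
  define k where "k = - \<lfloor>c / (2 * pi)\<rfloor>"
  let ?s = "2 * pi * of_int k"
  define lo where "lo = (\<lambda>i. min (a i) (b i) + ?s)"
  define hi where "hi = (\<lambda>i. max (a i) (b i) + ?s)"
  have c: "0 \<le> c + ?s" "c + ?s < 2 * pi"
    using reduce_bounds[of c] by (simp_all add: reduce_def k_def)
  have seg: "z \<in> open_segment x y \<longleftrightarrow> min x y < z \<and> z < max x y" for x y z :: real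
    by (auto simp: open_segment_eq_real_ivl)
  have clash: False if "i \<in> J" "j \<in> J" "i \<noteq> j" "lo i < z" "z < hi i" "lo j < z" "z < hi j" for i j z
  proof -
    have "z - ?s \<in> open_segment (a i) (b i)" "z - ?s \<in> open_segment (a j) (b j)"
      using that unfolding seg lo_def hi_def by linarith+
    then show False using disjoint_family_onD[OF disj that(1-3)] by blast
  qed
  have rng: "c + ?s \<le> lo i" "hi i \<le> c + ?s + 2 * pi" "lo i \<le> hi i" if "i \<in> J" for i
    using ab[OF that] by (auto simp: lo_def hi_def)
  let ?D = "\<lambda>i. log_weight p i * norm (coord_increment f s (a i) (b i) (y i))"
  \<comment> \<open>Segments ending exactly at 2 pi count as crossing, since the variation admits
    end points strictly below 2 pi.\<close>
  define X where "X = {i \<in> J. lo i < 2 * pi \<and> 2 * pi \<le> hi i}"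
  define Y where "Y = {i \<in> J. lo i < hi i \<and> (hi i < 2 * pi \<or> 2 * pi \<le> lo i)}"
  have "i = j" if ij: "i \<in> X" "j \<in> X" for i j
  proof (rule ccontr)
    assume "i \<noteq> j"
    obtain z where "max (lo i) (lo j) < z" "z < 2 * pi"
      using dense[of "max (lo i) (lo j)" "2 * pi"] ij unfolding X_def mem_Collect_eq max_less_iff_conj by blast
    then show False using clash[of i j z] \<open>i \<noteq> j\<close> ij by (simp add: X_def)
  qed
  then have cardX: "card X \<le> Suc 0" using J(1) by (subst card_le_Suc0_iff_eq) (auto simp: X_def)
  have "(\<Sum>i\<in>J. ?D i) = (\<Sum>i\<in>Y \<union> X. ?D i)"
  proof (rule sum.mono_neutral_right)
    show "\<forall>i\<in>J - (Y \<union> X). ?D i = 0"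
    proof
      fix i assume i: "i \<in> J - (Y \<union> X)"
      have "\<not> lo i < hi i" using i by (auto simp: X_def Y_def)
      then have "a i = b i" by (simp add: lo_def hi_def)
      then show "?D i = 0" by (simp add: coord_increment_def)
    qed
  qed (use J(1) in \<open>auto simp: X_def Y_def\<close>)
  also have "\<dots> = (\<Sum>i\<in>Y. ?D i) + (\<Sum>i\<in>X. ?D i)"
    by (rule sum.union_disjoint) (use J(1) in \<open>auto simp: X_def Y_def\<close>)
  also have "(\<Sum>i\<in>X. ?D i) \<le> of_nat (card X) * (W0 * R0)"
    by (rule sum_bounded_above)
      (rule mult_mono[OF W0(2) norm_coord_increment_le less_imp_le[OF W0(1)] norm_ge_zero])
  also have "\<dots> \<le> 1 * (W0 * R0)"
    using cardX W0(1) R0_nonneg by (intro mult_right_mono) auto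
  also have "(\<Sum>i\<in>Y. ?D i) \<le> V0 + W0 * R0"
  proof -
    define t :: "nat \<Rightarrow> int" where "t = (\<lambda>i. if hi i < 2 * pi then 0 else -1)"
    let ?a = "\<lambda>i. lo i + 2 * pi * of_int (t i)" and ?b = "\<lambda>i. hi i + 2 * pi * of_int (t i)"
    have Y_cases: "(t i = 0 \<and> hi i < 2 * pi) \<or> (t i = -1 \<and> 2 * pi \<le> lo i)" if "i \<in> Y" for i
      using that by (auto simp: Y_def t_def)
    have "(\<Sum>i\<in>Y. ?D i) = (\<Sum>i\<in>Y. log_weight p i * norm (coord_increment f s (?a i) (?b i) (y i)))"
    proof (intro sum.cong HOL.refl)
      fix i
      have 1: "coord_increment f s (u + 2 * pi * of_int m) (v + 2 * pi * of_int m) (y i) =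
          coord_increment f s u v (y i)" for u v m
        using coord_increment_periodic[OF torus_periodic_f, of s u m v m "y i" "\<lambda>_. 0"] by simp
      have "norm (coord_increment f s (min (a i) (b i)) (max (a i) (b i)) (y i)) =
          norm (coord_increment f s (a i) (b i) (y i))"
        by (simp add: min_def max_def coord_increment_swap[of f s "b i"])
      then show "?D i = log_weight p i * norm (coord_increment f s (?a i) (?b i) (y i))"
        by (simp add: 1 lo_def hi_def)
    qed
    also have "\<dots> \<le> V0 + W0 * R0"
    proof (rule subfamily_le)
      fix i assume i: "i \<in> Y"
      then have "i \<in> J" "lo i < hi i" by (simp_all add: Y_def)
      then show "0 \<le> ?a i \<and> ?a i < ?b i \<and> ?b i < 2 * pi"
        using Y_cases[OF i] rng[of i] c by auto
    next
      show "disjoint_family_on (\<lambda>i. {?a i<..<?b i}) Y"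
        unfolding disjoint_family_on_def
      proof (intro ballI impI)
        fix i j assume ij: "i \<in> Y" "j \<in> Y" "i \<noteq> j"
        then have J: "i \<in> J" "j \<in> J" by (simp_all add: Y_def)
        have False if z: "z \<in> {?a i<..<?b i}" "z \<in> {?a j<..<?b j}" for z
          using Y_cases[OF ij(1)] Y_cases[OF ij(2)]
        proof (elim disjE conjE)
          assume "t i = 0" "t j = 0"
          then show False using clash[OF J ij(3), of z] z by simp
        next
          assume "t i = -1" "t j = -1"
          then show False using clash[OF J ij(3), of "z + 2 * pi"] z by simp
        next
          assume "t i = 0" "t j = -1"
          then show False using z rng[OF J(1)] rng[OF J(2)] by auto
        next
          assume "t i = -1" "t j = 0"
          then show False using z rng[OF J(1)] rng[OF J(2)] by auto
        qed
        then show "{?a i<..<?b i} \<inter> {?a j<..<?b j} = {}" by blast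
      qed
    qed (use J in \<open>auto simp: Y_def\<close>)
    finally show ?thesis .
  qed
  finally show ?thesis by (simp add: algebra_simps)
qed

section \<open>The oscillation along one axis as a gauge\<close>

definition axis_osc :: "'n \<Rightarrow> real \<Rightarrow> real \<Rightarrow> real" where
  "axis_osc s a b = (SUP y. norm (coord_increment f s a b y))"

lemma norm_coord_increment_le_axis_osc: "norm (coord_increment f s a b y) \<le> axis_osc s a b"
  unfolding axis_osc_def by (rule cSUP_upper) (auto intro: bdd_aboveI2 norm_coord_increment_le)

lemma axis_osc_le: "axis_osc s a b \<le> R0"
  unfolding axis_osc_def by (rule cSUP_least) (auto intro: norm_coord_increment_le)

lemma axis_osc_nonneg: "0 \<le> axis_osc s a b"
  by (rule order_trans[OF norm_ge_zero norm_coord_increment_le_axis_osc[of s a b 0]])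

lemma axis_osc_refl [simp]: "axis_osc s a a = 0"
  by (simp add: axis_osc_def coord_increment_def)

text \<open>Each interval may carry its own y, so the supremum over y can be approached separately
  in every term, up to an error e/S whose weighted total is at most e. The summand 1 in S keeps S
  positive for an empty family.\<close>

lemma log_gauge_axis_osc: "log_gauge p (axis_osc s) (V0 + 2 * W0 * R0) R0"
proof
  show "axis_osc s (a + 2 * pi * of_int k) (b + 2 * pi * of_int k) = axis_osc s a b" for a b k
    using coord_increment_periodic[OF torus_periodic_f, of s a k b k _ "\<lambda>_. 0"] by (simp add: axis_osc_def)
next
  fix J :: "nat set" and u v :: "nat \<Rightarrow> real" and c :: real
  assume J: "finite J" "0 \<notin> J" and uv: "\<And>i. i \<in> J \<Longrightarrow> u i \<in> {c..c + 2 * pi} \<and> v i \<in> {c..c + 2 * pi}"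
    and disj: "disjoint_family_on (\<lambda>i. open_segment (u i) (v i)) J"
  show "(\<Sum>i\<in>J. log_weight p i * axis_osc s (u i) (v i)) \<le> V0 + 2 * W0 * R0"
  proof (rule field_le_epsilon)
    fix e :: real assume "e > 0"
    define S where "S = (\<Sum>i\<in>J. log_weight p i) + 1"
    have "S > 0" using sum_nonneg[of J "log_weight p"] log_weight_nonneg by (simp add: S_def add_nonneg_pos)
    have "\<exists>y. axis_osc s (u i) (v i) - e / S < norm (coord_increment f s (u i) (v i) y)" for i
    proof -
      have "axis_osc s (u i) (v i) - e / S < axis_osc s (u i) (v i)" using \<open>e > 0\<close> \<open>S > 0\<close> by simp
      then show ?thesis unfolding axis_osc_def
        by (subst (asm) less_cSUP_iff) (auto intro: bdd_aboveI2 norm_coord_increment_le)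
    qed
    then obtain y where y: "\<And>i. axis_osc s (u i) (v i) - e / S < norm (coord_increment f s (u i) (v i) (y i))"
      by metis
    have le: "axis_osc s (u i) (v i) \<le> norm (coord_increment f s (u i) (v i) (y i)) + e / S" for i
      using y[of i] by linarith
    have "(\<Sum>i\<in>J. log_weight p i * axis_osc s (u i) (v i)) \<le>
        (\<Sum>i\<in>J. log_weight p i * (norm (coord_increment f s (u i) (v i) (y i)) + e / S))"
      by (intro sum_mono mult_left_mono log_weight_nonneg le)
    also have "\<dots> = (\<Sum>i\<in>J. log_weight p i * norm (coord_increment f s (u i) (v i) (y i))) +
        (\<Sum>i\<in>J. log_weight p i) * (e / S)"
      by (simp only: distrib_left sum.distrib sum_distrib_right)
    also have "\<dots> \<le> (V0 + 2 * W0 * R0) + S * (e / S)"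
      using \<open>e > 0\<close> \<open>S > 0\<close>
      by (intro add_mono family_segments_le[OF J uv disj] mult_right_mono) (auto simp: S_def)
    finally show "(\<Sum>i\<in>J. log_weight p i * axis_osc s (u i) (v i)) \<le> V0 + 2 * W0 * R0 + e"
      using \<open>S > 0\<close> by simp
  qed
qed (rule axis_osc_nonneg axis_osc_le axis_osc_refl)+

text \<open>The path from z to x changes one coordinate at a time, and the gauge of a coordinate is
  uniform in the others.\<close>

lemma norm_diff_le_axis_osc: "norm (f x - f z) \<le> (\<Sum>s\<in>UNIV. axis_osc s (z $ s) (x $ s))"
proof -
  have "norm (f (\<chi> j. if j \<in> A then x $ j else z $ j) - f z) \<le> (\<Sum>s\<in>A. axis_osc s (z $ s) (x $ s))"
    if "finite A" for A
    using that
  proof (induction A)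
    case (insert s A)
    let ?x = "\<lambda>A. \<chi> j. if j \<in> A then x $ j else z $ j"
    have "(\<chi> j. if j = s then x $ s else ?x A $ j) = ?x (insert s A)"
      "(\<chi> j. if j = s then z $ s else ?x A $ j) = ?x A"
      using insert.hyps by (auto simp: vec_eq_iff)
    then have "norm (f (?x (insert s A)) - f (?x A)) \<le> axis_osc s (z $ s) (x $ s)"
      using norm_coord_increment_le_axis_osc[of s "z $ s" "x $ s" "?x A"] by (simp add: coord_increment_def)
    moreover have "norm (f (?x (insert s A)) - f z) \<le>
        norm (f (?x (insert s A)) - f (?x A)) + norm (f (?x A) - f z)"
      using norm_triangle_ineq[of "f (?x (insert s A)) - f (?x A)" "f (?x A) - f z"] by simp
    ultimately show ?case using insert by simp
  qed simp
  from this[of UNIV] show ?thesis by simp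
qed

definition B0 :: real where
  "B0 = norm (f 0) + real CARD('n) * R0"

lemma norm_f_le: "norm (f x) \<le> B0"
proof -
  have "norm (f x - f 0) \<le> (\<Sum>s\<in>(UNIV :: 'n set). R0)"
    by (rule order_trans[OF norm_diff_le_axis_osc]) (intro sum_mono axis_osc_le)
  then show ?thesis using norm_triangle_ineq2[of "f x" "f 0"] by (simp add: B0_def)
qed

end

section \<open>Discontinuities and measurability of f\<close>

context log_sharp_BV
begin

text \<open>n jumps in one window yield n disjoint short segments with increments above \<epsilon>.
  Hence \<epsilon> times the sum of the first n weights is at most the variation bound, while that
  sum grows at least like ln^(p+1) n.\<close>

lemma finite_jumps:
  assumes "\<epsilon> > 0"
  shows "finite {t \<in> {c<..<c + 2 * pi}. \<forall>\<eta>>0. \<exists>t'. \<bar>t - t'\<bar> < \<eta> \<and> \<epsilon> < axis_osc s t t'}"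
    (is "finite ?S")
proof (rule ccontr)
  define jump where "jump = (\<lambda>t. \<forall>\<eta>>0. \<exists>t'. \<bar>t - t'\<bar> < \<eta> \<and> \<epsilon> < axis_osc s t t')"
  have "\<forall>\<eta>>0. \<exists>t'. \<bar>t - t'\<bar> < \<eta> \<and> \<epsilon> < axis_osc s t t'" if "jump t" for t
    using that unfolding jump_def .
  note jumpD = this[rule_format]
  assume "infinite ?S"
  then have inf: "infinite {t \<in> {c<..<c + 2 * pi}. jump t}" unfolding jump_def .
  define V where "V = V0 + 2 * W0 * R0"
  have large: "ln (real n + 1) ^ Suc p * \<epsilon> \<le> real (Suc p) * V" for n
  proof -
    obtain T where T: "finite T" "card T = n" "T \<subseteq> {t \<in> {c<..<c + 2 * pi}. jump t}"
      using infinite_arbitrarily_large[OF inf, of n] by (elim exE conjE)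
    \<comment> \<open>With the ends of the window included, segments of length below \<delta>/2 at
      the jumps stay inside the window as well as apart from one another.\<close>
    define U where "U = insert c (insert (c + 2 * pi) T)"
    have "finite U" using T(1) by (simp add: U_def)
    have "\<forall>a\<in>U. \<exists>d. d > 0 \<and> (\<forall>x\<in>U. x \<noteq> a \<longrightarrow> d \<le> dist a x)"
      using finite_set_avoid[OF \<open>finite U\<close>] by simp
    from bchoice[OF this] obtain d where
      d: "\<forall>a\<in>U. d a > 0 \<and> (\<forall>x\<in>U. x \<noteq> a \<longrightarrow> d a \<le> dist a x)" ..
    define \<delta> where "\<delta> = Min (d ` U)"
    have "\<delta> \<in> d ` U" unfolding \<delta>_def using \<open>finite U\<close> by (intro Min_in) (auto simp: U_def)
    then have \<delta>1: "\<delta> > 0" using d by auto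
    have \<delta>2: "\<delta> \<le> \<bar>t - t'\<bar>" if "t \<in> U" "t' \<in> U" "t \<noteq> t'" for t t'
    proof -
      have "\<delta> \<le> d t" unfolding \<delta>_def using \<open>finite U\<close> that(1) by (intro Min_le) auto
      also have "d t \<le> dist t t'" using d that by simp
      finally show ?thesis by (simp add: dist_real_def)
    qed
    have TU: "t \<in> U" if "t \<in> T" for t using that by (simp add: U_def)
    have near_T: "\<exists>t'. \<bar>t - t'\<bar> < \<delta> / 2 \<and> \<epsilon> < axis_osc s t t'" if "t \<in> T" for t
    proof -
      have "jump t" using T(3) that by blast
      then show ?thesis using \<delta>1 by (intro jumpD) simp_all
    qed
    then have "\<forall>t\<in>T. \<exists>t'. \<bar>t - t'\<bar> < \<delta> / 2 \<and> \<epsilon> < axis_osc s t t'" by (rule ballI)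
    from bchoice[OF this] obtain h where h: "\<And>t. t \<in> T \<Longrightarrow> \<bar>t - h t\<bar> < \<delta> / 2"
      "\<And>t. t \<in> T \<Longrightarrow> \<epsilon> < axis_osc s t (h t)"
      by blast
    obtain g where g: "bij_betw g {1..n} T"
      using ex_bij_betw_nat_finite_1[OF T(1)] T(2) by blast
    then have gT: "g i \<in> T" if "i \<in> {1..n}" for i using bij_betwE[OF g] that by blast
    have V: "(\<Sum>i=1..n. log_weight p i * axis_osc s (g i) (h (g i))) \<le> V"
      unfolding V_def
    proof (rule log_gauge.variation[OF log_gauge_axis_osc])
      fix i assume "i \<in> {1..n}"
      then have "g i \<in> T" by (rule gT)
      then have "g i \<in> {c<..<c + 2 * pi}" using T(3) by blast
      moreover have "\<delta> \<le> \<bar>g i - c\<bar>" "\<delta> \<le> \<bar>g i - (c + 2 * pi)\<bar>"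
        using \<delta>2[of "g i" c] \<delta>2[of "g i" "c + 2 * pi"] TU[OF \<open>g i \<in> T\<close>] calculation by (simp_all add: U_def)
      ultimately show "g i \<in> {c..c + 2 * pi} \<and> h (g i) \<in> {c..c + 2 * pi}"
        using h(1)[OF \<open>g i \<in> T\<close>] \<delta>1 unfolding atLeastAtMost_iff greaterThanLessThan_iff by linarith
    next
      show "disjoint_family_on (\<lambda>i. open_segment (g i) (h (g i))) {1..n}"
        unfolding disjoint_family_on_def
      proof (intro ballI impI)
        fix i j assume ij: "i \<in> {1..n}" "j \<in> {1..n}" "i \<noteq> j"
        have "inj_on g {1..n}" using g by (simp add: bij_betw_def)
        then have "g i \<noteq> g j" using ij by (simp add: inj_on_eq_iff)
        then have d: "\<delta> \<le> \<bar>g i - g j\<bar>" using \<delta>2[of "g i" "g j"] TU[OF gT[OF ij(1)]] TU[OF gT[OF ij(2)]] by simp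
        have near: "\<bar>g m - z\<bar> < \<delta> / 2" if "z \<in> open_segment (g m) (h (g m))" "m \<in> {1..n}" for z m
          using that h(1)[OF gT[OF that(2)]] by (auto simp: open_segment_eq_real_ivl split: if_splits)
        have False if "z \<in> open_segment (g i) (h (g i))" "z \<in> open_segment (g j) (h (g j))" for z
          using near[OF that(1) ij(1)] near[OF that(2) ij(2)] d by linarith
        then show "open_segment (g i) (h (g i)) \<inter> open_segment (g j) (h (g j)) = {}" by blast
      qed
    qed auto
    have "(\<Sum>i=1..n. log_weight p i) * \<epsilon> \<le> (\<Sum>i=1..n. log_weight p i * axis_osc s (g i) (h (g i)))"
      unfolding sum_distrib_right
      by (intro sum_mono mult_left_mono log_weight_nonneg less_imp_le[OF h(2)] gT)
    with V have "(\<Sum>i=1..n. log_weight p i) * \<epsilon> \<le> V" by linarith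
    then have "real (Suc p) * ((\<Sum>i=1..n. log_weight p i) * \<epsilon>) \<le> real (Suc p) * V"
      by (intro mult_left_mono) auto
    moreover have "ln (real n + 1) ^ Suc p * \<epsilon> \<le> (real (Suc p) * (\<Sum>i=1..n. log_weight p i)) * \<epsilon>"
      using assms by (intro mult_right_mono ln_power_le_sum_log_weight) auto
    ultimately show ?thesis by (simp only: mult.assoc)
  qed
  have "filterlim (\<lambda>n. ln (real n + 1)) at_top sequentially" by real_asymp
  then have "filterlim (\<lambda>n. ln (real n + 1) ^ Suc p) at_top sequentially"
    by (intro filterlim_pow_at_top) auto
  then have "\<forall>\<^sub>F n in sequentially. real (Suc p) * V / \<epsilon> < ln (real n + 1) ^ Suc p"
    by (simp only: filterlim_at_top_dense)
  from eventually_happens'[OF sequentially_bot this]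
  obtain n where "real (Suc p) * V / \<epsilon> < ln (real n + 1) ^ Suc p" ..
  then have "real (Suc p) * V < ln (real n + 1) ^ Suc p * \<epsilon>"
    using assms by (simp only: pos_divide_less_eq)
  then show False using large[of n] by linarith
qed

text \<open>\<open>sharp_BV\<close> restricts increments and does not speak of measurability.
  Rounding every coordinate to a countable set gives compositions of f that are measurable. They
  converge to f because small changes of a coordinate that is not a jump have small gauge, and the
  countably many jump coordinates are eventually left unrounded.\<close>

lemma borel_measurable_f: "f \<in> borel_measurable borel"
proof -
  define Bad where "Bad = (\<lambda>s \<epsilon>. {t. \<forall>\<eta>>0. \<exists>t'. \<bar>t - t'\<bar> < \<eta> \<and> \<epsilon> < axis_osc s t t'})"
  have "countable (Bad s \<epsilon>)" if "\<epsilon> > 0" for s \<epsilon>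
  proof -
    \<comment> \<open>\<open>finite_jumps\<close> concerns open windows; those starting at integers
      cover the line because 2 pi > 1.\<close>
    have "Bad s \<epsilon> \<subseteq> (\<Union>k::int. {t \<in> {of_int k<..<of_int k + 2 * pi}.
        \<forall>\<eta>>0. \<exists>t'. \<bar>t - t'\<bar> < \<eta> \<and> \<epsilon> < axis_osc s t t'})"
    proof
      fix t assume t: "t \<in> Bad s \<epsilon>"
      have "of_int (\<lceil>t\<rceil> - 1) < t" "t \<le> of_int (\<lceil>t\<rceil> - 1) + 1" by linarith+
      moreover have "1 < 2 * pi" using pi_gt3 by simp
      ultimately have "t \<in> {of_int (\<lceil>t\<rceil> - 1)<..<of_int (\<lceil>t\<rceil> - 1) + 2 * pi}"
        unfolding greaterThanLessThan_iff by linarith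
      then show "t \<in> (\<Union>k::int. {t \<in> {of_int k<..<of_int k + 2 * pi}.
          \<forall>\<eta>>0. \<exists>t'. \<bar>t - t'\<bar> < \<eta> \<and> \<epsilon> < axis_osc s t t'})"
        using t unfolding Bad_def by blast
    qed
    then show ?thesis
      by (rule countable_subset) (intro countable_UN countable_finite finite_jumps[OF that] countableI_type)
  qed
  then have "countable (\<Union>s. \<Union>j. Bad s (1 / real (Suc j)))" by (intro countable_UN) auto
  \<comment> \<open>The point 0 ensures a nonempty set to enumerate.\<close>
  define E where "E = insert 0 (\<Union>s. \<Union>j. Bad s (1 / real (Suc j)))"
  have E: "countable E" "E \<noteq> {}" using \<open>countable (\<Union>s. _)\<close> by (simp_all add: E_def)
  define e where "e = from_nat_into E"
  have range_e: "range e = E" unfolding e_def by (rule range_from_nat_into[OF E(2,1)])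
  \<comment> \<open>Fixing the first k + 1 enumerated points makes every jump exact from some k on;
    the other points move by at most 1/(k+1).\<close>
  define q where "q = (\<lambda>k t. if t \<in> e ` {..k} then t else of_int \<lfloor>real (Suc k) * t\<rfloor> / real (Suc k))"
  have [measurable]: "q k \<in> borel_measurable borel" for k
  proof -
    have "e ` {..k} \<in> sets borel" by (intro borel_closed finite_imp_closed) auto
    moreover have "(\<lambda>t. of_int \<lfloor>real (Suc k) * t\<rfloor> / real (Suc k)) \<in> borel_measurable borel"
      by (intro borel_measurable_divide borel_measurable_const
          measurable_compose[OF _ borel_measurable_real_floor] borel_measurable_times measurable_ident_sets[OF HOL.refl])
    moreover have "{t \<in> space borel. t \<in> e ` {..k}} = e ` {..k}" by simp
    ultimately show ?thesis unfolding q_def by (intro measurable_If measurable_ident_sets[OF HOL.refl]) simp_all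
  qed
  have q_lim: "(\<lambda>k. q k t) \<longlonglongrightarrow> t" for t
  proof (rule tendsto_sandwich)
    show "\<forall>\<^sub>F k in sequentially. t - 1 / real (Suc k) \<le> q k t"
    proof (intro always_eventually allI)
      fix k
      have "real (Suc k) * t - 1 \<le> of_int \<lfloor>real (Suc k) * t\<rfloor>" by linarith
      then have "(real (Suc k) * t - 1) / real (Suc k) \<le> of_int \<lfloor>real (Suc k) * t\<rfloor> / real (Suc k)"
        by (rule divide_right_mono) simp
      moreover have "(real (Suc k) * t - 1) / real (Suc k) = t - 1 / real (Suc k)"
        by (simp add: diff_divide_distrib del: of_nat_Suc)
      ultimately show "t - 1 / real (Suc k) \<le> q k t" by (simp add: q_def del: of_nat_Suc)
    qed
    show "\<forall>\<^sub>F k in sequentially. q k t \<le> t"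
    proof (intro always_eventually allI)
      fix k
      have "of_int \<lfloor>real (Suc k) * t\<rfloor> \<le> real (Suc k) * t" by linarith
      then show "q k t \<le> t" by (simp add: q_def pos_divide_le_eq mult.commute del: of_nat_Suc)
    qed
    show "(\<lambda>k. t - 1 / real (Suc k)) \<longlonglongrightarrow> t" by real_asymp
  qed simp
  have osc_lim: "(\<lambda>k. axis_osc s (x $ s) (q k (x $ s))) \<longlonglongrightarrow> 0" for s and x :: "real ^ 'n"
  proof (cases "x $ s \<in> E")
    case True
    then have "x $ s \<in> range e" by (simp only: range_e)
    then obtain k0 where "x $ s = e k0" by blast
    have "axis_osc s (x $ s) (q k (x $ s)) = 0" if "k \<ge> k0" for k
    proof -
      have "e k0 \<in> e ` {..k}" using that by (intro imageI) simp
      then have "q k (e k0) = e k0" by (simp only: q_def if_True)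
      then show ?thesis using \<open>x $ s = e k0\<close> by simp
    qed
    then show ?thesis by (intro tendsto_eventually eventually_sequentiallyI[of k0])
  next
    case False
    show ?thesis
    proof (rule LIMSEQ_I)
      fix r :: real assume "r > 0"
      then obtain j where j: "1 / real (Suc j) < r" by (rule nat_approx_posE)
      have "x $ s \<notin> Bad s (1 / real (Suc j))" using False by (simp add: E_def del: of_nat_Suc)
      then have "\<not> (\<forall>\<eta>>0. \<exists>t'. \<bar>x $ s - t'\<bar> < \<eta> \<and> 1 / real (Suc j) < axis_osc s (x $ s) t')"
        unfolding Bad_def mem_Collect_eq .
      then obtain \<eta> where "\<eta> > 0"
        and no_jump: "\<not> (\<exists>t'. \<bar>x $ s - t'\<bar> < \<eta> \<and> 1 / real (Suc j) < axis_osc s (x $ s) t')"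
        by (simp only: not_all not_imp) (elim exE conjE)
      have \<eta>: "axis_osc s (x $ s) t' \<le> 1 / real (Suc j)" if "\<bar>x $ s - t'\<bar> < \<eta>" for t'
      proof (rule ccontr)
        assume "\<not> axis_osc s (x $ s) t' \<le> 1 / real (Suc j)"
        then have "\<bar>x $ s - t'\<bar> < \<eta> \<and> 1 / real (Suc j) < axis_osc s (x $ s) t'" using that by (simp only: not_le)
        with no_jump show False by (rule notE[OF _ exI])
      qed
      obtain k0 where k0: "\<forall>k\<ge>k0. norm (q k (x $ s) - x $ s) < \<eta>"
        using LIMSEQ_D[OF q_lim[of "x $ s"] \<open>\<eta> > 0\<close>] ..
      have "norm (axis_osc s (x $ s) (q k (x $ s)) - 0) < r" if "k \<ge> k0" for k
        using \<eta>[of "q k (x $ s)"] k0[rule_format, OF that] j axis_osc_nonneg[of s "x $ s" "q k (x $ s)"]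
        by (simp add: abs_minus_commute)
      then show "\<exists>no. \<forall>n\<ge>no. norm (axis_osc s (x $ s) (q n (x $ s)) - 0) < r" by blast
    qed
  qed
  show ?thesis
  proof (rule borel_measurable_LIMSEQ_metric)
    fix k
    let ?Q = "\<lambda>x::real ^ 'n. \<chi> i. q k (x $ i)"
    define C where "C = e ` {..k} \<union> range (\<lambda>m::int. of_int m / real (Suc k))"
    define C' where "C' = (\<lambda>\<omega>. \<chi> i. (\<omega> i :: real)) ` (\<Pi>\<^sub>E i\<in>(UNIV :: 'n set). C)"
    have "countable C" by (simp add: C_def)
    then have "countable C'" unfolding C'_def by (intro countable_image countable_PiE) auto
    have Q_in: "?Q x \<in> C'" for x
    proof -
      have "q k t \<in> C" for t
      proof (cases "t \<in> e ` {..k}")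
        case True
        then show ?thesis unfolding q_def C_def by (simp only: if_True) (rule UnI1)
      next
        case False
        then show ?thesis unfolding q_def C_def by (simp only: if_False) (intro UnI2 rangeI)
      qed
      then show ?thesis unfolding C'_def by (intro image_eqI[of _ _ "\<lambda>i. q k (x $ i)"]) auto
    qed
    have Q_meas: "?Q \<in> borel_measurable borel" by (rule borel_measurable_vec_lambda) measurable
    \<comment> \<open>A measurable map with countably many values stays measurable when these carry
      the discrete structure, and then it can be followed by an arbitrary function.\<close>
    have "?Q \<in> measurable borel (count_space C')"
      unfolding measurable_count_space_eq_countable[OF \<open>countable C'\<close>]
    proof (intro conjI ballI funcsetI)
      show "?Q -` {a} \<inter> space borel \<in> sets borel" for a
        by (rule measurable_sets[OF Q_meas]) simp
    qed (rule Q_in)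
    then show "(\<lambda>x. f (?Q x)) \<in> borel_measurable borel"
      by (rule measurable_compose) simp
  next
    fix x :: "real ^ 'n"
    have "(\<lambda>k. \<Sum>s\<in>UNIV. axis_osc s (x $ s) (q k (x $ s))) \<longlonglongrightarrow> (\<Sum>s\<in>(UNIV :: 'n set). 0)"
      by (intro tendsto_sum osc_lim)
    then have lim: "(\<lambda>k. \<Sum>s\<in>UNIV. axis_osc s (x $ s) (q k (x $ s))) \<longlonglongrightarrow> 0" by simp
    show "(\<lambda>k. f (\<chi> i. q k (x $ i))) \<longlonglongrightarrow> f x"
    proof (rule Lim_transform[OF tendsto_const])
      show "(\<lambda>k. f (\<chi> i. q k (x $ i)) - f x) \<longlonglongrightarrow> 0"
      proof (rule Lim_null_comparison[OF _ lim])
        show "\<forall>\<^sub>F k in sequentially. norm (f (\<chi> i. q k (x $ i)) - f x) \<le>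
            (\<Sum>s\<in>UNIV. axis_osc s (x $ s) (q k (x $ s)))"
          by (intro always_eventually allI order_trans[OF norm_diff_le_axis_osc]) simp
      qed
    qed
  qed
qed

end

section \<open>Rectangular partial sums\<close>

lemma torus_cube_borel [measurable]: "torus_cube \<in> sets (borel :: (real ^ 'n::finite) measure)"
proof -
  have "torus_cube = (\<Inter>i\<in>UNIV. (\<lambda>x::real ^ 'n. x $ i) -` {0..<2 * pi} \<inter> space borel)"
    by (auto simp: torus_cube_def)
  also have "\<dots> \<in> sets borel"
    by (intro sets.finite_INT measurable_sets[where A=borel]) auto
  finally show ?thesis .
qed

lemma integrable_indicator_bounded:
  fixes g :: "real ^ 'n::finite \<Rightarrow> complex"
  assumes "g \<in> borel_measurable borel" "\<And>x. norm (g x) \<le> B" "A \<in> sets borel" "bounded A"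
  shows "integrable lborel (\<lambda>x. indicator A x *\<^sub>R g x)"
proof (rule Bochner_Integration.integrable_bound)
  have "emeasure lborel A < \<infinity>" using assms(4) by (rule emeasure_bounded_finite)
  then show "integrable lborel (\<lambda>x. B * indicator A x)"
    using assms(3) by (intro integrable_mult_right integrable_real_indicator) auto
  show "(\<lambda>x. indicator A x *\<^sub>R g x) \<in> borel_measurable lborel" using assms by simp
  show "AE x in lborel. norm (indicator A x *\<^sub>R g x) \<le> norm (B * indicator A x)"
    using assms(2) by (intro AE_I2) (auto split: split_indicator intro: order_trans[OF _ abs_ge_self])
qed

lemma bounded_torus_cube: "bounded (torus_cube :: (real ^ 'n::finite) set)"
proof (rule bounded_subset)
  show "bounded (cbox (0 :: real ^ 'n) (\<chi> i. 2 * pi))" by (rule bounded_cbox)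
  show "torus_cube \<subseteq> cbox (0 :: real ^ 'n) (\<chi> i. 2 * pi)"
  proof
    fix x :: "real ^ 'n" assume "x \<in> torus_cube"
    then have "0 \<le> x $ i \<and> x $ i < 2 * pi" for i by (simp add: torus_cube_def)
    then show "x \<in> cbox 0 (\<chi> i. 2 * pi)" by (simp add: mem_box_cart less_imp_le)
  qed
qed

lemma torus_integral_lborel:
  fixes g :: "real ^ 'n::finite \<Rightarrow> complex"
  assumes "g \<in> borel_measurable borel"
  shows "(LINT x:torus_cube|lebesgue. g x) = (\<integral>x. indicator torus_cube x *\<^sub>R g x \<partial>lborel)"
  unfolding set_lebesgue_integral_def using assms by (subst integral_completion) auto

lemma exp_ii_sum:
  "exp (\<i> * of_real (\<Sum>j\<in>A. of_int (n j) * y j)) = (\<Prod>j\<in>A. exp (\<i> * of_real (of_int (n j) * y j)))"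
  if "finite A"
  using that by (simp add: exp_sum sum_distrib_left)

lemma fourier_partial_sum_eq:
  fixes f :: "real ^ 'n::finite \<Rightarrow> complex"
  assumes f [measurable]: "f \<in> borel_measurable borel" and B: "\<And>x. norm (f x) \<le> B"
  shows "fourier_partial_sum N f x =
    (\<integral>t. indicator torus_cube t *\<^sub>R (f t * of_real (\<Prod>j\<in>UNIV. dirichlet (N j) (x $ j - t $ j))) \<partial>lborel)
      / of_real ((2 * pi) ^ CARD('n))"
proof -
  let ?K = "\<Pi>\<^sub>E j\<in>(UNIV :: 'n set). {- int (N j)..int (N j)}"
  let ?c = "of_real ((2 * pi) ^ CARD('n)) :: complex"
  let ?e = "\<lambda>n y. exp (\<i> * of_real (\<Sum>j\<in>(UNIV :: 'n set). of_int (n j) * y j)) :: complex"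
  let ?e' = "\<lambda>n t. exp (- \<i> * of_real (\<Sum>j\<in>(UNIV :: 'n set). of_int (n j) * t $ j)) :: complex"
  have meas [measurable]: "(\<lambda>t. ?e' n t) \<in> borel_measurable borel" for n
    by (intro borel_measurable_continuous_onI continuous_intros)
  have kernel: "(\<Sum>n\<in>?K. ?e' n t * ?e n (\<lambda>j. x $ j)) = of_real (\<Prod>j\<in>UNIV. dirichlet (N j) (x $ j - t $ j))" for t
  proof -
    have "?e' n t * ?e n (\<lambda>j. x $ j) = ?e n (\<lambda>j. x $ j - t $ j)" for n
      unfolding exp_add[symmetric] by (rule arg_cong[of _ _ exp])
        (simp add: right_diff_distrib sum_subtractf)
    then have "(\<Sum>n\<in>?K. ?e' n t * ?e n (\<lambda>j. x $ j)) =
        (\<Sum>n\<in>?K. \<Prod>j\<in>UNIV. exp (\<i> * of_real (of_int (n j) * (x $ j - t $ j))))"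
      by (simp only: exp_ii_sum[OF finite])
    also have "\<dots> = (\<Prod>j\<in>UNIV. \<Sum>k = - int (N j)..int (N j). exp (\<i> * of_real (of_int k * (x $ j - t $ j))))"
      by (rule prod_sum_PiE[symmetric]) auto
    also have "\<dots> = of_real (\<Prod>j\<in>UNIV. dirichlet (N j) (x $ j - t $ j))"
      by (simp only: sum_exp_eq_dirichlet of_real_prod)
    finally show ?thesis .
  qed
  have int: "integrable lborel (\<lambda>t. indicator torus_cube t *\<^sub>R (f t * ?e' n t))" for n
  proof (rule integrable_indicator_bounded[where B=B])
    show "norm (f t * ?e' n t) \<le> B" for t
    proof -
      have "norm (?e' n t) = 1"
        using norm_exp_i_times[of "- (\<Sum>j\<in>UNIV. of_int (n j) * t $ j)"] by simp
      then show ?thesis using B[of t] by (simp add: norm_mult)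
    qed
  qed (auto simp: bounded_torus_cube)
  have coeff: "fourier_coeff f n = (\<integral>t. indicator torus_cube t *\<^sub>R (f t * ?e' n t) \<partial>lborel) / ?c" for n
    unfolding fourier_coeff_def by (subst torus_integral_lborel) auto
  have "fourier_partial_sum N f x =
      (\<Sum>n\<in>?K. (\<integral>t. indicator torus_cube t *\<^sub>R (f t * ?e' n t) \<partial>lborel) * ?e n (\<lambda>j. x $ j)) / ?c"
    by (simp add: fourier_partial_sum_def coeff sum_divide_distrib)
  also have "(\<Sum>n\<in>?K. (\<integral>t. indicator torus_cube t *\<^sub>R (f t * ?e' n t) \<partial>lborel) * ?e n (\<lambda>j. x $ j)) =
      (\<Sum>n\<in>?K. \<integral>t. (indicator torus_cube t *\<^sub>R (f t * ?e' n t)) * ?e n (\<lambda>j. x $ j) \<partial>lborel)"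
    by (intro sum.cong HOL.refl integral_mult_left_zero[symmetric])
  also have "\<dots> = (\<integral>t. (\<Sum>n\<in>?K. (indicator torus_cube t *\<^sub>R (f t * ?e' n t)) * ?e n (\<lambda>j. x $ j)) \<partial>lborel)"
    by (intro Bochner_Integration.integral_sum[symmetric] integrable_mult_left int)
  also have "\<dots> = (\<integral>t. indicator torus_cube t *\<^sub>R
      (f t * of_real (\<Prod>j\<in>UNIV. dirichlet (N j) (x $ j - t $ j))) \<partial>lborel)"
  proof (intro Bochner_Integration.integral_cong HOL.refl)
    fix t
    have "(\<Sum>n\<in>?K. (indicator torus_cube t *\<^sub>R (f t * ?e' n t)) * ?e n (\<lambda>j. x $ j)) =
        indicator torus_cube t *\<^sub>R (f t * (\<Sum>n\<in>?K. ?e' n t * ?e n (\<lambda>j. x $ j)))"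
      by (simp only: sum_distrib_left scaleR_sum_right mult_scaleR_left mult.assoc)
    then show "(\<Sum>n\<in>?K. (indicator torus_cube t *\<^sub>R (f t * ?e' n t)) * ?e n (\<lambda>j. x $ j)) =
        indicator torus_cube t *\<^sub>R (f t * of_real (\<Prod>j\<in>UNIV. dirichlet (N j) (x $ j - t $ j)))"
      by (simp only: kernel)
  qed
  finally show ?thesis .
qed

section \<open>Translating the period cube\<close>

lemma period_window_iff:
  "a \<le> z + 2 * pi * of_int k \<and> z + 2 * pi * of_int k < a + 2 * pi \<longleftrightarrow> k = - \<lfloor>(z - a) / (2 * pi)\<rfloor>"
proof -
  have "of_int (- k) \<le> (z - a) / (2 * pi) \<longleftrightarrow> a \<le> z + 2 * pi * of_int k"
    by (subst pos_le_divide_eq) (auto simp: algebra_simps)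
  moreover have "(z - a) / (2 * pi) < of_int (- k) + 1 \<longleftrightarrow> z + 2 * pi * of_int k < a + 2 * pi"
    by (subst pos_divide_less_eq) (auto simp: algebra_simps)
  ultimately have "a \<le> z + 2 * pi * of_int k \<and> z + 2 * pi * of_int k < a + 2 * pi \<longleftrightarrow>
      of_int (- k) \<le> (z - a) / (2 * pi) \<and> (z - a) / (2 * pi) < of_int (- k) + 1"
    by blast
  also have "\<dots> \<longleftrightarrow> \<lfloor>(z - a) / (2 * pi)\<rfloor> = - k" by (simp only: floor_eq_iff)
  finally show ?thesis by linarith
qed

text \<open>Confines the relevant period vectors to a finite box. Windows start at 0 or at -pi,
  hence the 4; the coordinate added to or reduced by that of x is below 2 pi < 7 in absolute value;
  and the divisor 2 pi exceeds 6.\<close>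

lemma floor_window_bound:
  assumes "0 \<le> X" "\<bar>z\<bar> \<le> X + 7" "\<bar>a\<bar> \<le> 4" "X + 3 \<le> of_int m"
  shows "\<lfloor>(z - a) / (2 * pi)\<rfloor> \<in> {- m..m}"
proof -
  have "\<bar>z - a\<bar> \<le> X + 11" using assms by linarith
  have "\<bar>(z - a) / (2 * pi)\<bar> = \<bar>z - a\<bar> / (2 * pi)" by (simp add: abs_divide)
  also have "\<dots> \<le> (X + 11) / 6"
    using \<open>\<bar>z - a\<bar> \<le> X + 11\<close> pi_gt3 assms(1) by (intro frac_le) auto
  also have "\<dots> \<le> of_int m" using assms by simp
  finally have "- of_int m \<le> (z - a) / (2 * pi)" "(z - a) / (2 * pi) \<le> of_int m" by linarith+
  then show ?thesis unfolding atLeastAtMost_iff by linarith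
qed

text \<open>Both integrals are split along the translates of the cube by the finitely many relevant
  period vectors.\<close>

lemma torus_integral_shift:
  fixes g :: "real ^ 'n::finite \<Rightarrow> complex"
  assumes per: "torus_periodic g" and g [measurable]: "g \<in> borel_measurable borel"
    and B: "\<And>x. norm (g x) \<le> B"
  shows "(\<integral>t. indicator torus_cube t *\<^sub>R g t \<partial>lborel) =
    (\<integral>u. indicator {u. \<forall>i. - pi \<le> u $ i \<and> u $ i < pi} u *\<^sub>R g (x + u) \<partial>lborel)"
proof -
  define Q :: "(real ^ 'n) set" where "Q = {u. \<forall>i. - pi \<le> u $ i \<and> u $ i < pi}"
  define S where "S = (\<lambda>k::'n \<Rightarrow> int. \<chi> i. (2 * pi * of_int (k i) :: real))"
  have Q [measurable]: "Q \<in> sets borel"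
  proof -
    have "Q = (\<Inter>i\<in>UNIV. (\<lambda>x::real ^ 'n. x $ i) -` {- pi..<pi} \<inter> space borel)" by (auto simp: Q_def)
    also have "\<dots> \<in> sets borel" by (intro sets.finite_INT measurable_sets[where A=borel]) auto
    finally show ?thesis .
  qed
  have "bounded Q"
  proof (rule bounded_subset)
    show "bounded (cbox (\<chi> i. - pi) ((\<chi> i. pi) :: real ^ 'n))" by (rule bounded_cbox)
    show "Q \<subseteq> cbox (\<chi> i. - pi) (\<chi> i. pi)"
    proof
      fix x :: "real ^ 'n" assume "x \<in> Q"
      then have "- pi \<le> x $ i \<and> x $ i < pi" for i by (simp add: Q_def)
      then show "x \<in> cbox (\<chi> i. - pi) (\<chi> i. pi)" by (simp add: mem_box_cart less_imp_le)
    qed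
  qed
  define m where "m = \<lceil>\<Sum>i\<in>UNIV. \<bar>x $ i\<bar>\<rceil> + 3"
  have m: "\<bar>x $ i\<bar> + 3 \<le> of_int m" for i
  proof -
    have "\<bar>x $ i\<bar> \<le> (\<Sum>i\<in>UNIV. \<bar>x $ i\<bar>)" by (rule member_le_sum) auto
    then show ?thesis by (simp add: m_def) linarith
  qed
  define K where "K = (\<Pi>\<^sub>E i\<in>(UNIV :: 'n set). {- m..m})"
  have "finite K" unfolding K_def by (intro finite_PiE) auto
  have pi4: "pi < 4" "pi > 3" using pi_less_4 pi_gt3 by auto
  \<comment> \<open>Exactly one period vector carries a given point into the cube, and the floor
    bound places its index in K.\<close>
  have split_Q: "(\<Sum>k\<in>K. indicator torus_cube (x + u + S k) :: real) = 1" if "u \<in> Q" for u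
  proof -
    let ?k = "\<lambda>i. - \<lfloor>((x + u) $ i - 0) / (2 * pi)\<rfloor>"
    have "x + u + S k \<in> torus_cube \<longleftrightarrow> k = ?k" for k
      using period_window_iff[of 0] by (simp add: torus_cube_def S_def fun_eq_iff)
    then have eq: "(indicator torus_cube (x + u + S k) :: real) = (if k = ?k then 1 else 0)" for k
      by (simp add: indicator_def)
    have rng: "\<lfloor>((x + u) $ i - 0) / (2 * pi)\<rfloor> \<in> {- m..m}" for i
    proof (rule floor_window_bound[OF abs_ge_zero _ _ m[of i]])
      have "- pi \<le> u $ i" "u $ i < pi" using that by (auto simp: Q_def)
      then show "\<bar>(x + u) $ i\<bar> \<le> \<bar>x $ i\<bar> + 7" using pi4 by simp
    qed simp
    have "?k i \<in> {- m..m}" for i using rng[of i] unfolding atLeastAtMost_iff by linarith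
    then have "?k \<in> K" by (simp only: K_def PiE_UNIV_domain Pi_iff) blast
    then show ?thesis using \<open>finite K\<close> by (simp add: eq)
  qed
  have split_cube: "(\<Sum>k\<in>K. indicator Q (v - x - S k) :: real) = 1" if "v \<in> torus_cube" for v
  proof -
    let ?k = "\<lambda>i. \<lfloor>((v - x) $ i - (- pi)) / (2 * pi)\<rfloor>"
    have "v - x - S k \<in> Q \<longleftrightarrow> k = ?k" for k
    proof -
      have "v - x - S k \<in> Q \<longleftrightarrow> (\<forall>i. - pi \<le> (v - x) $ i + 2 * pi * of_int (- k i) \<and>
          (v - x) $ i + 2 * pi * of_int (- k i) < - pi + 2 * pi)"
        by (simp add: Q_def S_def)
      also have "\<dots> \<longleftrightarrow> (\<forall>i. - k i = - \<lfloor>((v - x) $ i - (- pi)) / (2 * pi)\<rfloor>)"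
        by (simp only: period_window_iff)
      finally show ?thesis by (simp add: fun_eq_iff)
    qed
    then have eq: "(indicator Q (v - x - S k) :: real) = (if k = ?k then 1 else 0)" for k
      by (simp add: indicator_def)
    have rng: "\<lfloor>((v - x) $ i - (- pi)) / (2 * pi)\<rfloor> \<in> {- m..m}" for i
    proof (rule floor_window_bound[OF abs_ge_zero _ _ m[of i]])
      have "0 \<le> v $ i" "v $ i < 2 * pi" using that by (auto simp: torus_cube_def)
      moreover have "pi < 3.5" using pi_approx by simp
      ultimately show "\<bar>(v - x) $ i\<bar> \<le> \<bar>x $ i\<bar> + 7" by simp
    qed (use pi4 in simp)
    have "?k i \<in> {- m..m}" for i using rng[of i] unfolding atLeastAtMost_iff by linarith
    then have "?k \<in> K" by (simp only: K_def PiE_UNIV_domain Pi_iff) blast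
    then show ?thesis using \<open>finite K\<close> by (simp add: eq)
  qed
  have gS: "g (v + S k) = g v" for v k
  proof -
    have "v + S k = (\<chi> i. v $ i + 2 * pi * of_int (k i))" by (simp add: S_def vec_eq_iff)
    then show ?thesis using torus_periodic_shift[OF per, of v k] by simp
  qed
  let ?F = "\<lambda>k v. (indicator Q (v - x - S k) * indicator torus_cube v :: real) *\<^sub>R g v"
  have intF: "integrable lborel (?F k)" for k
  proof -
    have "integrable lborel (\<lambda>v. indicator torus_cube v *\<^sub>R ((indicator Q (v - x - S k) :: real) *\<^sub>R g v))"
      by (rule integrable_indicator_bounded[where B=B])
        (use B order_trans[OF norm_ge_zero B] in \<open>auto simp: bounded_torus_cube split: split_indicator\<close>)
    then show ?thesis by (simp add: mult.commute)
  qed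
  have trans: "(\<integral>v. ?F k v \<partial>lborel) = (\<integral>u. (indicator Q u * indicator torus_cube (x + u + S k) :: real) *\<^sub>R g (x + u) \<partial>lborel)"
    and intG: "integrable lborel (\<lambda>u. (indicator Q u * indicator torus_cube (x + u + S k) :: real) *\<^sub>R g (x + u))" for k
  proof -
    have F: "?F k \<in> borel_measurable borel" using borel_measurable_integrable[OF intF[of k]] by simp
    have eq: "(\<lambda>u. ?F k ((x + S k) + u)) =
        (\<lambda>u. (indicator Q u * indicator torus_cube (x + u + S k) :: real) *\<^sub>R g (x + u))"
    proof (intro ext)
      fix u
      have "g (u + (x + S k)) = g (u + x)" using gS[of "u + x" k] by (simp add: add.assoc)
      then show "?F k ((x + S k) + u) =
          (indicator Q u * indicator torus_cube (x + u + S k) :: real) *\<^sub>R g (x + u)"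
        by (simp add: algebra_simps)
    qed
    have "(\<integral>v. ?F k v \<partial>lborel) = (\<integral>v. ?F k v \<partial>distr lborel borel ((+) (x + S k)))"
      by (simp only: lborel_distr_plus)
    also have "\<dots> = (\<integral>u. ?F k ((x + S k) + u) \<partial>lborel)"
      by (rule integral_distr[OF _ F]) simp
    finally show "(\<integral>v. ?F k v \<partial>lborel) = (\<integral>u. (indicator Q u * indicator torus_cube (x + u + S k) :: real) *\<^sub>R g (x + u) \<partial>lborel)"
      unfolding eq .
    have "integrable (distr lborel borel ((+) (x + S k))) (?F k)"
      using intF[of k] by (simp only: lborel_distr_plus)
    then show "integrable lborel (\<lambda>u. (indicator Q u * indicator torus_cube (x + u + S k) :: real) *\<^sub>R g (x + u))"
      unfolding eq[symmetric] by (subst (asm) integrable_distr_eq[OF _ F]) simp_all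
  qed
  have "(\<integral>t. indicator torus_cube t *\<^sub>R g t \<partial>lborel) = (\<integral>v. (\<Sum>k\<in>K. ?F k v) \<partial>lborel)"
  proof (intro Bochner_Integration.integral_cong HOL.refl)
    fix v show "indicator torus_cube v *\<^sub>R g v = (\<Sum>k\<in>K. ?F k v)"
      using split_cube[of v] by (cases "v \<in> torus_cube") (simp_all flip: scaleR_sum_left)
  qed
  also have "\<dots> = (\<Sum>k\<in>K. \<integral>v. ?F k v \<partial>lborel)" by (rule Bochner_Integration.integral_sum[OF intF])
  also have "\<dots> = (\<Sum>k\<in>K. \<integral>u. (indicator Q u * indicator torus_cube (x + u + S k) :: real) *\<^sub>R g (x + u) \<partial>lborel)"
    by (simp only: trans)
  also have "\<dots> = (\<integral>u. (\<Sum>k\<in>K. (indicator Q u * indicator torus_cube (x + u + S k) :: real) *\<^sub>R g (x + u)) \<partial>lborel)"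
    by (rule Bochner_Integration.integral_sum[OF intG, symmetric])
  also have "\<dots> = (\<integral>u. indicator Q u *\<^sub>R g (x + u) \<partial>lborel)"
  proof (intro Bochner_Integration.integral_cong HOL.refl)
    fix u show "(\<Sum>k\<in>K. (indicator Q u * indicator torus_cube (x + u + S k) :: real) *\<^sub>R g (x + u)) =
        indicator Q u *\<^sub>R g (x + u)"
      using split_Q[of u] by (cases "u \<in> Q") (simp_all flip: scaleR_sum_left)
  qed
  finally show ?thesis by (simp add: Q_def)
qed

section \<open>Splitting a partial sum over the octants\<close>

lemma AE_vec_nth_neq: "AE x in lborel. (x :: real ^ 'n::finite) $ i \<noteq> c"
proof (rule AE_I')
  have "closed {x :: real ^ 'n. x $ i = c}"
    by (intro closed_Collect_eq continuous_intros)
  then have b: "{x :: real ^ 'n. x $ i = c} \<in> sets borel" by (rule borel_closed)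
  have "{x :: real ^ 'n. x $ i = c} \<in> null_sets lebesgue"
    using negligible_standard_hyperplane[of "axis i (1::real)" c]
    by (simp add: negligible_iff_null_sets inner_axis axis_in_Basis_iff)
  then show "{x :: real ^ 'n. x $ i = c} \<in> null_sets lborel"
    using b by (simp add: null_sets_def)
qed auto

definition half_kernel :: "real \<Rightarrow> nat \<Rightarrow> real \<Rightarrow> real" where
  "half_kernel \<sigma> N u = indicator {0<..pi} (\<sigma> * u) * dirichlet N u"

lemma sign_vectors_PiE: "(sign_vectors :: ('n::finite \<Rightarrow> real) set) = (\<Pi>\<^sub>E i\<in>UNIV. {-1, 1})"
  by (auto simp: sign_vectors_def PiE_UNIV_domain)

lemma finite_sign_vectors: "finite (sign_vectors :: ('n::finite \<Rightarrow> real) set)"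
  unfolding sign_vectors_PiE by (intro finite_PiE) auto

lemma card_sign_vectors: "card (sign_vectors :: ('n::finite \<Rightarrow> real) set) = 2 ^ CARD('n)"
  unfolding sign_vectors_PiE by (subst card_PiE) (auto simp: numeral_2_eq_2)

lemma sign_vectors_abs: "\<sigma> \<in> sign_vectors \<Longrightarrow> \<bar>\<sigma> i\<bar> = 1"
  by (auto simp: sign_vectors_def dest!: spec[of _ i])

lemma integrable_half_kernel: "\<bar>\<sigma>\<bar> = 1 \<Longrightarrow> integrable lborel (half_kernel \<sigma> N)"
  and integral_half_kernel: "\<bar>\<sigma>\<bar> = 1 \<Longrightarrow> integral\<^sup>L lborel (half_kernel \<sigma> N) = pi"
  using integral_dirichlet_half[of \<sigma> N]
  by (auto simp: half_kernel_def[abs_def] has_bochner_integral_iff)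

text \<open>The supports of the two half kernels, \<open>{-pi..<0}\<close> and
  \<open>{0<..pi}\<close>, together agree with \<open>{-pi..<pi}\<close> except at 0 and pi, whose
  hyperplanes are null sets. Multiplying out the coordinatewise sums over the two signs produces the
  octants.\<close>

lemma sum_prod_half_kernel:
  fixes u :: "real ^ 'n::finite"
  assumes "\<And>i. u $ i \<noteq> 0 \<and> u $ i \<noteq> pi"
  shows "(\<Sum>\<sigma>\<in>sign_vectors. \<Prod>j\<in>UNIV. half_kernel (\<sigma> j) (N j) (u $ j)) =
    indicator {u. \<forall>i. - pi \<le> u $ i \<and> u $ i < pi} u * (\<Prod>j\<in>UNIV. dirichlet (N j) (u $ j))"
proof -
  have one: "(\<Sum>s\<in>{-1, 1}. half_kernel s N t) = indicator {-pi..<pi} t * dirichlet N t"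
    if "t \<noteq> 0" "t \<noteq> pi" for N t
  proof -
    have "(\<Sum>s\<in>{-1, 1}. half_kernel s N t) = half_kernel (-1) N t + half_kernel 1 N t" by simp
    also have "\<dots> = indicator {-pi..<pi} t * dirichlet N t"
      using that by (auto simp: half_kernel_def indicator_def)
    finally show ?thesis .
  qed
  have "(\<Sum>\<sigma>\<in>sign_vectors. \<Prod>j\<in>UNIV. half_kernel (\<sigma> j) (N j) (u $ j)) =
      (\<Prod>j\<in>UNIV. \<Sum>s\<in>{-1, 1}. half_kernel s (N j) (u $ j))"
    unfolding sign_vectors_PiE by (rule prod_sum_PiE[symmetric]) auto
  also have "\<dots> = (\<Prod>j\<in>UNIV. indicator {-pi..<pi} (u $ j) * dirichlet (N j) (u $ j))"
    by (intro prod.cong HOL.refl one) (use assms in auto)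
  also have "\<dots> = (\<Prod>j\<in>UNIV. indicator {-pi..<pi} (u $ j)) * (\<Prod>j\<in>UNIV. dirichlet (N j) (u $ j))"
    by (rule prod.distrib)
  also have "(\<Prod>j\<in>UNIV. indicator {-pi..<pi} (u $ j) :: real) =
      indicator {u. \<forall>i. - pi \<le> u $ i \<and> u $ i < pi} u"
    by (auto simp: indicator_def)
  finally show ?thesis .
qed

lemma fourier_partial_sum_octants:
  fixes f :: "real ^ 'n::finite \<Rightarrow> complex"
  assumes per: "torus_periodic f" and f [measurable]: "f \<in> borel_measurable borel"
    and B: "\<And>x. norm (f x) \<le> B"
  shows "fourier_partial_sum N f x =
    (\<Sum>\<sigma>\<in>sign_vectors. \<integral>u. f (x + u) * of_real (\<Prod>j\<in>UNIV. half_kernel (\<sigma> j) (N j) (u $ j)) \<partial>lborel)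
      / of_real ((2 * pi) ^ CARD('n))"
proof -
  let ?D = "\<lambda>u::real ^ 'n. \<Prod>j\<in>UNIV. dirichlet (N j) (u $ j)"
  let ?g = "\<lambda>t. f t * of_real (?D (x - t))"
  let ?Q = "{u::real ^ 'n. \<forall>i. - pi \<le> u $ i \<and> u $ i < pi}"
  have dir_per: "dirichlet n (t + - 2 * pi) = dirichlet n t" for n t
  proof -
    have "cos (real k * (t + - 2 * pi)) = cos (real k * t)" for k
    proof -
      have "real k * (t + - 2 * pi) = real k * t - 2 * real k * pi" by (simp add: algebra_simps)
      then show ?thesis by (simp only: cos_diff cos_2npi sin_2npi mult_1_right mult_zero_right add_0_right)
    qed
    then show ?thesis by (simp only: dirichlet_def)
  qed
  have g_per: "torus_periodic ?g"
    unfolding torus_periodic_def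
  proof (intro allI)
    fix t :: "real ^ 'n" and i
    have "dirichlet (N j) ((x - (t + axis i (2 * pi))) $ j) = dirichlet (N j) ((x - t) $ j)" for j
      using dir_per[of "N i" "x $ i - t $ i"] by (cases "j = i") (simp_all add: axis_def algebra_simps)
    then show "f (t + axis i (2 * pi)) * of_real (?D (x - (t + axis i (2 * pi)))) = ?g t"
      using per by (simp add: torus_periodic_def del: vector_minus_component vector_add_component)
  qed
  have Dm [measurable]: "?D \<in> borel_measurable borel" by measurable
  have D_le: "\<bar>?D u\<bar> \<le> (\<Prod>j\<in>UNIV. 2 * real (N j) + 1)" for u
    unfolding abs_prod by (intro prod_mono conjI abs_ge_zero abs_dirichlet_le)
  have "fourier_partial_sum N f x = (\<integral>t. indicator torus_cube t *\<^sub>R ?g t \<partial>lborel) / of_real ((2 * pi) ^ CARD('n))"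
    using fourier_partial_sum_eq[OF f B, of N x] by simp
  also have "(\<integral>t. indicator torus_cube t *\<^sub>R ?g t \<partial>lborel) = (\<integral>u. indicator ?Q u *\<^sub>R ?g (x + u) \<partial>lborel)"
  proof (rule torus_integral_shift[OF g_per, where B="B * (\<Prod>j\<in>UNIV. 2 * real (N j) + 1)"])
    have "(\<lambda>t. ?D (x - t)) \<in> borel_measurable borel" by (rule measurable_compose[OF _ Dm]) measurable
    then show "?g \<in> borel_measurable borel" by measurable
    fix t
    have "norm (?g t) = norm (f t) * \<bar>?D (x - t)\<bar>" by (simp only: norm_mult norm_of_real real_norm_def)
    also have "\<dots> \<le> B * (\<Prod>j\<in>UNIV. 2 * real (N j) + 1)"
      by (intro mult_mono B D_le order_trans[OF norm_ge_zero B]) auto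
    finally show "norm (?g t) \<le> B * (\<Prod>j\<in>UNIV. 2 * real (N j) + 1)" .
  qed
  also have "\<dots> = (\<integral>u. (\<Sum>\<sigma>\<in>sign_vectors. f (x + u) * of_real (\<Prod>j\<in>UNIV. half_kernel (\<sigma> j) (N j) (u $ j))) \<partial>lborel)"
  proof (rule integral_cong_AE)
    have hk: "(\<lambda>u::real ^ 'n. \<Prod>j\<in>UNIV. half_kernel (\<sigma> j) (N j) (u $ j)) \<in> borel_measurable borel" for \<sigma>
      unfolding half_kernel_def by measurable
    have fx: "(\<lambda>u. f (x + u)) \<in> borel_measurable borel" by measurable
    show "(\<lambda>u. \<Sum>\<sigma>\<in>sign_vectors. f (x + u) * of_real (\<Prod>j\<in>UNIV. half_kernel (\<sigma> j) (N j) (u $ j))) \<in> borel_measurable lborel"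
      using hk fx by (simp del: of_real_prod)
    have "?Q = (\<Inter>i\<in>UNIV. (\<lambda>x::real ^ 'n. x $ i) -` {- pi..<pi} \<inter> space borel)" by auto
    also have "\<dots> \<in> sets borel" by (intro sets.finite_INT measurable_sets[where A=borel]) auto
    finally have Q: "?Q \<in> sets borel" .
    have "(\<lambda>u. ?D (x - (x + u))) \<in> borel_measurable borel" by (rule measurable_compose[OF _ Dm]) measurable
    then show "(\<lambda>u. indicator ?Q u *\<^sub>R ?g (x + u)) \<in> borel_measurable lborel"
      using Q fx by (simp del: of_real_prod)
    have "AE u in lborel. \<forall>i\<in>UNIV. (u :: real ^ 'n) $ i \<noteq> 0 \<and> u $ i \<noteq> pi"
      by (intro AE_finite_allI AE_conjI AE_vec_nth_neq) auto
    then show "AE u in lborel. indicator ?Q u *\<^sub>R ?g (x + u) =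
        (\<Sum>\<sigma>\<in>sign_vectors. f (x + u) * of_real (\<Prod>j\<in>UNIV. half_kernel (\<sigma> j) (N j) (u $ j)))"
    proof eventually_elim
      case (elim u)
      have "(\<Sum>\<sigma>\<in>sign_vectors. f (x + u) * of_real (\<Prod>j\<in>UNIV. half_kernel (\<sigma> j) (N j) (u $ j))) =
          f (x + u) * of_real (\<Sum>\<sigma>\<in>sign_vectors. \<Prod>j\<in>UNIV. half_kernel (\<sigma> j) (N j) (u $ j))"
        by (simp only: of_real_sum sum_distrib_left)
      also have "\<dots> = f (x + u) * of_real (indicator ?Q u * ?D u)"
        using elim by (subst sum_prod_half_kernel) auto
      also have "?D u = ?D (x - (x + u))" by simp
      finally show ?case by (simp only: of_real_mult scaleR_conv_of_real mult_ac)
    qed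
  qed
  also have "\<dots> = (\<Sum>\<sigma>\<in>sign_vectors. \<integral>u. f (x + u) * of_real (\<Prod>j\<in>UNIV. half_kernel (\<sigma> j) (N j) (u $ j)) \<partial>lborel)"
  proof (rule Bochner_Integration.integral_sum)
    fix \<sigma> :: "'n \<Rightarrow> real" assume \<sigma>: "\<sigma> \<in> sign_vectors"
    show "integrable lborel (\<lambda>u. f (x + u) * of_real (\<Prod>j\<in>UNIV. half_kernel (\<sigma> j) (N j) (u $ j)))"
      by (rule integrable_mult_prod[where \<phi>="\<lambda>j. half_kernel (\<sigma> j) (N j)" and G=B])
        (use B in \<open>auto intro: integrable_half_kernel sign_vectors_abs[OF \<sigma>]\<close>)
  qed
  finally show ?thesis .
qed

section \<open>The estimate over an octant\<close>

lemma cell_nonempty: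
  assumes "k \<le> N div 2"
  shows "min pi ((real k + 1) * (4 * pi / (2 * real N + 1))) \<in> cell N k"
proof -
  have "2 * k \<le> N" using assms by linarith
  then have "real k * 2 \<le> real N" by linarith
  then have "pi * (real k * 4) < pi * (2 * real N + 1)" by (intro mult_strict_left_mono) auto
  then have "real k * (4 * pi / (2 * real N + 1)) < pi" by (simp add: pos_divide_less_eq algebra_simps)
  moreover have "real k * (4 * pi / (2 * real N + 1)) < (real k + 1) * (4 * pi / (2 * real N + 1))"
    by (intro mult_strict_right_mono) auto
  ultimately show ?thesis by (simp add: cell_def)
qed

lemma half_kernel_eq_sum: "half_kernel \<sigma> N u = (\<Sum>k\<le>N div 2. cell_kernel \<sigma> N k u)"
proof (cases "\<sigma> * u \<in> {0<..pi}")
  case True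
  then have "0 < \<sigma> * u" "\<sigma> * u \<le> pi" by simp_all
  then obtain k where k: "k \<le> N div 2" "\<sigma> * u \<in> cell N k" by (rule ex_cell)
  have "cell_kernel \<sigma> N i u = (if i = k then dirichlet N u else 0)" for i
  proof (cases "i = k")
    case True
    then show ?thesis using k(2) by (simp add: cell_kernel_def)
  next
    case False
    then have "\<sigma> * u \<notin> cell N i" using cell_inj[OF _ k(2), of i] by blast
    then show ?thesis using False by (simp add: cell_kernel_def)
  qed
  then have "(\<Sum>i\<le>N div 2. cell_kernel \<sigma> N i u) = dirichlet N u" using k(1) by simp
  then show ?thesis using True by (simp add: half_kernel_def)
next
  case False
  then have "\<sigma> * u \<notin> cell N k" for k
    using cell_pos[of "\<sigma> * u" N k] cell_le_pi[of "\<sigma> * u" N k] by (simp only: greaterThanAtMost_iff) blast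
  then show ?thesis using False by (simp add: half_kernel_def cell_kernel_def)
qed

text \<open>Yields one logarithm for each coordinate whose index is not the isolated largest one.
  The factor 3 covers 1 \<le> 3 ln 2 at the start and 1/(k+2) \<le> 3/(k+3) in the step.\<close>

lemma sum_inverse_le_ln: "(\<Sum>i\<le>k. 1 / (real i + 1)) \<le> 3 * ln (real k + 2)"
proof (induction k)
  case 0
  then show ?case using ln2_ge_two_thirds by simp
next
  case (Suc k)
  have "ln ((real k + 2) / (real k + 3)) \<le> (real k + 2) / (real k + 3) - 1" by (rule ln_le_minus_one) simp
  moreover have "ln ((real k + 2) / (real k + 3)) = ln (real k + 2) - ln (real k + 3)" by (simp add: ln_div)
  moreover have "(real k + 2) / (real k + 3) - 1 = - (1 / (real k + 3))" by (simp add: field_simps)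
  ultimately have "1 / (real k + 3) \<le> ln (real k + 3) - ln (real k + 2)" by linarith
  moreover have "1 / (real k + 2) \<le> 3 * (1 / (real k + 3))" by (simp add: field_simps)
  ultimately show ?case using Suc by (simp add: add.commute)
qed

context log_sharp_BV
begin

definition cell_osc :: "'n \<Rightarrow> real \<Rightarrow> real \<Rightarrow> nat \<Rightarrow> nat \<Rightarrow> real" where
  "cell_osc s x \<sigma> N k = (SUP (u, v)\<in>cell N k \<times> cell N k. axis_osc s (x + \<sigma> * u) (x + \<sigma> * v))"

lemma bdd_above_cell_osc:
  "bdd_above ((\<lambda>(u, v). axis_osc s (x + \<sigma> * u) (x + \<sigma> * v)) ` (cell N k \<times> cell N k))"
  by (rule bdd_aboveI2[where M=R0]) (auto simp: axis_osc_le)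

lemma axis_osc_le_cell_osc:
  "u \<in> cell N k \<Longrightarrow> v \<in> cell N k \<Longrightarrow> axis_osc s (x + \<sigma> * u) (x + \<sigma> * v) \<le> cell_osc s x \<sigma> N k"
  unfolding cell_osc_def by (rule cSUP_upper2[OF bdd_above_cell_osc, of "(u, v)"]) auto

lemma cell_osc_nonneg:
  assumes "k \<le> N div 2"
  shows "0 \<le> cell_osc s x \<sigma> N k"
  by (rule order_trans[OF axis_osc_nonneg axis_osc_le_cell_osc[OF cell_nonempty[OF assms] cell_nonempty[OF assms]]])

text \<open>The supremum need not be attained, so a pair reaching half of it is taken. If the
  supremum is not positive, any point of the cell will do.\<close>

lemma ex_cell_osc:
  assumes "k \<le> N div 2"
  shows "\<exists>w. fst w \<in> cell N k \<and> snd w \<in> cell N k \<and>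
    cell_osc s x \<sigma> N k \<le> 2 * axis_osc s (x + \<sigma> * fst w) (x + \<sigma> * snd w)"
proof (cases "cell_osc s x \<sigma> N k \<le> 0")
  case True
  let ?c = "min pi ((real k + 1) * (4 * pi / (2 * real N + 1)))"
  show ?thesis
    using cell_nonempty[OF assms] True by (intro exI[of _ "(?c, ?c)"]) simp
next
  case False
  then have less: "cell_osc s x \<sigma> N k / 2 < (SUP (u, v)\<in>cell N k \<times> cell N k. axis_osc s (x + \<sigma> * u) (x + \<sigma> * v))"
    by (simp add: cell_osc_def)
  have ne: "cell N k \<times> cell N k \<noteq> {}" using cell_nonempty[OF assms] by blast
  obtain w where w: "w \<in> cell N k \<times> cell N k"
    "cell_osc s x \<sigma> N k / 2 < (case w of (u, v) \<Rightarrow> axis_osc s (x + \<sigma> * u) (x + \<sigma> * v))"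
    using less unfolding less_cSUP_iff[OF ne bdd_above_cell_osc] ..
  then show ?thesis by (intro exI[of _ w]) (auto split: prod.splits)
qed

lemma cell_osc_sum_small:
  assumes "\<epsilon> > 0"
  shows "\<exists>M N0. \<forall>N x \<sigma>. N \<ge> N0 \<longrightarrow> \<bar>\<sigma>\<bar> = 1 \<longrightarrow>
    (\<Sum>k=M..N div 2. log_weight p (Suc k) * cell_osc s x \<sigma> N k) \<le> \<epsilon>"
proof (rule log_gauge.cell_variation_small[OF log_gauge_axis_osc[of s], of "\<epsilon> / 2"])
  show "\<epsilon> / 2 > 0" using assms by simp
next
  fix M N0
  assume small: "\<And>N x \<sigma> u v. \<lbrakk>N \<ge> N0; \<bar>\<sigma>\<bar> = 1; \<And>k. k \<le> N div 2 \<Longrightarrow> u k \<in> cell N k \<and> v k \<in> cell N k\<rbrakk>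
    \<Longrightarrow> (\<Sum>k=M..N div 2. log_weight p (Suc k) * axis_osc s (x + \<sigma> * u k) (x + \<sigma> * v k)) \<le> \<epsilon> / 2"
  show ?thesis
  proof (rule exI[of _ M], rule exI[of _ N0], intro allI impI)
    fix N x and \<sigma> :: real
    assume N: "N \<ge> N0" "\<bar>\<sigma>\<bar> = 1"
    have "\<forall>k\<in>{..N div 2}. \<exists>w. fst w \<in> cell N k \<and> snd w \<in> cell N k \<and>
        cell_osc s x \<sigma> N k \<le> 2 * axis_osc s (x + \<sigma> * fst w) (x + \<sigma> * snd w)"
      using ex_cell_osc by simp
    from bchoice[OF this] obtain w where w: "\<forall>k\<in>{..N div 2}. fst (w k) \<in> cell N k \<and> snd (w k) \<in> cell N k \<and>
        cell_osc s x \<sigma> N k \<le> 2 * axis_osc s (x + \<sigma> * fst (w k)) (x + \<sigma> * snd (w k))" ..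
    have "(\<Sum>k=M..N div 2. log_weight p (Suc k) * cell_osc s x \<sigma> N k) \<le>
        (\<Sum>k=M..N div 2. log_weight p (Suc k) * (2 * axis_osc s (x + \<sigma> * fst (w k)) (x + \<sigma> * snd (w k))))"
      using w by (intro sum_mono mult_left_mono log_weight_nonneg) simp
    also have "\<dots> = 2 * (\<Sum>k=M..N div 2. log_weight p (Suc k) * axis_osc s (x + \<sigma> * fst (w k)) (x + \<sigma> * snd (w k)))"
      by (simp add: sum_distrib_left mult_ac)
    also have "\<dots> \<le> 2 * (\<epsilon> / 2)"
      using w by (intro mult_left_mono small N) auto
    finally show "(\<Sum>k=M..N div 2. log_weight p (Suc k) * cell_osc s x \<sigma> N k) \<le> \<epsilon>" by simp
  qed
qed

text \<open>The last cell is not a full period, so no cancellation is available there and the mean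
  is bounded by the L1 norm.\<close>

definition mean_bound :: "nat \<Rightarrow> nat \<Rightarrow> real" where
  "mean_bound N k = (if k < N div 2 then 32 / (real k + 1)\<^sup>2 else 4 * pi / (real k + 1))"

lemma abs_integral_cell_kernel_le:
  assumes "\<bar>\<sigma>\<bar> = 1"
  shows "\<bar>\<integral>u. cell_kernel \<sigma> N k u \<partial>lborel\<bar> \<le> mean_bound N k"
proof (cases "k < N div 2")
  case True
  then show ?thesis using integral_cell_kernel[OF assms True] by (simp add: mean_bound_def)
next
  case False
  have "\<bar>\<integral>u. cell_kernel \<sigma> N k u \<partial>lborel\<bar> \<le> (\<integral>u. \<bar>cell_kernel \<sigma> N k u\<bar> \<partial>lborel)"
    by (rule integral_abs_bound)
  also have "\<dots> \<le> 4 * pi / (real k + 1)" by (rule integral_abs_cell_kernel[OF assms])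
  finally show ?thesis using False by (simp only: mean_bound_def if_False)
qed

text \<open>The second factor in \<open>norm_integral_mult_prod_osc\<close>: 2 * B0 bounds f minus
  its limit and multiplies the mean, the oscillation multiplies the L1 norm.\<close>

definition far_bound :: "'n \<Rightarrow> real \<Rightarrow> real \<Rightarrow> nat \<Rightarrow> nat \<Rightarrow> real" where
  "far_bound s x \<sigma> N k = 2 * B0 * mean_bound N k + cell_osc s x \<sigma> N k * (4 * pi / (real k + 1))"

lemma B0_nonneg: "0 \<le> B0"
  by (rule order_trans[OF norm_ge_zero norm_f_le])

lemma far_bound_nonneg: "k \<le> N div 2 \<Longrightarrow> 0 \<le> far_bound s x \<sigma> N k"
  unfolding far_bound_def mean_bound_def using B0_nonneg cell_osc_nonneg by simp

context
  fixes N :: "'n \<Rightarrow> nat" and x :: "real ^ 'n" and \<sigma> :: "'n \<Rightarrow> real" and L :: complex and M :: nat and \<beta> :: real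
  assumes \<sigma>: "\<sigma> \<in> sign_vectors" and L: "norm L \<le> B0"
    and near: "\<And>u. (\<And>j. 0 < \<sigma> j * u $ j \<and> \<sigma> j * u $ j \<le> real M * (4 * pi / (2 * real (N j) + 1)))
      \<Longrightarrow> norm (f (x + u) - L) \<le> \<beta>"
begin

definition cell_integral :: "('n \<Rightarrow> nat) \<Rightarrow> complex" where
  "cell_integral m = (\<integral>u. (f (x + u) - L) * of_real (\<Prod>j\<in>UNIV. cell_kernel (\<sigma> j) (N j) (m j) (u $ j)) \<partial>lborel)"

lemma shifted_f_measurable: "(\<lambda>u. f (x + u) - L) \<in> borel_measurable borel"
proof -
  note [measurable] = borel_measurable_f
  show ?thesis by measurable
qed

lemma shifted_f_le: "norm (f (x + u) - L) \<le> 2 * B0"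
  using norm_triangle_ineq4[of "f (x + u)" L] norm_f_le[of "x + u"] L by linarith

lemma norm_cell_integral_near:
  assumes "\<And>j. m j < M"
  shows "norm (cell_integral m) \<le> \<beta> * (4 * pi) ^ CARD('n)"
proof -
  have close: "norm (f (x + u) - L) \<le> \<beta>" if nz: "\<And>j. cell_kernel (\<sigma> j) (N j) (m j) (u $ j) \<noteq> 0" for u
  proof (rule near)
    fix j
    have c: "\<sigma> j * u $ j \<in> cell (N j) (m j)"
      using nz[of j] by (auto simp: cell_kernel_def indicator_def split: if_splits)
    have "real (m j) + 1 \<le> real M" using assms[of j] by linarith
    then have "(real (m j) + 1) * (4 * pi / (2 * real (N j) + 1)) \<le> real M * (4 * pi / (2 * real (N j) + 1))"
      by (intro mult_right_mono) auto
    then show "0 < \<sigma> j * u $ j \<and> \<sigma> j * u $ j \<le> real M * (4 * pi / (2 * real (N j) + 1))"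
      using c cell_pos[OF c] by (simp add: cell_def)
  qed
  \<comment> \<open>Evaluating the closeness hypothesis at one admissible point shows that \<beta>
    is nonnegative.\<close>
  define c where "c = (\<chi> j. \<sigma> j * (min (M * (4 * pi / (2 * real (N j) + 1))) 1))"
  have "0 \<le> \<beta>"
  proof (rule order_trans[OF norm_ge_zero near[of c]])
    fix j
    have "M \<noteq> 0" using assms[of j] by simp
    then have pos: "0 < real M * (4 * pi / (2 * real (N j) + 1))" by simp
    have "\<sigma> j * \<sigma> j = 1" using sign_vectors_abs[OF \<sigma>, of j] by (simp add: abs_if split: if_splits)
    then have "\<sigma> j * c $ j = min (M * (4 * pi / (2 * real (N j) + 1))) 1"
      by (simp add: c_def flip: mult.assoc)
    then show "0 < \<sigma> j * c $ j \<and> \<sigma> j * c $ j \<le> real M * (4 * pi / (2 * real (N j) + 1))"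
      using pos by simp
  qed
  have "norm (cell_integral m) \<le> \<beta> * (\<Prod>j\<in>UNIV. \<integral>u. \<bar>cell_kernel (\<sigma> j) (N j) (m j) u\<bar> \<partial>lborel)"
    unfolding cell_integral_def
    by (intro norm_integral_mult_prod_le integrable_cell_kernel sign_vectors_abs[OF \<sigma>] shifted_f_measurable close)
  also have "\<dots> \<le> \<beta> * (\<Prod>j\<in>(UNIV :: 'n set). 4 * pi)"
  proof (intro mult_left_mono prod_mono conjI \<open>0 \<le> \<beta>\<close>)
    fix j
    have "4 * pi / (real (m j) + 1) \<le> 4 * pi / 1" by (intro divide_left_mono) auto
    then show "(\<integral>u. \<bar>cell_kernel (\<sigma> j) (N j) (m j) u\<bar> \<partial>lborel) \<le> 4 * pi"
      using integral_abs_cell_kernel[OF sign_vectors_abs[OF \<sigma>], of j "N j" "m j"] by linarith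
  qed simp
  finally show ?thesis by simp
qed

text \<open>The coordinate s that receives the cancellation is still free here; summation over the
  cells will use one with maximal index.\<close>

lemma norm_cell_integral_far:
  assumes "m s \<le> N s div 2"
  shows "norm (cell_integral m) \<le>
    (\<Prod>j\<in>UNIV - {s}. 4 * pi / (real (m j) + 1)) * far_bound s (x $ s) (\<sigma> s) (N s) (m s)"
proof -
  let ?k = "\<lambda>j. cell_kernel (\<sigma> j) (N j) (m j)"
  have "norm (cell_integral m) \<le> (\<Prod>j\<in>UNIV - {s}. \<integral>u. \<bar>?k j u\<bar> \<partial>lborel) *
      (2 * B0 * \<bar>\<integral>u. ?k s u \<partial>lborel\<bar> + cell_osc s (x $ s) (\<sigma> s) (N s) (m s) * (\<integral>u. \<bar>?k s u\<bar> \<partial>lborel))"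
    unfolding cell_integral_def
  proof (rule norm_integral_mult_prod_osc)
    show "integrable lborel (?k j)" for j by (intro integrable_cell_kernel sign_vectors_abs[OF \<sigma>])
    show "(\<lambda>u. f (x + u) - L) \<in> borel_measurable borel" by (rule shifted_f_measurable)
    show "norm (f (x + u) - L) \<le> 2 * B0" for u by (rule shifted_f_le)
    fix y :: "real ^ 'n" and u v
    assume "?k s u \<noteq> 0" "?k s v \<noteq> 0"
    then have uv: "\<sigma> s * u \<in> cell (N s) (m s)" "\<sigma> s * v \<in> cell (N s) (m s)"
      by (auto simp: cell_kernel_def indicator_def split: if_splits)
    have sq: "\<sigma> s * (\<sigma> s * t) = t" for t
      using sign_vectors_abs[OF \<sigma>, of s] by (auto simp: abs_if split: if_splits)
    have shift: "x + (\<chi> j. if j = s then t else y $ j) = (\<chi> j. if j = s then x $ s + t else (x + y) $ j)" for t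
      by (simp add: vec_eq_iff)
    have "norm (f (x + (\<chi> j. if j = s then u else y $ j)) - L - (f (x + (\<chi> j. if j = s then v else y $ j)) - L)) =
        norm (coord_increment f s (x $ s + v) (x $ s + u) (x + y))"
      by (simp add: coord_increment_def shift)
    also have "\<dots> \<le> axis_osc s (x $ s + v) (x $ s + u)" by (rule norm_coord_increment_le_axis_osc)
    also have "\<dots> \<le> cell_osc s (x $ s) (\<sigma> s) (N s) (m s)"
      using axis_osc_le_cell_osc[OF uv(2,1), of s "x $ s" "\<sigma> s"] by (simp add: sq)
    finally show "norm (f (x + (\<chi> j. if j = s then u else y $ j)) - L - (f (x + (\<chi> j. if j = s then v else y $ j)) - L))
        \<le> cell_osc s (x $ s) (\<sigma> s) (N s) (m s)" .
  qed
  also have "\<dots> \<le> (\<Prod>j\<in>UNIV - {s}. 4 * pi / (real (m j) + 1)) * far_bound s (x $ s) (\<sigma> s) (N s) (m s)"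
    unfolding far_bound_def
    using B0_nonneg cell_osc_nonneg[OF assms]
    by (intro mult_mono prod_mono conjI add_mono mult_left_mono order_refl
        abs_integral_cell_kernel_le integral_abs_cell_kernel sign_vectors_abs[OF \<sigma>] add_nonneg_nonneg mult_nonneg_nonneg
        prod_nonneg Bochner_Integration.integral_nonneg ballI) auto
  finally show ?thesis .
qed

lemma octant_integral_eq_sum:
  "(\<integral>u. (f (x + u) - L) * of_real (\<Prod>j\<in>UNIV. half_kernel (\<sigma> j) (N j) (u $ j)) \<partial>lborel) =
    (\<Sum>m\<in>(\<Pi>\<^sub>E j\<in>UNIV. {..N j div 2}). cell_integral m)"
proof -
  have "(\<integral>u. (f (x + u) - L) * of_real (\<Prod>j\<in>UNIV. half_kernel (\<sigma> j) (N j) (u $ j)) \<partial>lborel) =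
      (\<integral>u. (\<Sum>m\<in>(\<Pi>\<^sub>E j\<in>UNIV. {..N j div 2}).
        (f (x + u) - L) * of_real (\<Prod>j\<in>UNIV. cell_kernel (\<sigma> j) (N j) (m j) (u $ j))) \<partial>lborel)"
  proof (intro Bochner_Integration.integral_cong HOL.refl)
    fix u :: "real ^ 'n"
    have "(\<Prod>j\<in>UNIV. half_kernel (\<sigma> j) (N j) (u $ j)) =
        (\<Sum>m\<in>(\<Pi>\<^sub>E j\<in>UNIV. {..N j div 2}). \<Prod>j\<in>UNIV. cell_kernel (\<sigma> j) (N j) (m j) (u $ j))"
      unfolding half_kernel_eq_sum by (rule prod_sum_PiE) auto
    then show "(f (x + u) - L) * of_real (\<Prod>j\<in>UNIV. half_kernel (\<sigma> j) (N j) (u $ j)) =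
        (\<Sum>m\<in>(\<Pi>\<^sub>E j\<in>UNIV. {..N j div 2}).
          (f (x + u) - L) * of_real (\<Prod>j\<in>UNIV. cell_kernel (\<sigma> j) (N j) (m j) (u $ j)))"
      by (simp only: of_real_sum sum_distrib_left)
  qed
  also have "\<dots> = (\<Sum>m\<in>(\<Pi>\<^sub>E j\<in>UNIV. {..N j div 2}). cell_integral m)"
    unfolding cell_integral_def
    by (intro Bochner_Integration.integral_sum integrable_mult_prod[where G="2 * B0"]
        integrable_cell_kernel sign_vectors_abs[OF \<sigma>] shifted_f_measurable shifted_f_le)
  finally show ?thesis .
qed

text \<open>The cells outside the cube of side \<open>M\<close> are grouped by a coordinate \<open>s\<close> in which their index is
  maximal and by the value \<open>k\<close> of that index.\<close>

lemma norm_octant_integral_le: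
  assumes p: "p = CARD('n) - 1"
  shows "norm (\<integral>u. (f (x + u) - L) * of_real (\<Prod>j\<in>UNIV. half_kernel (\<sigma> j) (N j) (u $ j)) \<partial>lborel) \<le>
    \<beta> * (4 * pi * real M) ^ CARD('n) +
    (\<Sum>s\<in>UNIV. (12 * pi) ^ p * (\<Sum>k=M..N s div 2. ln (real k + 2) ^ p * far_bound s (x $ s) (\<sigma> s) (N s) k))"
proof -
  define I where "I = (\<Pi>\<^sub>E j\<in>(UNIV :: 'n set). {..N j div 2})"
  have "finite I" unfolding I_def by (intro finite_PiE) auto
  define I0 where "I0 = {m \<in> I. \<forall>j. m j < M}"
  \<comment> \<open>Ties put m into several of these sets; counting it repeatedly is harmless
    because the bounds \<open>F\<close> are nonnegative.\<close>
  define IS where "IS = (\<lambda>s. {m \<in> I. M \<le> m s \<and> (\<forall>j. m j \<le> m s)})"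
  define F where "F = (\<lambda>s m. (\<Prod>j\<in>UNIV - {s}. 4 * pi / (real (m j) + 1)) * far_bound s (x $ s) (\<sigma> s) (N s) (m s))"
  have mI: "m j \<le> N j div 2" if "m \<in> I" for m j using that by (auto simp: I_def PiE_UNIV_domain)
  have F_nonneg: "0 \<le> F s m" if "m \<in> I" for s m
    unfolding F_def using mI[OF that] by (intro mult_nonneg_nonneg prod_nonneg far_bound_nonneg) auto
  have cover: "\<exists>s. m \<in> IS s" if m: "m \<in> I - I0" for m
  proof -
    have "Max (range m) \<in> range m" by (intro Max_in) auto
    then obtain s where "Max (range m) = m s" by (rule rangeE)
    then have "m s = Max (range m)" ..
    then have s: "m j \<le> m s" for j by simp
    obtain j where "M \<le> m j" using m by (auto simp: I0_def not_less)
    then have "M \<le> m s" using s[of j] by linarith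
    then show ?thesis using m s by (auto simp: IS_def)
  qed
  have "norm (\<Sum>m\<in>I. cell_integral m) \<le> (\<Sum>m\<in>I. norm (cell_integral m))" by (rule norm_sum)
  also have "\<dots> = (\<Sum>m\<in>I - I0. norm (cell_integral m)) + (\<Sum>m\<in>I0. norm (cell_integral m))"
    by (rule sum.subset_diff) (auto simp: I0_def \<open>finite I\<close>)
  also have "(\<Sum>m\<in>I0. norm (cell_integral m)) \<le> \<beta> * (4 * pi * real M) ^ CARD('n)"
  proof (cases "I0 = {}")
    case False
    then obtain m0 where "m0 \<in> I0" by blast
    then have "norm (cell_integral m0) \<le> \<beta> * (4 * pi) ^ CARD('n)"
      by (intro norm_cell_integral_near) (simp add: I0_def)
    then have b: "0 \<le> \<beta> * (4 * pi) ^ CARD('n)" by (rule order_trans[OF norm_ge_zero])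
    have "I0 \<subseteq> (\<Pi>\<^sub>E j\<in>(UNIV :: 'n set). {..<M})" by (auto simp: I0_def PiE_UNIV_domain)
    then have "card I0 \<le> card (\<Pi>\<^sub>E j\<in>(UNIV :: 'n set). {..<M})"
      by (intro card_mono finite_PiE) auto
    also have "\<dots> = M ^ CARD('n)" by (subst card_PiE) auto
    finally have card: "real (card I0) \<le> real M ^ CARD('n)" by (simp only: of_nat_le_iff flip: of_nat_power)
    have "(\<Sum>m\<in>I0. norm (cell_integral m)) \<le> real (card I0) * (\<beta> * (4 * pi) ^ CARD('n))"
      by (rule sum_bounded_above, rule norm_cell_integral_near) (simp add: I0_def)
    also have "\<dots> \<le> real M ^ CARD('n) * (\<beta> * (4 * pi) ^ CARD('n))"
      by (rule mult_right_mono[OF card b])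
    finally show ?thesis by (simp add: power_mult_distrib mult_ac)
  next
    case empty: True
    \<comment> \<open>Without cells below M the sign of \<beta> is unknown, but then M = 0 and the
      first term vanishes.\<close>
    have "M = 0"
    proof (rule ccontr)
      assume "M \<noteq> 0"
      then have "(\<lambda>_. 0) \<in> I0" by (simp add: I0_def I_def PiE_UNIV_domain)
      then show False using empty by simp
    qed
    then have "(4 * pi * real M) ^ CARD('n) = 0" by (simp add: zero_power)
    then show ?thesis by (simp only: empty sum.empty mult_zero_right order_refl)
  qed
  also have "(\<Sum>m\<in>I - I0. norm (cell_integral m)) \<le> (\<Sum>m\<in>I - I0. \<Sum>s | m \<in> IS s. F s m)"
  proof (rule sum_mono)
    fix m assume m: "m \<in> I - I0"
    then obtain s where s: "m \<in> IS s" using cover by blast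
    have "norm (cell_integral m) \<le> F s m"
      unfolding F_def using mI m by (intro norm_cell_integral_far) auto
    also have "\<dots> \<le> (\<Sum>s | m \<in> IS s. F s m)"
      using s m F_nonneg by (intro member_le_sum) auto
    finally show "norm (cell_integral m) \<le> (\<Sum>s | m \<in> IS s. F s m)" .
  qed
  also have "\<dots> \<le> (\<Sum>m\<in>I. \<Sum>s | m \<in> IS s. F s m)"
    using \<open>finite I\<close> F_nonneg by (intro sum_mono2 sum_nonneg) auto
  also have "\<dots> = (\<Sum>s\<in>UNIV. \<Sum>m | m \<in> I \<and> m \<in> IS s. F s m)"
    using sum.swap_restrict[OF \<open>finite I\<close> finite[of "UNIV :: 'n set"], of "\<lambda>m s. F s m" "\<lambda>m s. m \<in> IS s"] by simp
  also have "\<dots> \<le> (\<Sum>s\<in>UNIV. (12 * pi) ^ p * (\<Sum>k=M..N s div 2. ln (real k + 2) ^ p * far_bound s (x $ s) (\<sigma> s) (N s) k))"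
  proof (rule sum_mono)
    fix s :: 'n
    let ?Q = "far_bound s (x $ s) (\<sigma> s) (N s)"
    have IS: "{m. m \<in> I \<and> m \<in> IS s} = IS s" by (auto simp: IS_def)
    have "finite (IS s)" using \<open>finite I\<close> by (simp add: IS_def)
    have "(\<Sum>m\<in>IS s. F s m) = (\<Sum>k=M..N s div 2. \<Sum>m | m \<in> IS s \<and> m s = k. F s m)"
      using mI by (intro sum.group[symmetric] \<open>finite (IS s)\<close>) (auto simp: IS_def)
    also have "\<dots> \<le> (\<Sum>k=M..N s div 2. (12 * pi) ^ p * (ln (real k + 2) ^ p * ?Q k))"
    proof (rule sum_mono)
      fix k assume k: "k \<in> {M..N s div 2}"
      \<comment> \<open>The other indices are allowed all values up to k, which turns the sum over
        cells into a product of one-dimensional harmonic sums.\<close>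
      let ?B = "\<lambda>j. if j = s then {k} else {..k}"
      let ?h = "\<lambda>j i. if j = s then ?Q i else 4 * pi / (real i + 1)"
      have F_h: "F s m = (\<Prod>j\<in>UNIV. ?h j (m j))" for m
      proof -
        have "(\<Prod>j\<in>UNIV. ?h j (m j)) = ?h s (m s) * (\<Prod>j\<in>UNIV - {s}. ?h j (m j))"
          by (rule prod.remove) auto
        also have "(\<Prod>j\<in>UNIV - {s}. ?h j (m j)) = (\<Prod>j\<in>UNIV - {s}. 4 * pi / (real (m j) + 1))"
          by (rule prod.cong) auto
        finally show ?thesis by (simp add: F_def)
      qed
      have finB: "finite (\<Pi>\<^sub>E j\<in>(UNIV :: 'n set). ?B j)" by (intro finite_PiE) auto
      have Qk: "0 \<le> ?Q k" using k by (intro far_bound_nonneg) auto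
      have "(\<Sum>m | m \<in> IS s \<and> m s = k. F s m) \<le> (\<Sum>m\<in>(\<Pi>\<^sub>E j\<in>UNIV. ?B j). F s m)"
      proof (rule sum_mono2[OF finB])
        show "{m. m \<in> IS s \<and> m s = k} \<subseteq> (\<Pi>\<^sub>E j\<in>UNIV. ?B j)" by (auto simp: IS_def PiE_UNIV_domain)
        fix m assume "m \<in> (\<Pi>\<^sub>E j\<in>UNIV. ?B j) - {m. m \<in> IS s \<and> m s = k}"
        then have "m s \<in> ?B s" unfolding PiE_UNIV_domain Pi_iff by blast
        then have "m s = k" by simp
        then show "0 \<le> F s m" unfolding F_def using Qk by (intro mult_nonneg_nonneg prod_nonneg) auto
      qed
      also have "\<dots> = (\<Prod>j\<in>UNIV. \<Sum>i\<in>?B j. ?h j i)"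
        unfolding F_h by (rule prod_sum_PiE[symmetric]) auto
      also have "\<dots> = (\<Sum>i\<in>?B s. ?h s i) * (\<Prod>j\<in>UNIV - {s}. \<Sum>i\<in>?B j. ?h j i)"
        by (rule prod.remove) auto
      also have "(\<Prod>j\<in>UNIV - {s}. \<Sum>i\<in>?B j. ?h j i) = (\<Prod>j\<in>UNIV - {s}. \<Sum>i\<le>k. 4 * pi / (real i + 1))"
        by (intro prod.cong HOL.refl) (auto intro: sum.cong)
      \<comment> \<open>There are CARD('n) - 1 = p coordinates other than s; this is the source of
        the power of the logarithm in the weights.\<close>
      also have "\<dots> = (\<Sum>i\<le>k. 4 * pi / (real i + 1)) ^ p" by (simp add: p)
      also have "(\<Sum>i\<in>?B s. ?h s i) = ?Q k" by simp
      also have "?Q k * (\<Sum>i\<le>k. 4 * pi / (real i + 1)) ^ p \<le> ?Q k * (12 * pi * ln (real k + 2)) ^ p"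
      proof (intro mult_left_mono power_mono Qk sum_nonneg)
        have "(\<Sum>i\<le>k. 4 * pi / (real i + 1)) = 4 * pi * (\<Sum>i\<le>k. 1 / (real i + 1))"
          by (simp add: sum_distrib_left)
        also have "\<dots> \<le> 4 * pi * (3 * ln (real k + 2))"
          by (intro mult_left_mono sum_inverse_le_ln) auto
        finally show "(\<Sum>i\<le>k. 4 * pi / (real i + 1)) \<le> 12 * pi * ln (real k + 2)" by simp
      qed simp
      also have "\<dots> = (12 * pi) ^ p * (ln (real k + 2) ^ p * ?Q k)" by (simp only: power_mult_distrib mult_ac)
      finally show "(\<Sum>m | m \<in> IS s \<and> m s = k. F s m) \<le> (12 * pi) ^ p * (ln (real k + 2) ^ p * ?Q k)" .
    qed
    also have "\<dots> = (12 * pi) ^ p * (\<Sum>k=M..N s div 2. ln (real k + 2) ^ p * ?Q k)"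
      by (rule sum_distrib_left[symmetric])
    finally show "(\<Sum>m | m \<in> I \<and> m \<in> IS s. F s m) \<le>
        (12 * pi) ^ p * (\<Sum>k=M..N s div 2. ln (real k + 2) ^ p * ?Q k)"
      by (simp only: IS)
  qed
  finally show ?thesis unfolding octant_integral_eq_sum I_def[symmetric] by simp
qed

end

text \<open>ln^p(k + 2) is k + 1 times the weight with index k + 1. The hypotheses answer the three
  sources of error: the means over complete cells, the single incomplete last cell, and the
  oscillations.\<close>

lemma sum_far_bound_le:
  assumes tail: "(\<Sum>k=M..N div 2. log_weight p (Suc k) / real (Suc k)) \<le> \<delta>"
    and last: "log_weight p (Suc (N div 2)) \<le> \<delta>"
    and osc: "(\<Sum>k=M..N div 2. log_weight p (Suc k) * cell_osc s x \<sigma> N k) \<le> \<delta>"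
    and "0 \<le> \<delta>"
  shows "(\<Sum>k=M..N div 2. ln (real k + 2) ^ p * far_bound s x \<sigma> N k) \<le> (2 * B0 * (32 + 4 * pi) + 4 * pi) * \<delta>"
proof -
  let ?w = "\<lambda>k. log_weight p (Suc k)"
  have lw: "ln (real k + 2) ^ p = ?w k * (real k + 1)" for k
    by (simp add: log_weight_def add.commute)
  have "ln (real k + 2) ^ p * far_bound s x \<sigma> N k \<le>
      2 * B0 * (32 * (?w k / real (Suc k)) + (if k = N div 2 then 4 * pi * ?w k else 0)) + 4 * pi * (?w k * cell_osc s x \<sigma> N k)"
    if "k \<in> {M..N div 2}" for k
  proof -
    have "ln (real k + 2) ^ p * mean_bound N k \<le> 32 * (?w k / real (Suc k)) + (if k = N div 2 then 4 * pi * ?w k else 0)"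
    proof (cases "k < N div 2")
      case True
      have "ln (real k + 2) ^ p * mean_bound N k = 32 * (?w k / real (Suc k))"
        unfolding lw using True by (simp add: mean_bound_def power2_eq_square add.commute)
      then show ?thesis using True by simp
    next
      case False
      then have "k = N div 2" using that by simp
      have "ln (real k + 2) ^ p * mean_bound N k = 4 * pi * ?w k"
        unfolding lw using False by (simp add: mean_bound_def)
      then show ?thesis using \<open>k = N div 2\<close> log_weight_nonneg[of p "Suc k"] by simp
    qed
    then have "2 * B0 * (ln (real k + 2) ^ p * mean_bound N k) \<le>
        2 * B0 * (32 * (?w k / real (Suc k)) + (if k = N div 2 then 4 * pi * ?w k else 0))"
      using B0_nonneg by (intro mult_left_mono) auto
    moreover have "ln (real k + 2) ^ p * (cell_osc s x \<sigma> N k * (4 * pi / (real k + 1))) =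
        4 * pi * (?w k * cell_osc s x \<sigma> N k)"
      unfolding lw by simp
    moreover have "ln (real k + 2) ^ p * far_bound s x \<sigma> N k =
        2 * B0 * (ln (real k + 2) ^ p * mean_bound N k) +
        ln (real k + 2) ^ p * (cell_osc s x \<sigma> N k * (4 * pi / (real k + 1)))"
      unfolding far_bound_def by (simp only: distrib_left mult_ac)
    ultimately show ?thesis by linarith
  qed
  then have "(\<Sum>k=M..N div 2. ln (real k + 2) ^ p * far_bound s x \<sigma> N k) \<le>
      (\<Sum>k=M..N div 2. 2 * B0 * (32 * (?w k / real (Suc k)) + (if k = N div 2 then 4 * pi * ?w k else 0)) +
        4 * pi * (?w k * cell_osc s x \<sigma> N k))"
    by (rule sum_mono)
  also have "\<dots> = 2 * B0 * (32 * (\<Sum>k=M..N div 2. ?w k / real (Suc k)) +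
        (\<Sum>k=M..N div 2. if k = N div 2 then 4 * pi * ?w k else 0)) +
      4 * pi * (\<Sum>k=M..N div 2. ?w k * cell_osc s x \<sigma> N k)"
    by (simp only: sum.distrib sum_distrib_left[symmetric])
  also have "\<dots> \<le> 2 * B0 * (32 * \<delta> + 4 * pi * \<delta>) + 4 * pi * \<delta>"
  proof (intro add_mono mult_left_mono tail osc)
    have "(\<Sum>k=M..N div 2. if k = N div 2 then 4 * pi * ?w k else 0) \<le> 4 * pi * ?w (N div 2)"
      using log_weight_nonneg[of p "Suc (N div 2)"] by (simp add: sum.delta)
    also have "\<dots> \<le> 4 * pi * \<delta>" using last by (intro mult_left_mono) auto
    finally show "(\<Sum>k=M..N div 2. if k = N div 2 then 4 * pi * ?w k else 0) \<le> 4 * pi * \<delta>" .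
  qed (use B0_nonneg in auto)
  also have "\<dots> = (2 * B0 * (32 + 4 * pi) + 4 * pi) * \<delta>" by (simp add: algebra_simps)
  finally show ?thesis .
qed

text \<open>M and N0 come before \<beta>: the near cells cost \<beta> times a power of M, and
  \<beta> is made small once M is known. Uniformity in x, \<sigma> and L is what convergence on
  compact sets will need.\<close>

lemma octant_integral_small:
  assumes p: "p = CARD('n) - 1" and "\<epsilon> > 0"
  shows "\<exists>M N0. \<forall>N x \<sigma> L \<beta>. (\<forall>j. N0 \<le> N j) \<longrightarrow> \<sigma> \<in> sign_vectors \<longrightarrow> norm L \<le> B0 \<longrightarrow>
    (\<forall>u. (\<forall>j. 0 < \<sigma> j * u $ j \<and> \<sigma> j * u $ j \<le> real M * (4 * pi / (2 * real (N j) + 1)))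
      \<longrightarrow> norm (f (x + u) - L) \<le> \<beta>) \<longrightarrow>
    norm (\<integral>u. (f (x + u) - L) * of_real (\<Prod>j\<in>UNIV. half_kernel (\<sigma> j) (N j) (u $ j)) \<partial>lborel) \<le>
      \<beta> * (4 * pi * real M) ^ CARD('n) + \<epsilon>"
proof -
  define C where "C = real CARD('n) * ((12 * pi) ^ p * (2 * B0 * (32 + 4 * pi) + 4 * pi))"
  have "C > 0" unfolding C_def using B0_nonneg by (intro mult_pos_pos add_nonneg_pos) auto
  define \<delta> where "\<delta> = \<epsilon> / C"
  have "\<delta> > 0" using \<open>C > 0\<close> \<open>\<epsilon> > 0\<close> by (simp add: \<delta>_def)
  have "\<forall>s\<in>(UNIV :: 'n set). \<exists>w. \<forall>N x \<sigma>. N \<ge> snd w \<longrightarrow> \<bar>\<sigma>\<bar> = 1 \<longrightarrow>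
      (\<Sum>k=fst w..N div 2. log_weight p (Suc k) * cell_osc s x \<sigma> N k) \<le> \<delta>"
    using cell_osc_sum_small[OF \<open>\<delta> > 0\<close>] by simp
  from bchoice[OF this] obtain w where "\<forall>s\<in>UNIV. \<forall>N x \<sigma>. N \<ge> snd (w s) \<longrightarrow> \<bar>\<sigma>\<bar> = 1 \<longrightarrow>
      (\<Sum>k=fst (w s)..N div 2. log_weight p (Suc k) * cell_osc s x \<sigma> N k) \<le> \<delta>" ..
  note w = this[rule_format, OF UNIV_I]
  have "\<forall>e>0. \<exists>N. \<forall>m\<ge>N. \<forall>n. norm (\<Sum>k=m..<n. log_weight p (Suc k) / real (Suc k)) < e"
    using summable_log_weight_div[of p] unfolding summable_Cauchy .
  from this[rule_format, OF \<open>\<delta> > 0\<close>]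
  obtain M1 where "\<forall>m\<ge>M1. \<forall>n. norm (\<Sum>k=m..<n. log_weight p (Suc k) / real (Suc k)) < \<delta>" ..
  note M1 = this[rule_format]
  have "\<forall>\<^sub>F n in sequentially. log_weight p n < \<delta>"
    using log_weight_tendsto_0[of p] \<open>\<delta> > 0\<close> by (rule order_tendstoD)
  then obtain n1 where "\<forall>n\<ge>n1. log_weight p n < \<delta>" unfolding eventually_sequentially ..
  note n1 = this[rule_format]
  define M where "M = Max (insert M1 (range (fst \<circ> w)))"
  \<comment> \<open>The last cell has the weight index \<open>N s div 2 + 1\<close>; N s \<ge> 2 *
    n1 makes it exceed n1.\<close>
  define N0 where "N0 = Max (insert (2 * n1) (range (snd \<circ> w)))"
  have M: "M1 \<le> M" "fst (w s) \<le> M" for s unfolding M_def by (rule Max_ge; auto)+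
  have N0: "2 * n1 \<le> N0" "snd (w s) \<le> N0" for s unfolding N0_def by (rule Max_ge; auto)+
  show ?thesis
  proof (rule exI[of _ M], rule exI[of _ N0], intro allI impI)
    fix N :: "'n \<Rightarrow> nat" and x :: "real ^ 'n" and \<sigma> :: "'n \<Rightarrow> real" and L :: complex and \<beta> :: real
    assume N: "\<forall>j. N0 \<le> N j" and \<sigma>: "\<sigma> \<in> sign_vectors" and L: "norm L \<le> B0"
      and near: "\<forall>u. (\<forall>j. 0 < \<sigma> j * u $ j \<and> \<sigma> j * u $ j \<le> real M * (4 * pi / (2 * real (N j) + 1)))
        \<longrightarrow> norm (f (x + u) - L) \<le> \<beta>"
    have far: "(\<Sum>k=M..N s div 2. ln (real k + 2) ^ p * far_bound s (x $ s) (\<sigma> s) (N s) k) \<le>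
        (2 * B0 * (32 + 4 * pi) + 4 * pi) * \<delta>" for s
    proof (rule sum_far_bound_le)
      show "(\<Sum>k=M..N s div 2. log_weight p (Suc k) / real (Suc k)) \<le> \<delta>"
        using M1[OF M(1), of "Suc (N s div 2)"] by (simp add: atLeastLessThanSuc_atLeastAtMost)
      have "n1 \<le> Suc (N s div 2)" using N0(1) N[rule_format, of s] by linarith
      then show "log_weight p (Suc (N s div 2)) \<le> \<delta>" using n1 by (simp add: less_imp_le)
      have "(\<Sum>k=M..N s div 2. log_weight p (Suc k) * cell_osc s (x $ s) (\<sigma> s) (N s) k) \<le>
          (\<Sum>k=fst (w s)..N s div 2. log_weight p (Suc k) * cell_osc s (x $ s) (\<sigma> s) (N s) k)"
        using M(2)[of s] by (intro sum_mono2 mult_nonneg_nonneg log_weight_nonneg cell_osc_nonneg) auto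
      also have "\<dots> \<le> \<delta>"
        using N0(2)[of s] N[rule_format, of s] by (intro w sign_vectors_abs[OF \<sigma>]) linarith
      finally show "(\<Sum>k=M..N s div 2. log_weight p (Suc k) * cell_osc s (x $ s) (\<sigma> s) (N s) k) \<le> \<delta>" .
    qed (use \<open>\<delta> > 0\<close> in simp)
    have "norm (\<integral>u. (f (x + u) - L) * of_real (\<Prod>j\<in>UNIV. half_kernel (\<sigma> j) (N j) (u $ j)) \<partial>lborel) \<le>
        \<beta> * (4 * pi * real M) ^ CARD('n) +
        (\<Sum>s\<in>UNIV. (12 * pi) ^ p * (\<Sum>k=M..N s div 2. ln (real k + 2) ^ p * far_bound s (x $ s) (\<sigma> s) (N s) k))"
      using near by (intro norm_octant_integral_le \<sigma> L p) simp
    also have "(\<Sum>s\<in>UNIV. (12 * pi) ^ p * (\<Sum>k=M..N s div 2. ln (real k + 2) ^ p * far_bound s (x $ s) (\<sigma> s) (N s) k)) \<le>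
        (\<Sum>s\<in>(UNIV :: 'n set). (12 * pi) ^ p * ((2 * B0 * (32 + 4 * pi) + 4 * pi) * \<delta>))"
      by (intro sum_mono mult_left_mono far) simp
    also have "\<dots> = C * \<delta>" by (simp add: C_def)
    also have "\<dots> = \<epsilon>" using \<open>C > 0\<close> by (simp add: \<delta>_def)
    finally show "norm (\<integral>u. (f (x + u) - L) * of_real (\<Prod>j\<in>UNIV. half_kernel (\<sigma> j) (N j) (u $ j)) \<partial>lborel) \<le>
        \<beta> * (4 * pi * real M) ^ CARD('n) + \<epsilon>" by simp
  qed
qed

end

section \<open>Convergence\<close>

lemma eventually_pringsheim:
  "\<forall>\<^sub>F N in (pringsheim :: ('n::finite \<Rightarrow> nat) filter). \<forall>j. n \<le> N j"
  unfolding pringsheim_def eventually_filtercomap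
proof (rule exI[of _ "\<lambda>m. n \<le> m"], intro conjI allI impI)
  fix N :: "'n \<Rightarrow> nat" and j
  assume "n \<le> Min (range N)"
  also have "Min (range N) \<le> N j" by (rule Min_le) auto
  finally show "n \<le> N j" .
qed (rule eventually_ge_at_top)

context log_sharp_BV
begin

text \<open>Every octant kernel integrates to pi^d, so subtracting \<open>L \<sigma>\<close> inside
  the integral removes \<open>L \<sigma>\<close> times pi^d. Divided by (2 pi)^d this is the average
  over the 2^d octants.\<close>

lemma norm_partial_sum_diff_le:
  "norm (fourier_partial_sum N f x - (\<Sum>\<sigma>\<in>sign_vectors. L \<sigma>) / 2 ^ CARD('n)) \<le>
    (\<Sum>\<sigma>\<in>sign_vectors. norm (\<integral>u. (f (x + u) - L \<sigma>) * of_real (\<Prod>j\<in>UNIV. half_kernel (\<sigma> j) (N j) (u $ j)) \<partial>lborel))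
      / (2 * pi) ^ CARD('n)"
proof -
  let ?P = "\<lambda>\<sigma> (u :: real ^ 'n). of_real (\<Prod>j\<in>UNIV. half_kernel (\<sigma> j) (N j) (u $ j)) :: complex"
  let ?c = "of_real ((2 * pi) ^ CARD('n)) :: complex"
  have c0: "?c \<noteq> 0" by simp
  have f_shift: "(\<lambda>u. f (x + u)) \<in> borel_measurable borel"
    by (rule measurable_compose[OF _ borel_measurable_f]) simp
  have split: "(\<integral>u. (f (x + u) - L \<sigma>) * ?P \<sigma> u \<partial>lborel) = (\<integral>u. f (x + u) * ?P \<sigma> u \<partial>lborel) - L \<sigma> * of_real (pi ^ CARD('n))"
    if \<sigma>: "\<sigma> \<in> sign_vectors" for \<sigma>
  proof -
    have hk: "\<And>j. integrable lborel (half_kernel (\<sigma> j) (N j))"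
      by (rule integrable_half_kernel[OF sign_vectors_abs[OF \<sigma>]])
    have 1: "integrable lborel (\<lambda>u. f (x + u) * ?P \<sigma> u)"
      by (rule integrable_mult_prod[OF hk f_shift, where G=B0]) (rule norm_f_le)
    have int: "integrable lborel (\<lambda>u::real ^ 'n. \<Prod>j\<in>UNIV. half_kernel (\<sigma> j) (N j) (u $ j))"
      by (rule integrable_prod_vec) (rule hk)
    then have 2: "integrable lborel (\<lambda>u. ?P \<sigma> u)" by (simp only: complex_of_real_integrable_eq)
    have "(\<integral>u. ?P \<sigma> u \<partial>lborel) = of_real (\<integral>u. (\<Prod>j\<in>UNIV. half_kernel (\<sigma> j) (N j) (u $ j)) \<partial>(lborel :: (real ^ 'n) measure))"
      by (rule integral_of_real[OF int])
    also have "(\<integral>u. (\<Prod>j\<in>UNIV. half_kernel (\<sigma> j) (N j) (u $ j)) \<partial>(lborel :: (real ^ 'n) measure)) = pi ^ CARD('n)"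
      using integral_prod_vec[of "\<lambda>j. half_kernel (\<sigma> j) (N j)", OF hk]
      by (simp add: integral_half_kernel[OF sign_vectors_abs[OF \<sigma>]])
    finally have 3: "(\<integral>u. ?P \<sigma> u \<partial>lborel) = of_real (pi ^ CARD('n))" .
    have "(\<integral>u. (f (x + u) - L \<sigma>) * ?P \<sigma> u \<partial>lborel) = (\<integral>u. f (x + u) * ?P \<sigma> u - L \<sigma> * ?P \<sigma> u \<partial>lborel)"
      by (simp only: left_diff_distrib)
    also have "\<dots> = (\<integral>u. f (x + u) * ?P \<sigma> u \<partial>lborel) - (\<integral>u. L \<sigma> * ?P \<sigma> u \<partial>lborel)"
      by (rule Bochner_Integration.integral_diff[OF 1 integrable_mult_right[OF 2]])
    also have "(\<integral>u. L \<sigma> * ?P \<sigma> u \<partial>lborel) = L \<sigma> * of_real (pi ^ CARD('n))"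
      by (simp only: integral_mult_right_zero 3)
    finally show ?thesis .
  qed
  have S: "fourier_partial_sum N f x = (\<Sum>\<sigma>\<in>sign_vectors. \<integral>u. f (x + u) * ?P \<sigma> u \<partial>lborel) / ?c"
    by (rule fourier_partial_sum_octants[OF torus_periodic_f borel_measurable_f norm_f_le])
  have "?c = 2 ^ CARD('n) * of_real (pi ^ CARD('n))" by (simp add: power_mult_distrib)
  then have mean: "(\<Sum>\<sigma>\<in>sign_vectors. L \<sigma>) / 2 ^ CARD('n) = (\<Sum>\<sigma>\<in>sign_vectors. L \<sigma> * of_real (pi ^ CARD('n))) / ?c"
    by (simp add: sum_distrib_right[symmetric])
  have "fourier_partial_sum N f x - (\<Sum>\<sigma>\<in>sign_vectors. L \<sigma>) / 2 ^ CARD('n) =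
      (\<Sum>\<sigma>\<in>sign_vectors. \<integral>u. (f (x + u) - L \<sigma>) * ?P \<sigma> u \<partial>lborel) / ?c"
    unfolding S mean diff_divide_distrib[symmetric] sum_subtractf[symmetric]
    by (simp only: split cong: sum.cong)
  also have "norm \<dots> = norm (\<Sum>\<sigma>\<in>sign_vectors. \<integral>u. (f (x + u) - L \<sigma>) * ?P \<sigma> u \<partial>lborel) / (2 * pi) ^ CARD('n)"
    by (simp only: norm_divide norm_of_real) (simp add: power_abs)
  also have "\<dots> \<le> (\<Sum>\<sigma>\<in>sign_vectors. norm (\<integral>u. (f (x + u) - L \<sigma>) * ?P \<sigma> u \<partial>lborel)) / (2 * pi) ^ CARD('n)"
    by (intro divide_right_mono norm_sum) simp
  finally show ?thesis .
qed

text \<open>Common source of both requirements on a class of convergence: X is a single regular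
  point or a compact set of continuity points, and L gives the octant limits.\<close>

lemma uniform_limit_partial_sums:
  assumes p: "p = CARD('n) - 1" and L: "\<And>\<sigma> x. x \<in> X \<Longrightarrow> \<sigma> \<in> sign_vectors \<Longrightarrow> norm (L \<sigma> x) \<le> B0"
    and near: "\<And>\<beta>. \<beta> > 0 \<Longrightarrow> \<exists>\<eta>>0. \<forall>x\<in>X. \<forall>\<sigma>\<in>sign_vectors. \<forall>u.
      (\<forall>j. 0 < \<sigma> j * u $ j \<and> \<sigma> j * u $ j < \<eta>) \<longrightarrow> norm (f (x + u) - L \<sigma> x) \<le> \<beta>"
  shows "uniform_limit X (\<lambda>N. fourier_partial_sum N f) (\<lambda>x. (\<Sum>\<sigma>\<in>sign_vectors. L \<sigma> x) / 2 ^ CARD('n)) pringsheim"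
proof (rule uniform_limitI)
  fix e :: real assume "e > 0"
  \<comment> \<open>Each of the 2^d octants will cost at most 2 \<epsilon>, which adds up to
    e/2.\<close>
  define \<epsilon> where "\<epsilon> = e * (2 * pi) ^ CARD('n) / (4 * 2 ^ CARD('n))"
  have "\<epsilon> > 0" using \<open>e > 0\<close> by (simp add: \<epsilon>_def)
  obtain M N0 where small: "\<forall>N x \<sigma> L \<beta>. (\<forall>j. N0 \<le> N j) \<longrightarrow> \<sigma> \<in> sign_vectors \<longrightarrow> norm L \<le> B0 \<longrightarrow>
    (\<forall>u. (\<forall>j. 0 < \<sigma> j * u $ j \<and> \<sigma> j * u $ j \<le> real M * (4 * pi / (2 * real (N j) + 1)))
      \<longrightarrow> norm (f (x + u) - L) \<le> \<beta>) \<longrightarrow>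
    norm (\<integral>u. (f (x + u) - L) * of_real (\<Prod>j\<in>UNIV. half_kernel (\<sigma> j) (N j) (u $ j)) \<partial>lborel) \<le>
      \<beta> * (4 * pi * real M) ^ CARD('n) + \<epsilon>"
    using octant_integral_small[OF p \<open>\<epsilon> > 0\<close>] by (elim exE)
  define A where "A = (4 * pi * real M) ^ CARD('n)"
  have "A \<ge> 0" by (simp add: A_def)
  define \<beta> where "\<beta> = \<epsilon> / (A + 1)"
  have "\<beta> > 0" using \<open>\<epsilon> > 0\<close> \<open>A \<ge> 0\<close> by (simp add: \<beta>_def)
  have "\<beta> * A \<le> \<epsilon>" using \<open>\<epsilon> > 0\<close> \<open>A \<ge> 0\<close> by (simp add: \<beta>_def field_simps)
  obtain \<eta> where \<eta>: "\<eta> > 0" and near_\<eta>: "\<forall>x\<in>X. \<forall>\<sigma>\<in>sign_vectors. \<forall>u.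
      (\<forall>j. 0 < \<sigma> j * u $ j \<and> \<sigma> j * u $ j < \<eta>) \<longrightarrow> norm (f (x + u) - L \<sigma> x) \<le> \<beta>"
    using near[OF \<open>\<beta> > 0\<close>] by (elim exE conjE)
  have "(\<lambda>n. real M * (4 * pi / (2 * real n + 1))) \<longlonglongrightarrow> 0" by real_asymp
  then have "\<forall>\<^sub>F n in sequentially. real M * (4 * pi / (2 * real n + 1)) < \<eta>"
    using \<eta> by (rule order_tendstoD)
  then obtain N1 where N1: "\<forall>n\<ge>N1. real M * (4 * pi / (2 * real n + 1)) < \<eta>"
    unfolding eventually_sequentially ..
  have "\<forall>\<^sub>F N in (pringsheim :: ('n \<Rightarrow> nat) filter). \<forall>j. max N0 N1 \<le> N j" by (rule eventually_pringsheim)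
  then show "\<forall>\<^sub>F N in pringsheim. \<forall>x\<in>X. dist (fourier_partial_sum N f x) ((\<Sum>\<sigma>\<in>sign_vectors. L \<sigma> x) / 2 ^ CARD('n)) < e"
  proof eventually_elim
    case (elim N)
    show ?case
    proof
      fix x assume x: "x \<in> X"
      have int_le: "norm (\<integral>u. (f (x + u) - L \<sigma> x) * of_real (\<Prod>j\<in>UNIV. half_kernel (\<sigma> j) (N j) (u $ j)) \<partial>lborel) \<le> 2 * \<epsilon>"
        if \<sigma>: "\<sigma> \<in> sign_vectors" for \<sigma>
      proof -
        have "norm (f (x + u) - L \<sigma> x) \<le> \<beta>"
          if u: "\<forall>j. 0 < \<sigma> j * u $ j \<and> \<sigma> j * u $ j \<le> real M * (4 * pi / (2 * real (N j) + 1))" for u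
        proof (rule near_\<eta>[rule_format, OF x \<sigma>])
          fix j
          have "N1 \<le> N j" using elim[rule_format, of j] by simp
          then have "real M * (4 * pi / (2 * real (N j) + 1)) < \<eta>" using N1 by blast
          then show "0 < \<sigma> j * u $ j \<and> \<sigma> j * u $ j < \<eta>" using u[rule_format, of j] by linarith
        qed
        then have "norm (\<integral>u. (f (x + u) - L \<sigma> x) * of_real (\<Prod>j\<in>UNIV. half_kernel (\<sigma> j) (N j) (u $ j)) \<partial>lborel) \<le>
            \<beta> * (4 * pi * real M) ^ CARD('n) + \<epsilon>"
          using elim by (intro small[rule_format] \<sigma> L x) auto
        then show ?thesis using \<open>\<beta> * A \<le> \<epsilon>\<close> by (simp add: A_def)
      qed
      have "norm (fourier_partial_sum N f x - (\<Sum>\<sigma>\<in>sign_vectors. L \<sigma> x) / 2 ^ CARD('n)) \<le>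
          (\<Sum>\<sigma>\<in>sign_vectors. norm (\<integral>u. (f (x + u) - L \<sigma> x) * of_real (\<Prod>j\<in>UNIV. half_kernel (\<sigma> j) (N j) (u $ j)) \<partial>lborel))
            / (2 * pi) ^ CARD('n)"
        by (rule norm_partial_sum_diff_le)
      also have "\<dots> \<le> (\<Sum>\<sigma>\<in>(sign_vectors :: ('n \<Rightarrow> real) set). 2 * \<epsilon>) / (2 * pi) ^ CARD('n)"
        by (intro divide_right_mono sum_mono int_le) auto
      also have "\<dots> = e / 2" by (simp add: card_sign_vectors \<epsilon>_def)
      also have "\<dots> < e" using \<open>e > 0\<close> by simp
      finally show "dist (fourier_partial_sum N f x) ((\<Sum>\<sigma>\<in>sign_vectors. L \<sigma> x) / 2 ^ CARD('n)) < e"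
        by (simp add: dist_norm)
    qed
  qed
qed

end

section \<open>Octant limits and convergence of the partial sums\<close>

lemma octant_box_add_iff:
  fixes u :: "real ^ 'n::finite"
  assumes "\<sigma> \<in> sign_vectors"
  shows "x + u \<in> octant_box \<sigma> x \<longleftrightarrow> (\<forall>j. 0 < \<sigma> j * u $ j \<and> \<sigma> j * u $ j < 1)"
proof -
  have "(x + u) $ j \<in> open_segment (x $ j) (x $ j + \<sigma> j) \<longleftrightarrow> 0 < \<sigma> j * u $ j \<and> \<sigma> j * u $ j < 1" for j
  proof -
    have "\<sigma> j = 1 \<or> \<sigma> j = -1" using sign_vectors_abs[OF assms, of j] by linarith
    then show ?thesis by (auto simp: open_segment_eq_real_ivl)
  qed
  then show ?thesis by (simp add: octant_box_def)
qed

lemma norm_less_sum_bound: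
  fixes u :: "real ^ 'n::finite"
  assumes \<sigma>: "\<sigma> \<in> sign_vectors" and u: "\<And>j. 0 < \<sigma> j * u $ j \<and> \<sigma> j * u $ j < \<eta>"
  shows "norm u < real CARD('n) * \<eta>"
proof -
  have "\<bar>u $ j\<bar> < \<eta>" for j
    using u[of j] sign_vectors_abs[OF \<sigma>, of j] abs_mult[of "\<sigma> j" "u $ j"] by simp
  then have "(\<Sum>j\<in>UNIV. \<bar>u $ j\<bar>) < (\<Sum>j\<in>(UNIV :: 'n set). \<eta>)"
    by (intro sum_strict_mono) auto
  then show ?thesis using norm_le_l1_cart[of u] by simp
qed

text \<open>Makes octant limits unique, so that \<open>Lim\<close> in \<open>octant_mean\<close>
  really returns them.\<close>

lemma at_within_octant_box_neq_bot:
  fixes x :: "real ^ 'n::finite"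
  assumes \<sigma>: "\<sigma> \<in> sign_vectors"
  shows "at x within octant_box \<sigma> x \<noteq> bot"
  unfolding trivial_limit_within islimpt_approachable not_not
proof (intro allI impI)
  fix e :: real assume "e > 0"
  define h where "h = min (1 / 2) (e / (2 * real CARD('n)))"
  have h: "0 < h" "h < 1" "h < e / real CARD('n)"
    using \<open>e > 0\<close> by (auto simp: h_def min_less_iff_disj divide_strict_left_mono frac_less2)
  define u where "u = (\<chi> j. \<sigma> j * h)"
  have su: "\<sigma> j * u $ j = h" for j
    using sign_vectors_abs[OF \<sigma>, of j] by (auto simp: u_def abs_if split: if_splits)
  have "x + u \<in> octant_box \<sigma> x" unfolding octant_box_add_iff[OF \<sigma>] su using h by simp
  moreover have "norm u < real CARD('n) * (e / real CARD('n))"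
    by (rule norm_less_sum_bound[OF \<sigma>]) (use su h in simp)
  then have "dist (x + u) x < e" by (simp add: dist_norm)
  moreover have "x + u \<noteq> x"
  proof
    assume "x + u = x"
    then have "u = 0" by simp
    then show False using su[of undefined] h(1) by simp
  qed
  ultimately show "\<exists>x'\<in>octant_box \<sigma> x. x' \<noteq> x \<and> dist x' x < e" by blast
qed

lemma octant_limitD:
  fixes f :: "real ^ 'n::finite \<Rightarrow> complex"
  assumes \<sigma>: "\<sigma> \<in> sign_vectors" and lim: "(f \<longlongrightarrow> l) (at x within octant_box \<sigma> x)" and "\<beta> > 0"
  shows "\<exists>\<eta>>0. \<forall>u. (\<forall>j. 0 < \<sigma> j * u $ j \<and> \<sigma> j * u $ j < \<eta>) \<longrightarrow> norm (f (x + u) - l) \<le> \<beta>"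
proof -
  obtain d where "d > 0" and d: "\<forall>t\<in>octant_box \<sigma> x. 0 < dist t x \<and> dist t x < d \<longrightarrow> dist (f t) l < \<beta>"
    using lim \<open>\<beta> > 0\<close> unfolding Lim_within by blast
  \<comment> \<open>The 1 keeps x + u inside the octant box of side 1; division by the dimension
    turns a coordinatewise bound into one on the Euclidean norm.\<close>
  define \<eta> where "\<eta> = min 1 (d / real CARD('n))"
  have \<eta>: "\<eta> > 0" "\<eta> \<le> 1" "real CARD('n) * \<eta> \<le> d"
    using \<open>d > 0\<close> by (auto simp: \<eta>_def min_def field_simps)
  have "norm (f (x + u) - l) \<le> \<beta>" if u: "\<forall>j. 0 < \<sigma> j * u $ j \<and> \<sigma> j * u $ j < \<eta>" for u
  proof -
    have "x + u \<in> octant_box \<sigma> x"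
      unfolding octant_box_add_iff[OF \<sigma>] using u \<eta>(2) less_le_trans by blast
    moreover have "norm u < real CARD('n) * \<eta>"
      by (rule norm_less_sum_bound[OF \<sigma> u[rule_format]])
    then have "dist (x + u) x < d" using \<eta>(3) by (simp add: dist_norm)
    moreover have "u \<noteq> 0" using u[rule_format, of undefined] by auto
    ultimately have "dist (f (x + u)) l < \<beta>" using d by simp
    then show ?thesis by (simp add: dist_norm)
  qed
  then show ?thesis using \<eta>(1) by blast
qed

context log_sharp_BV
begin

lemma norm_octant_limit_le:
  assumes \<sigma>: "\<sigma> \<in> sign_vectors" and lim: "(f \<longlongrightarrow> l) (at x within octant_box \<sigma> x)"
  shows "norm l \<le> B0"
proof (rule tendsto_upperbound)
  show "((\<lambda>t. norm (f t)) \<longlongrightarrow> norm l) (at x within octant_box \<sigma> x)" by (rule tendsto_norm[OF lim])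
  show "\<forall>\<^sub>F t in at x within octant_box \<sigma> x. norm (f t) \<le> B0" by (simp add: norm_f_le)
  show "at x within octant_box \<sigma> x \<noteq> bot" by (rule at_within_octant_box_neq_bot[OF \<sigma>])
qed

lemma partial_sums_tendsto_octant_mean:
  assumes p: "p = CARD('n) - 1" and reg: "regular_point f x"
  shows "((\<lambda>N. fourier_partial_sum N f x) \<longlongrightarrow> octant_mean f x) pringsheim"
proof -
  let ?L = "\<lambda>\<sigma> x. Lim (at x within octant_box \<sigma> x) f"
  have lim: "(f \<longlongrightarrow> ?L \<sigma> x) (at x within octant_box \<sigma> x)" if \<sigma>: "\<sigma> \<in> sign_vectors" for \<sigma>
  proof -
    obtain l where l: "(f \<longlongrightarrow> l) (at x within octant_box \<sigma> x)"
      using reg \<sigma> unfolding regular_point_def by blast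
    then show ?thesis using tendsto_Lim[OF at_within_octant_box_neq_bot[OF \<sigma>] l] by simp
  qed
  have "uniform_limit {x} (\<lambda>N. fourier_partial_sum N f) (\<lambda>x. (\<Sum>\<sigma>\<in>sign_vectors. ?L \<sigma> x) / 2 ^ CARD('n)) pringsheim"
  proof (rule uniform_limit_partial_sums[OF p])
    show "norm (?L \<sigma> y) \<le> B0" if "y \<in> {x}" "\<sigma> \<in> sign_vectors" for y \<sigma>
      using norm_octant_limit_le[OF that(2) lim[OF that(2)]] that(1) by simp
    fix \<beta> :: real assume "\<beta> > 0"
    have "\<forall>\<sigma>\<in>sign_vectors. \<exists>\<eta>. \<eta> > 0 \<and> (\<forall>u. (\<forall>j. 0 < \<sigma> j * u $ j \<and> \<sigma> j * u $ j < \<eta>) \<longrightarrow> norm (f (x + u) - ?L \<sigma> x) \<le> \<beta>)"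
      using octant_limitD[OF _ lim \<open>\<beta> > 0\<close>] by simp
    from bchoice[OF this] obtain h where h: "\<forall>\<sigma>\<in>sign_vectors. h \<sigma> > 0 \<and>
        (\<forall>u. (\<forall>j. 0 < \<sigma> j * u $ j \<and> \<sigma> j * u $ j < h \<sigma>) \<longrightarrow> norm (f (x + u) - ?L \<sigma> x) \<le> \<beta>)" ..
    define \<eta> where "\<eta> = Min (insert 1 (h ` sign_vectors))"
    have fin: "finite (insert 1 (h ` sign_vectors))" by (intro finite.insertI finite_imageI finite_sign_vectors)
    have "0 < t" if "t \<in> insert 1 (h ` sign_vectors)" for t
      using that h by (elim insertE imageE) simp_all
    then have "\<eta> > 0" using Min_in[OF fin] by (simp add: \<eta>_def)
    have \<eta>_le: "\<eta> \<le> h \<sigma>" if "\<sigma> \<in> sign_vectors" for \<sigma>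
      unfolding \<eta>_def using that by (intro Min_le[OF fin]) simp
    show "\<exists>\<eta>>0. \<forall>x'\<in>{x}. \<forall>\<sigma>\<in>sign_vectors. \<forall>u.
        (\<forall>j. 0 < \<sigma> j * u $ j \<and> \<sigma> j * u $ j < \<eta>) \<longrightarrow> norm (f (x' + u) - ?L \<sigma> x') \<le> \<beta>"
    proof (rule exI[of _ \<eta>], intro conjI \<open>\<eta> > 0\<close> ballI allI impI)
      fix x' \<sigma> and u :: "real ^ 'n"
      assume x': "x' \<in> {x}" and \<sigma>: "\<sigma> \<in> sign_vectors" and u: "\<forall>j. 0 < \<sigma> j * u $ j \<and> \<sigma> j * u $ j < \<eta>"
      have "\<forall>j. 0 < \<sigma> j * u $ j \<and> \<sigma> j * u $ j < h \<sigma>"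
      proof
        fix j show "0 < \<sigma> j * u $ j \<and> \<sigma> j * u $ j < h \<sigma>" using u[rule_format, of j] \<eta>_le[OF \<sigma>] by linarith
      qed
      then show "norm (f (x' + u) - ?L \<sigma> x') \<le> \<beta>" using h \<sigma> x' by simp
    qed
  qed
  then show ?thesis
    unfolding octant_mean_def by (rule tendsto_uniform_limitI) simp
qed

text \<open>Here y may lie outside K, so uniform continuity of the restriction to K would not
  suffice. The radius is a Lebesgue number of a cover of K by open sets on which g varies by at most
  \<beta>.\<close>

lemma uniformly_continuous_near_compact:
  fixes g :: "real ^ 'm::finite \<Rightarrow> complex"
  assumes "compact K" and cont: "\<And>x. x \<in> K \<Longrightarrow> isCont g x" and "\<beta> > 0"
  shows "\<exists>\<eta>>0. \<forall>x\<in>K. \<forall>y. dist y x < \<eta> \<longrightarrow> norm (g y - g x) \<le> \<beta>"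
proof -
  define \<G> where "\<G> = {G. open G \<and> (\<forall>y\<in>G. \<forall>z\<in>G. norm (g y - g z) \<le> \<beta>)}"
  have "K \<subseteq> \<Union>\<G>"
  proof
    fix x assume "x \<in> K"
    obtain d where "d > 0" and d: "\<forall>y. dist y x < d \<longrightarrow> dist (g y) (g x) < \<beta> / 2"
      using cont[OF \<open>x \<in> K\<close>] half_gt_zero[OF \<open>\<beta> > 0\<close>] unfolding continuous_at_eps_delta by blast
    have "norm (g y - g z) \<le> \<beta>" if "y \<in> ball x d" "z \<in> ball x d" for y z
    proof -
      have "dist y x < d" "dist z x < d" using that by (simp_all add: dist_commute)
      then have "dist (g y) (g x) < \<beta> / 2" "dist (g z) (g x) < \<beta> / 2" using d by blast+
      then have "dist (g y) (g z) \<le> \<beta>" using dist_triangle2[of "g y" "g z" "g x"] by linarith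
      then show ?thesis by (simp add: dist_norm)
    qed
    then have "ball x d \<in> \<G>" by (simp add: \<G>_def)
    moreover have "x \<in> ball x d" using \<open>d > 0\<close> by simp
    ultimately show "x \<in> \<Union>\<G>" by blast
  qed
  moreover have "\<And>G. G \<in> \<G> \<Longrightarrow> open G" by (simp add: \<G>_def)
  ultimately obtain \<eta> where "\<eta> > 0" and \<eta>: "\<And>x. x \<in> K \<Longrightarrow> \<exists>G\<in>\<G>. ball x \<eta> \<subseteq> G"
    using Heine_Borel_lemma[OF \<open>compact K\<close>] by metis
  have "norm (g y - g x) \<le> \<beta>" if x: "x \<in> K" and y: "dist y x < \<eta>" for x y
  proof -
    obtain G where "G \<in> \<G>" "ball x \<eta> \<subseteq> G" using \<eta>[OF x] by blast
    moreover have "y \<in> ball x \<eta>" "x \<in> ball x \<eta>" using y \<open>\<eta> > 0\<close> by (simp_all add: dist_commute)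
    ultimately show ?thesis unfolding \<G>_def by blast
  qed
  then show ?thesis using \<open>\<eta> > 0\<close> by blast
qed

lemma partial_sums_uniform_limit:
  assumes p: "p = CARD('n) - 1" and "compact K" and cont: "\<And>x. x \<in> K \<Longrightarrow> isCont f x"
  shows "uniform_limit K (\<lambda>N. fourier_partial_sum N f) (octant_mean f) pringsheim"
proof -
  have Lim_eq: "Lim (at x within octant_box \<sigma> x) f = f x" if "x \<in> K" "\<sigma> \<in> sign_vectors" for x \<sigma>
  proof (rule tendsto_Lim[OF at_within_octant_box_neq_bot[OF that(2)]])
    show "(f \<longlongrightarrow> f x) (at x within octant_box \<sigma> x)"
      by (rule Lim_at_imp_Lim_at_within) (use cont[OF that(1)] in \<open>simp add: isCont_def\<close>)
  qed
  show ?thesis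
    unfolding octant_mean_def[abs_def]
  proof (rule uniform_limit_partial_sums[OF p])
    show "norm (Lim (at x within octant_box \<sigma> x) f) \<le> B0" if "x \<in> K" "\<sigma> \<in> sign_vectors" for x \<sigma>
      by (simp only: Lim_eq[OF that] norm_f_le)
    fix \<beta> :: real assume "\<beta> > 0"
    obtain d where "d > 0" and d: "\<forall>x\<in>K. \<forall>y. dist y x < d \<longrightarrow> norm (f y - f x) \<le> \<beta>"
    proof -
      have "\<exists>d>0. \<forall>x\<in>K. \<forall>y. dist y x < d \<longrightarrow> norm (f y - f x) \<le> \<beta>"
        by (rule uniformly_continuous_near_compact[OF \<open>compact K\<close> _ \<open>\<beta> > 0\<close>]) (rule cont)
      then show ?thesis using that by blast
    qed
    show "\<exists>\<eta>>0. \<forall>x\<in>K. \<forall>\<sigma>\<in>sign_vectors. \<forall>u. (\<forall>j. 0 < \<sigma> j * u $ j \<and> \<sigma> j * u $ j < \<eta>) \<longrightarrow>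
        norm (f (x + u) - Lim (at x within octant_box \<sigma> x) f) \<le> \<beta>"
    proof (rule exI[of _ "d / real CARD('n)"], intro conjI ballI allI impI)
      show "0 < d / real CARD('n)" using \<open>d > 0\<close> by simp
      fix x \<sigma> and u :: "real ^ 'n"
      assume x: "x \<in> K" and \<sigma>: "\<sigma> \<in> sign_vectors" and u: "\<forall>j. 0 < \<sigma> j * u $ j \<and> \<sigma> j * u $ j < d / real CARD('n)"
      have "norm u < real CARD('n) * (d / real CARD('n))"
        by (rule norm_less_sum_bound[OF \<sigma> u[rule_format]])
      then have "dist (x + u) x < d" by (simp add: dist_norm)
      then show "norm (f (x + u) - Lim (at x within octant_box \<sigma> x) f) \<le> \<beta>"
        using d x by (simp only: Lim_eq[OF x \<sigma>]) 
    qed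
  qed
qed

lemma f_in_L1_torus: "f \<in> L1_torus"
proof -
  have "integrable lborel (\<lambda>x. indicator torus_cube x *\<^sub>R f x)"
    by (rule integrable_indicator_bounded[OF borel_measurable_f norm_f_le torus_cube_borel bounded_torus_cube])
  then have "integrable lebesgue (\<lambda>x. indicator torus_cube x *\<^sub>R f x)"
    using borel_measurable_integrable[of lborel] by (subst integrable_completion) auto
  then show ?thesis by (simp add: L1_torus_def set_integrable_def torus_periodic_f)
qed

end

theorem sharp_BV_class_of_convergence:
  "class_of_convergence
     (sharp_BV (\<lambda>n. real n / ln (real n + 1) ^ (CARD('n) - 1)) :: (real ^ 'n::finite \<Rightarrow> complex) set)"
  unfolding class_of_convergence_def
proof (intro conjI subsetI ballI allI impI)
  fix f :: "real ^ 'n \<Rightarrow> complex"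
  assume "f \<in> sharp_BV (\<lambda>n. real n / ln (real n + 1) ^ (CARD('n) - 1))"
  then interpret log_sharp_BV "CARD('n) - 1" f by unfold_locales
  show "f \<in> L1_torus" by (rule f_in_L1_torus)
  show "((\<lambda>N. fourier_partial_sum N f x) \<longlongrightarrow> octant_mean f x) pringsheim" if "regular_point f x" for x
    by (rule partial_sums_tendsto_octant_mean[OF HOL.refl that])
  show "uniform_limit K (\<lambda>N. fourier_partial_sum N f) (octant_mean f) pringsheim"
    if "compact K \<and> (\<forall>x\<in>K. isCont f x)" for K
    using that by (intro partial_sums_uniform_limit[OF HOL.refl]) auto
qed

section \<open>Divergence\<close>

text \<open>On \<open>[0, 2\<pi>]\<close> this is \<open>sin ((N + 1/2) t)\<close>: it is bounded by 1 and Lipschitz, but its \<open>N\<close>-th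
  partial sum at 0 is of order \<open>log N\<close>.\<close>

definition sine_block :: "nat \<Rightarrow> real \<Rightarrow> real" where
  "sine_block N t = \<bar>sin (t / 2)\<bar> * dirichlet N t"

lemma dirichlet_periodic: "dirichlet N (t + 2 * pi) = dirichlet N t"
proof -
  have "cos (real k * (t + 2 * pi)) = cos (real k * t)" for k
  proof -
    have "real k * (t + 2 * pi) = real k * t + 2 * real k * pi" by (simp add: algebra_simps)
    then show ?thesis by (simp only: cos_add cos_2npi sin_2npi mult_1_right mult_zero_right diff_zero)
  qed
  then show ?thesis by (simp only: dirichlet_def)
qed

lemma sine_block_periodic: "sine_block N (t + 2 * pi) = sine_block N t"
proof -
  have "(t + 2 * pi) / 2 = t / 2 + pi" by simp
  then have "\<bar>sin ((t + 2 * pi) / 2)\<bar> = \<bar>sin (t / 2)\<bar>" by (simp only: sin_periodic_pi abs_minus_cancel)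
  then show ?thesis by (simp only: sine_block_def dirichlet_periodic)
qed

lemma abs_sine_block_le: "\<bar>sine_block N t\<bar> \<le> 1"
proof -
  have "\<bar>sine_block N t\<bar> = \<bar>sin (t / 2) * dirichlet N t\<bar>" by (simp add: sine_block_def abs_mult)
  also have "\<dots> \<le> 1" unfolding sin_half_mult_dirichlet by (rule abs_sin_le_one)
  finally show ?thesis .
qed

lemma sine_block_eq: "0 \<le> t \<Longrightarrow> t \<le> 2 * pi \<Longrightarrow> sine_block N t = sin ((real N + 1 / 2) * t)"
  unfolding sine_block_def sin_half_mult_dirichlet[symmetric] by (simp add: sin_ge_zero)

lemma sine_block_lipschitz:
  assumes "0 \<le> a" "a \<le> 2 * pi" "0 \<le> b" "b \<le> 2 * pi"
  shows "\<bar>sine_block N b - sine_block N a\<bar> \<le> (real N + 1 / 2) * \<bar>b - a\<bar>"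
proof -
  have "\<bar>sine_block N b - sine_block N a\<bar> \<le> \<bar>(real N + 1 / 2) * b - (real N + 1 / 2) * a\<bar>"
    using assms by (simp only: sine_block_eq abs_sin_diff_le)
  also have "\<dots> = (real N + 1 / 2) * \<bar>b - a\<bar>" by (simp add: abs_mult flip: right_diff_distrib)
  finally show ?thesis .
qed

lemma continuous_on_sine_block [continuous_intros]: "continuous_on A (sine_block N)"
  unfolding sine_block_def by (intro continuous_intros) auto

lemma borel_measurable_sine_block [measurable]: "sine_block N \<in> borel_measurable borel"
  by (intro borel_measurable_continuous_onI continuous_intros)

text \<open>With m = 2N + 1 it identifies sin^2((N + 1/2) t) / sin(t/2), the product of block and
  kernel, with a sum of sines that can be integrated term by term.\<close>

lemma sin_half_mult_sum_sin:
  "sin (t / 2) * (\<Sum>k<m. sin ((real k + 1 / 2) * t)) = (sin (real m / 2 * t))\<^sup>2"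
proof -
  have "2 * (sin (t / 2) * (\<Sum>k<m. sin ((real k + 1 / 2) * t))) = 1 - cos (real m * t)"
  proof (induction m)
    case (Suc m)
    have "2 * (sin (t / 2) * sin ((real m + 1 / 2) * t)) =
        cos ((real m + 1 / 2) * t - t / 2) - cos ((real m + 1 / 2) * t + t / 2)"
      by (simp add: cos_diff cos_add)
    also have "(real m + 1 / 2) * t - t / 2 = real m * t" by (simp add: algebra_simps)
    also have "(real m + 1 / 2) * t + t / 2 = real (Suc m) * t" by (simp add: algebra_simps)
    finally show ?case using Suc by (simp add: distrib_left)
  qed simp
  also have "\<dots> = 2 * (sin (real m / 2 * t))\<^sup>2"
    using cos_double_sin[of "real m / 2 * t"] by simp
  finally show ?thesis by simp
qed

text \<open>Each sin((k + 1/2) t) integrates over \<open>{0..2 * pi}\<close> to 2/(k + 1/2). All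
  these terms are positive, and their sum dominates twice a harmonic sum.\<close>

lemma
  fixes N :: nat
  defines "\<phi> \<equiv> \<lambda>t. indicator {0..<2 * pi} t * (sine_block N t * dirichlet N t) :: real"
  shows integrable_sine_block_dirichlet: "integrable lborel \<phi>"
    and integral_sine_block_dirichlet: "2 * ln (real N + 1) \<le> integral\<^sup>L lborel \<phi>"
proof -
  let ?g = "\<lambda>t. \<Sum>k<2 * N + 1. sin ((real k + 1 / 2) * t)"
  let ?F = "\<lambda>t. \<Sum>k<2 * N + 1. - cos ((real k + 1 / 2) * t) / (real k + 1 / 2)"
  have "has_bochner_integral lborel (\<lambda>t. ?g t * indicator {0..2 * pi} t) (?F (2 * pi) - ?F 0)"
  proof (rule has_bochner_integral_FTC_Icc_real)
    show "(?F has_real_derivative ?g t) (at t)" for t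
    proof (rule DERIV_sum)
      fix k :: nat
      define \<nu> where "\<nu> = real k + 1 / 2"
      have "\<nu> > 0" by (simp add: \<nu>_def)
      show "((\<lambda>t. - cos ((real k + 1 / 2) * t) / (real k + 1 / 2)) has_real_derivative sin ((real k + 1 / 2) * t)) (at t)"
        unfolding \<nu>_def[symmetric] using \<open>\<nu> > 0\<close> by (auto intro!: derivative_eq_intros)
    qed
    show "isCont ?g t" for t by (intro continuous_intros)
  qed simp
  moreover have "?F (2 * pi) - ?F 0 = (\<Sum>k<2 * N + 1. 2 / (real k + 1 / 2))"
  proof -
    have "- cos ((real k + 1 / 2) * (2 * pi)) / (real k + 1 / 2) - - cos ((real k + 1 / 2) * 0) / (real k + 1 / 2) =
        2 / (real k + 1 / 2)" for k
    proof -
      have "(real k + 1 / 2) * (2 * pi) = 2 * real k * pi + pi" by (simp add: algebra_simps)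
      then have "cos ((real k + 1 / 2) * (2 * pi)) = - 1"
        by (simp only: cos_periodic_pi cos_2npi)
      then show ?thesis by (simp add: diff_divide_distrib[symmetric])
    qed
    then show ?thesis by (simp only: sum_subtractf[symmetric])
  qed
  moreover have "AE t in lborel. ?g t * indicator {0..2 * pi} t = \<phi> t"
    using AE_lborel_singleton[of 0] AE_lborel_singleton[of "2 * pi"]
  proof eventually_elim
    case (elim t)
    show ?case
    proof (cases "t \<in> {0..<2 * pi}")
      case True
      then have t: "0 < t" "t < 2 * pi" using elim by auto
      have s: "sin (t / 2) > 0" using t by (intro sin_gt_zero) auto
      have "sin (t / 2) * (sine_block N t * dirichlet N t) = (sin ((real N + 1 / 2) * t))\<^sup>2"
        using sin_half_mult_dirichlet[of t N] sine_block_eq[of t N] t by (simp add: power2_eq_square mult_ac)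
      also have "(real N + 1 / 2) * t = real (2 * N + 1) / 2 * t" by (simp add: field_simps)
      finally have "sin (t / 2) * (sine_block N t * dirichlet N t) = sin (t / 2) * ?g t"
        by (simp only: sin_half_mult_sum_sin)
      then have "sine_block N t * dirichlet N t = ?g t" using s by simp
      then show ?thesis using True by (simp only: \<phi>_def) (simp add: indicator_def)
    next
      case False
      then show ?thesis using elim by (auto simp: \<phi>_def indicator_def)
    qed
  qed
  ultimately have has: "has_bochner_integral lborel \<phi> (\<Sum>k<2 * N + 1. 2 / (real k + 1 / 2))"
    by (subst has_bochner_integral_cong_AE[symmetric, rotated 2]) (auto simp: \<phi>_def)
  then show "integrable lborel \<phi>" by (rule integrable.intros)
  have "2 * ln (real N + 1) \<le> 2 * ln (real (2 * N + 1) + 1)" by simp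
  also have "\<dots> \<le> 2 * (\<Sum>i=1..2 * N + 1. log_weight 0 i)"
    using ln_power_le_sum_log_weight[of "2 * N + 1" 0] by (intro mult_left_mono) simp_all
  also have "(\<Sum>i=1..2 * N + 1. log_weight 0 i) = (\<Sum>k<2 * N + 1. log_weight 0 (Suc k))"
    by (simp only: One_nat_def sum.atLeast1_atMost_eq)
  also have "2 * \<dots> = (\<Sum>k<2 * N + 1. 2 / (real k + 1))"
    by (simp add: log_weight_def sum_distrib_left add.commute)
  also have "\<dots> \<le> (\<Sum>k<2 * N + 1. 2 / (real k + 1 / 2))"
    by (intro sum_mono divide_left_mono) auto
  also have "\<dots> = integral\<^sup>L lborel \<phi>" by (rule has_bochner_integral_integral_eq[OF has, symmetric])
  finally show "2 * ln (real N + 1) \<le> integral\<^sup>L lborel \<phi>" .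
qed

section \<open>Products of sine blocks\<close>

definition product_block :: "nat \<Rightarrow> real ^ 'n::finite \<Rightarrow> real" where
  "product_block N x = (\<Prod>j\<in>UNIV. sine_block N (x $ j))"

lemma abs_product_block_le: "\<bar>product_block N x\<bar> \<le> 1"
  unfolding product_block_def abs_prod by (intro prod_le_1 conjI abs_ge_zero abs_sine_block_le)

lemma continuous_on_product_block [continuous_intros]: "continuous_on A (product_block N)"
  unfolding product_block_def
  by (intro continuous_on_prod continuous_on_compose2[OF continuous_on_sine_block[of UNIV]] continuous_intros) auto

lemma product_block_periodic: "product_block N (x + axis i (2 * pi)) = product_block N x"
proof -
  have "sine_block N ((x + axis i (2 * pi)) $ j) = sine_block N (x $ j)" for j
    by (cases "j = i") (simp_all add: axis_def sine_block_periodic)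
  then show ?thesis by (simp only: product_block_def)
qed

lemma product_block_increment:
  fixes y :: "real ^ 'n::finite" and N :: nat and s :: 'n
  assumes "0 \<le> a" "a < b" "b < 2 * pi"
  defines "D \<equiv> \<bar>product_block N (\<chi> j. if j = s then b else y $ j) - product_block N (\<chi> j. if j = s then a else y $ j)\<bar>"
  shows "D \<le> 2" "D \<le> (real N + 1 / 2) * (b - a)"
proof -
  let ?x = "\<lambda>c. \<chi> j. if j = s then c else y $ j"
  show "D \<le> 2"
    unfolding D_def using abs_product_block_le[of N "?x b"] abs_product_block_le[of N "?x a"] by linarith
  have eq: "product_block N (?x c) = sine_block N c * (\<Prod>j\<in>UNIV - {s}. sine_block N (y $ j))" for c
    unfolding product_block_def by (subst prod.remove[of UNIV s]) (auto intro!: prod.cong)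
  have "\<bar>\<Prod>j\<in>UNIV - {s}. sine_block N (y $ j)\<bar> \<le> 1"
    unfolding abs_prod by (intro prod_le_1 conjI abs_ge_zero abs_sine_block_le)
  moreover have "D = \<bar>sine_block N b - sine_block N a\<bar> * \<bar>\<Prod>j\<in>UNIV - {s}. sine_block N (y $ j)\<bar>"
    unfolding D_def eq by (simp add: abs_mult flip: left_diff_distrib)
  ultimately have "D \<le> \<bar>sine_block N b - sine_block N a\<bar>" by (simp add: mult_left_le)
  also have "\<dots> \<le> (real N + 1 / 2) * \<bar>b - a\<bar>" using assms by (intro sine_block_lipschitz) auto
  finally show "D \<le> (real N + 1 / 2) * (b - a)" using assms by simp
qed

text \<open>Block and kernel are both products over the coordinates, so the cubical sum at 0 is the
  d-th power of a one-dimensional integral and carries d logarithms.\<close>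

lemma partial_sum_product_block:
  "\<exists>r \<ge> (ln (real N + 1) / pi) ^ CARD('n).
    fourier_partial_sum (\<lambda>_. N) (\<lambda>x :: real ^ 'n::finite. complex_of_real (product_block N x)) 0 = of_real r"
proof -
  define \<phi> where "\<phi> = (\<lambda>t. indicator {0..<2 * pi} t * (sine_block N t * dirichlet N t) :: real)"
  have int: "integrable lborel \<phi>" unfolding \<phi>_def by (rule integrable_sine_block_dirichlet)
  have ge: "2 * ln (real N + 1) \<le> integral\<^sup>L lborel \<phi>" unfolding \<phi>_def by (rule integral_sine_block_dirichlet)
  have meas: "(\<lambda>x :: real ^ 'n. complex_of_real (product_block N x)) \<in> borel_measurable borel"
    by (intro borel_measurable_continuous_onI continuous_intros)
  have "fourier_partial_sum (\<lambda>_. N) (\<lambda>x :: real ^ 'n. complex_of_real (product_block N x)) 0 =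
      (\<integral>t. indicator torus_cube t *\<^sub>R (complex_of_real (product_block N t) * of_real (\<Prod>j\<in>UNIV. dirichlet N (0 $ j - t $ j))) \<partial>(lborel :: (real ^ 'n) measure))
        / of_real ((2 * pi) ^ CARD('n))"
    by (rule fourier_partial_sum_eq[OF meas, where B=1]) (simp add: abs_product_block_le)
  also have "(\<integral>t. indicator torus_cube t *\<^sub>R (complex_of_real (product_block N t) * of_real (\<Prod>j\<in>UNIV. dirichlet N (0 $ j - t $ j))) \<partial>(lborel :: (real ^ 'n) measure)) =
      (\<integral>t. complex_of_real (\<Prod>j\<in>UNIV. \<phi> (t $ j)) \<partial>(lborel :: (real ^ 'n) measure))"
  proof (intro Bochner_Integration.integral_cong HOL.refl)
    fix t :: "real ^ 'n"
    have ind: "(\<Prod>j\<in>UNIV. indicator {0..<2 * pi} (t $ j) :: real) = indicator torus_cube t"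
      by (auto simp: indicator_def torus_cube_def)
    have "(\<Prod>j\<in>UNIV. \<phi> (t $ j)) = indicator torus_cube t * (product_block N t * (\<Prod>j\<in>UNIV. dirichlet N (t $ j)))"
      unfolding \<phi>_def prod.distrib ind product_block_def ..
    moreover have "dirichlet N (0 $ j - t $ j) = dirichlet N (t $ j)" for j by simp
    ultimately show "indicator torus_cube t *\<^sub>R (complex_of_real (product_block N t) * of_real (\<Prod>j\<in>UNIV. dirichlet N (0 $ j - t $ j))) =
        (of_real (\<Prod>j\<in>UNIV. \<phi> (t $ j)) :: complex)"
      by (simp only: scaleR_conv_of_real of_real_mult)
  qed
  also have "\<dots> = of_real (\<integral>t. (\<Prod>j\<in>UNIV. \<phi> (t $ j)) \<partial>(lborel :: (real ^ 'n) measure))"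
    by (rule integral_of_real, rule integrable_prod_vec[of "\<lambda>_. \<phi>"]) (rule int)
  also have "(\<integral>t. (\<Prod>j\<in>UNIV. \<phi> (t $ j)) \<partial>(lborel :: (real ^ 'n) measure)) = integral\<^sup>L lborel \<phi> ^ CARD('n)"
    using integral_prod_vec[of "\<lambda>_::'n. \<phi>", OF int] by simp
  also have "of_real (integral\<^sup>L lborel \<phi> ^ CARD('n)) / of_real ((2 * pi) ^ CARD('n)) =
      (of_real ((integral\<^sup>L lborel \<phi> / (2 * pi)) ^ CARD('n)) :: complex)"
    by (simp only: power_divide of_real_divide)
  finally have eq: "fourier_partial_sum (\<lambda>_. N) (\<lambda>x :: real ^ 'n. complex_of_real (product_block N x)) 0 =
      of_real ((integral\<^sup>L lborel \<phi> / (2 * pi)) ^ CARD('n))" .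
  have "ln (real N + 1) / pi = 2 * ln (real N + 1) / (2 * pi)" by simp
  also have "\<dots> \<le> integral\<^sup>L lborel \<phi> / (2 * pi)" by (rule divide_right_mono[OF ge]) simp
  finally have "(ln (real N + 1) / pi) ^ CARD('n) \<le> (integral\<^sup>L lborel \<phi> / (2 * pi)) ^ CARD('n)"
    by (rule power_mono) simp
  then show ?thesis using eq by blast
qed

text \<open>For larger p the weights grow at first, so decrease beyond N holds only up to a
  constant. With y the logarithm of (i+1)/(N+1), ln(i+1) is at most (1 + 2y) ln(N+1) because ln(N+1)
  \<ge> 1/2, and (1 + 2y)^p \<le> (2p)^p exp y. The factor exp y = (i+1)/(N+1) then cancels the
  decay of 1/i down to that of 1/(N+1); the last factor 2 is (i+1)/i.\<close>

lemma log_weight_le: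
  assumes "1 \<le> p" "1 \<le> N" "N \<le> i"
  shows "log_weight p i \<le> 2 * (2 * real p) ^ p * (ln (real N + 1) ^ p / (real N + 1))"
proof -
  define y where "y = ln ((real i + 1) / (real N + 1))"
  have "y \<ge> 0" using assms by (simp add: y_def)
  have "ln 2 \<le> ln (real N + 1)" using assms by simp
  then have half: "1 / 2 \<le> ln (real N + 1)" using ln2_ge_two_thirds by linarith
  have "ln (real i + 1) = ln (real N + 1) + y" by (simp add: y_def ln_div)
  also have "y \<le> 2 * y * ln (real N + 1)" using mult_left_mono[OF half, of "2 * y"] \<open>y \<ge> 0\<close> by simp
  finally have "ln (real i + 1) \<le> ln (real N + 1) * (1 + 2 * y)" by (simp add: algebra_simps)
  then have "ln (real i + 1) ^ p \<le> (ln (real N + 1) * (1 + 2 * y)) ^ p" by (intro power_mono) auto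
  also have "\<dots> = ln (real N + 1) ^ p * (1 + 2 * y) ^ p" by (rule power_mult_distrib)
  also have "(1 + 2 * y) ^ p \<le> (2 * real p) ^ p * ((real i + 1) / (real N + 1))"
  proof -
    have "1 + 2 * y \<le> 2 * real p * (1 + y / real p)" using assms(1) by (simp add: field_simps)
    also have "\<dots> \<le> 2 * real p * exp (y / real p)" by (intro mult_left_mono exp_ge_add_one_self) simp
    finally have "(1 + 2 * y) ^ p \<le> (2 * real p * exp (y / real p)) ^ p"
      using \<open>y \<ge> 0\<close> by (intro power_mono) auto
    also have "\<dots> = (2 * real p) ^ p * exp (real p * (y / real p))"
      by (simp only: power_mult_distrib exp_of_nat_mult)
    also have "real p * (y / real p) = y" using assms(1) by simp
    also have "exp y = (real i + 1) / (real N + 1)" by (simp add: y_def)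
    finally show ?thesis .
  qed
  finally have 1: "ln (real i + 1) ^ p \<le> ln (real N + 1) ^ p * ((2 * real p) ^ p * ((real i + 1) / (real N + 1)))"
    by (simp add: mult_left_mono)
  have "log_weight p i \<le> ln (real N + 1) ^ p * ((2 * real p) ^ p * ((real i + 1) / (real N + 1))) / real i"
    unfolding log_weight_def by (rule divide_right_mono[OF 1]) simp
  also have "\<dots> = (2 * real p) ^ p * (ln (real N + 1) ^ p / (real N + 1)) * ((real i + 1) / real i)" by simp
  also have "\<dots> \<le> (2 * real p) ^ p * (ln (real N + 1) ^ p / (real N + 1)) * 2"
    using assms by (intro mult_left_mono) (auto simp: field_simps)
  finally show ?thesis by (simp add: mult_ac)
qed

lemma sum_disjoint_lengths_le:
  fixes a b :: "nat \<Rightarrow> real"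
  assumes "\<And>i. i \<in> J \<Longrightarrow> 0 \<le> a i \<and> a i < b i \<and> b i < 2 * pi" "finite J"
    and "disjoint_family_on (\<lambda>i. {a i<..<b i}) J"
  shows "(\<Sum>i\<in>J. b i - a i) \<le> 2 * pi"
proof -
  have "ennreal (\<Sum>i\<in>J. b i - a i) = (\<Sum>i\<in>J. ennreal (b i - a i))"
    using assms(1) by (intro sum_ennreal[symmetric]) (simp add: less_imp_le)
  also have "\<dots> = (\<Sum>i\<in>J. emeasure lborel {a i<..<b i})"
    using assms(1) by (intro sum.cong HOL.refl) (simp add: less_imp_le)
  also have "\<dots> = emeasure lborel (\<Union>i\<in>J. {a i<..<b i})"
    using assms(2,3) by (intro sum_emeasure) auto
  also have "\<dots> \<le> emeasure lborel {0..2 * pi}"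
  proof (rule emeasure_mono)
    show "(\<Union>i\<in>J. {a i<..<b i}) \<subseteq> {0..2 * pi}"
    proof (intro UN_least subsetI)
      fix i t assume "i \<in> J" "t \<in> {a i<..<b i}"
      then show "t \<in> {0..2 * pi}" using assms(1)[of i] by simp
    qed
  qed simp
  finally show ?thesis by simp
qed

text \<open>The sizes \<open>e k\<close> are chosen so small that the later terms do not disturb the \<open>k\<close>-th functional,
  the signs so that the earlier terms do not cancel it:
  one of \<open>\<parallel>T (h + e g)\<parallel>\<close>, \<open>\<parallel>T (h - e g)\<parallel>\<close> is at least \<open>e \<parallel>T g\<parallel>\<close>.\<close>

lemma gliding_hump:
  fixes T :: "nat \<Rightarrow> ('a \<Rightarrow> real) \<Rightarrow> complex" and g :: "nat \<Rightarrow> 'a \<Rightarrow> real" and S :: "('a \<Rightarrow> real) \<Rightarrow> bool"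
  assumes lin: "\<And>n h k c. S h \<Longrightarrow> S k \<Longrightarrow> T n (\<lambda>x. h x + c * k x) = T n h + of_real c * T n k"
    and bound: "\<And>n h B. S h \<Longrightarrow> (\<And>x. \<bar>h x\<bar> \<le> B) \<Longrightarrow> norm (T n h) \<le> A n * B"
    and A: "\<And>n. A n \<ge> 1"
    and S_g: "\<And>n. S (g n)" and S_0: "S (\<lambda>_. 0)" and C: "\<And>n x. \<bar>g n x\<bar> \<le> C"
    and S_comb: "\<And>h k c. S h \<Longrightarrow> S k \<Longrightarrow> S (\<lambda>x. h x + c * k x)"
    and S_series: "\<And>u. (\<And>k. S (u k)) \<Longrightarrow> (\<And>k x. \<bar>u k x\<bar> \<le> C * (1 / 2) ^ k) \<Longrightarrow> S (\<lambda>x. \<Sum>k. u k x)"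
    and unbounded: "\<And>K. \<exists>n. K \<le> norm (T n (g n))"
  shows "\<exists>\<alpha> n. (\<forall>k. \<bar>\<alpha> k\<bar> \<le> (1 / 2) ^ k) \<and> S (\<lambda>x. \<Sum>k. \<alpha> k * g (n k) x) \<and>
    (\<forall>K. \<exists>m. K \<le> norm (T m (\<lambda>x. \<Sum>k. \<alpha> k * g (n k) x)))"
proof -
  \<comment> \<open>However small the size e has become, some functional still reaches k on e times
    its own block, because the unscaled values are unbounded.\<close>
  define \<nu> where "\<nu> = (\<lambda>k e. SOME n. real k \<le> e * norm (T n (g n)))"
  have \<nu>: "real k \<le> e * norm (T (\<nu> k e) (g (\<nu> k e)))" if "e > 0" for k e
  proof -
    obtain n where "real k / e \<le> norm (T n (g n))" using unbounded by blast
    then have "real k \<le> e * norm (T n (g n))" using that by (simp add: pos_divide_le_eq mult.commute)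
    then show ?thesis unfolding \<nu>_def by (rule someI)
  qed
  \<comment> \<open>The remainder after step k is at most 2 C e(k+1); this choice makes
    \<open>A (n k)\<close> times that bound equal to C e(k), hence at most C.\<close>
  define e where "e = rec_nat 1 (\<lambda>k t. t / (2 * A (\<nu> k t)))"
  define n where "n = (\<lambda>k. \<nu> k (e k))"
  have e_Suc: "e (Suc k) = e k / (2 * A (n k))" and e_0: "e 0 = 1" for k by (simp_all add: e_def n_def)
  have A_pos: "A k > 0" for k using A[of k] by linarith
  have e_pos: "e k > 0" for k by (induction k) (simp_all add: e_0 e_Suc A_pos)
  have e_half: "e (Suc k) \<le> e k * (1 / 2)" for k
  proof -
    have "e k / (2 * A (n k)) \<le> e k / 2" using A[of "n k"] e_pos[of k] by (intro divide_left_mono) auto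
    then show ?thesis by (simp add: e_Suc)
  qed
  have e_geom: "e (m + j) \<le> e m * (1 / 2) ^ j" for m j
  proof (induction j)
    case (Suc j)
    have "e (m + Suc j) \<le> e (m + j) * (1 / 2)" using e_half[of "m + j"] by simp
    also have "\<dots> \<le> e m * (1 / 2) ^ j * (1 / 2)" by (rule mult_right_mono[OF Suc]) simp
    finally show ?case by simp
  qed simp
  have e_le: "e k \<le> (1 / 2) ^ k" for k using e_geom[of 0 k] by (simp add: e_0)
  define a where "a = (\<lambda>k h. if norm (T (n k) (\<lambda>x. h x + (- e k) * g (n k) x)) \<le> norm (T (n k) (\<lambda>x. h x + e k * g (n k) x))
    then e k else - e k)"
  define h where "h = rec_nat (\<lambda>_. 0) (\<lambda>k h x. h x + a k h * g (n k) x)"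
  have h_0: "h 0 = (\<lambda>_. 0)" and h_Suc: "h (Suc k) = (\<lambda>x. h k x + a k (h k) * g (n k) x)" for k
    by (simp_all add: h_def)
  define \<alpha> where "\<alpha> = (\<lambda>k. a k (h k))"
  have abs_\<alpha>: "\<bar>\<alpha> k\<bar> = e k" for k using e_pos[of k] by (simp add: \<alpha>_def a_def)
  have h_sum: "h k x = (\<Sum>i<k. \<alpha> i * g (n i) x)" for k x
    by (induction k) (simp_all add: h_0 h_Suc \<alpha>_def)
  have S_h: "S (h k)" for k
    by (induction k) (simp_all only: h_0 h_Suc S_0 S_comb S_g)
  have "0 \<le> C" by (rule order_trans[OF abs_ge_zero C])
  have hump: "real k \<le> norm (T (n k) (h (Suc k)))" for k
  proof -
    define X where "X = T (n k) (h k)"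
    define Y where "Y = T (n k) (g (n k))"
    have plus: "T (n k) (\<lambda>x. h k x + e k * g (n k) x) = X + of_real (e k) * Y"
      unfolding X_def Y_def by (rule lin[OF S_h S_g])
    have minus: "T (n k) (\<lambda>x. h k x + (- e k) * g (n k) x) = X + of_real (- e k) * Y"
      unfolding X_def Y_def by (rule lin[OF S_h S_g])
    have "norm (T (n k) (h (Suc k))) = max (norm (X + of_real (e k) * Y)) (norm (X + of_real (- e k) * Y))"
      unfolding h_Suc a_def plus minus by (simp add: max_def plus[simplified] minus[simplified])
    moreover have "2 * (of_real (e k) * Y) = (X + of_real (e k) * Y) - (X + of_real (- e k) * Y)" by simp
    then have "norm (2 * (of_real (e k) * Y)) \<le> norm (X + of_real (e k) * Y) + norm (X + of_real (- e k) * Y)"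
      by (simp only: norm_triangle_ineq4)
    then have "2 * (e k * norm Y) \<le> norm (X + of_real (e k) * Y) + norm (X + of_real (- e k) * Y)"
      using e_pos[of k] by (simp only: norm_mult norm_of_real norm_numeral abs_of_pos)
    ultimately have "e k * norm Y \<le> norm (T (n k) (h (Suc k)))" by linarith
    then show ?thesis using \<nu>[OF e_pos[of k], of k] by (simp add: Y_def n_def)
  qed
  define f where "f = (\<lambda>x. \<Sum>k. \<alpha> k * g (n k) x)"
  have term_le: "\<bar>\<alpha> k * g (n k) x\<bar> \<le> e k * C" for k x
    unfolding abs_mult abs_\<alpha> using e_pos[of k] by (intro mult_left_mono C) simp
  have term_geom: "\<bar>\<alpha> k * g (n k) x\<bar> \<le> C * (1 / 2) ^ k" for k x
    using order_trans[OF term_le mult_right_mono[OF e_le \<open>0 \<le> C\<close>]] by (simp add: mult.commute)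
  have S_f: "S f"
    unfolding f_def
  proof (rule S_series[OF _ term_geom])
    fix k
    have "S (\<lambda>x. 0 + \<alpha> k * g (n k) x)" by (rule S_comb[OF S_0 S_g])
    then show "S (\<lambda>x. \<alpha> k * g (n k) x)" by simp
  qed
  have summable: "summable (\<lambda>k. \<alpha> k * g (n k) x)" for x
    by (rule summable_comparison_test'[of "\<lambda>k. C * (1 / 2) ^ k" 0]) (use term_geom in \<open>simp_all add: summable_mult\<close>)
  \<comment> \<open>The k-th functional sees a hump of size at least k and a remainder on which it
    is at most C.\<close>
  have large: "real k - C \<le> norm (T (n k) f)" for k
  proof -
    define r where "r = (\<lambda>x. f x + (- 1) * h (Suc k) x)"
    have S_r: "S r" unfolding r_def by (rule S_comb[OF S_f S_h])
    have r_le: "\<bar>r x\<bar> \<le> 2 * C * e (Suc k)" for x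
    proof -
      have "r x = (\<Sum>j. \<alpha> (j + Suc k) * g (n (j + Suc k)) x)"
        using suminf_minus_initial_segment[OF summable, of "Suc k" x] by (simp add: r_def f_def h_sum)
      also have "\<bar>\<dots>\<bar> \<le> (\<Sum>j. C * e (Suc k) * (1 / 2) ^ j)"
        unfolding real_norm_def[symmetric]
      proof (rule norm_suminf_le)
        show "norm (\<alpha> (j + Suc k) * g (n (j + Suc k)) x) \<le> C * e (Suc k) * (1 / 2) ^ j" for j
        proof -
          have "norm (\<alpha> (j + Suc k) * g (n (j + Suc k)) x) \<le> e (Suc k + j) * C"
            using term_le[of "j + Suc k" x] by (simp add: add.commute)
          also have "\<dots> \<le> e (Suc k) * (1 / 2) ^ j * C" by (rule mult_right_mono[OF e_geom \<open>0 \<le> C\<close>])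
          finally show ?thesis by (simp add: mult_ac)
        qed
        show "summable (\<lambda>j. C * e (Suc k) * (1 / 2) ^ j)" by (intro summable_mult summable_geometric) simp
      qed
      also have "\<dots> = C * e (Suc k) * 2"
        by (subst suminf_mult) (simp_all add: suminf_geometric)
      finally show ?thesis by (simp add: mult_ac)
    qed
    have "norm (T (n k) r) \<le> A (n k) * (2 * C * e (Suc k))" by (rule bound[OF S_r r_le])
    also have "\<dots> = C * e k" using A_pos[of "n k"] by (simp add: e_Suc)
    also have "\<dots> \<le> C * 1"
      using e_le[of k] power_le_one[of "1 / 2 :: real" k] by (intro mult_left_mono \<open>0 \<le> C\<close>) simp
    finally have r: "norm (T (n k) r) \<le> C" by simp
    have "f = (\<lambda>x. h (Suc k) x + 1 * r x)" by (simp add: r_def)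
    then have "T (n k) f = T (n k) (h (Suc k)) + T (n k) r"
      using lin[OF S_h S_r, of "n k" "Suc k" 1] by simp
    then show ?thesis
      using r hump[of k] norm_diff_ineq[of "T (n k) (h (Suc k))" "T (n k) r"] by simp
  qed
  have "\<exists>m. K \<le> norm (T m f)" for K
  proof -
    obtain k where "K + C \<le> real k" using real_arch_simple by blast
    then have "K \<le> norm (T (n k) f)" using large[of k] by linarith
    then show ?thesis ..
  qed
  moreover have "\<bar>\<alpha> k\<bar> \<le> (1 / 2) ^ k" for k by (simp only: abs_\<alpha> e_le)
  ultimately show ?thesis using S_f unfolding f_def by blast
qed

section \<open>Cubical sums at 0 as functionals on bounded continuous functions\<close>

definition bounded_continuous :: "(real ^ 'n::finite \<Rightarrow> real) \<Rightarrow> bool" where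
  "bounded_continuous h \<longleftrightarrow> continuous_on UNIV h \<and> (\<exists>B. \<forall>x. \<bar>h x\<bar> \<le> B)"

definition cubic_sum :: "nat \<Rightarrow> (real ^ 'n::finite \<Rightarrow> real) \<Rightarrow> complex" where
  "cubic_sum N h = fourier_partial_sum (\<lambda>_. N) (\<lambda>x. complex_of_real (h x)) 0"

lemma bounded_continuous_comb:
  assumes "bounded_continuous h" "bounded_continuous k"
  shows "bounded_continuous (\<lambda>x. h x + c * k x)"
proof -
  obtain B D where "\<forall>x. \<bar>h x\<bar> \<le> B" "\<forall>x. \<bar>k x\<bar> \<le> D"
    using assms unfolding bounded_continuous_def by blast
  then have "\<bar>h x + c * k x\<bar> \<le> B + \<bar>c\<bar> * D" for x
    by (intro order_trans[OF abs_triangle_ineq] add_mono) (simp_all add: abs_mult mult_left_mono)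
  moreover have "continuous_on UNIV (\<lambda>x. h x + c * k x)"
    using assms unfolding bounded_continuous_def by (intro continuous_intros) simp_all
  ultimately show ?thesis unfolding bounded_continuous_def by blast
qed

lemma bounded_continuous_series:
  fixes u :: "nat \<Rightarrow> real ^ 'n::finite \<Rightarrow> real"
  assumes "\<And>k. bounded_continuous (u k)" and u: "\<And>k x. \<bar>u k x\<bar> \<le> C * (1 / 2) ^ k"
  shows "bounded_continuous (\<lambda>x. \<Sum>k. u k x)"
proof -
  have geom: "summable (\<lambda>k. C * (1 / 2) ^ k)" by (intro summable_mult summable_geometric) simp
  have "uniform_limit UNIV (\<lambda>n x. \<Sum>k<n. u k x) (\<lambda>x. \<Sum>k. u k x) sequentially"
    by (rule Weierstrass_m_test[OF _ geom]) (simp add: u)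
  moreover have "\<forall>\<^sub>F n in sequentially. continuous_on UNIV (\<lambda>x. \<Sum>k<n. u k x)"
    using assms(1) unfolding bounded_continuous_def by (intro always_eventually allI continuous_on_sum) simp
  ultimately have "continuous_on UNIV (\<lambda>x. \<Sum>k. u k x)" by (intro uniform_limit_theorem) auto
  moreover have "\<bar>\<Sum>k. u k x\<bar> \<le> (\<Sum>k. C * (1 / 2) ^ k)" for x
    unfolding real_norm_def[symmetric] by (rule norm_suminf_le[OF _ geom]) (simp add: u)
  ultimately show ?thesis unfolding bounded_continuous_def by blast
qed

text \<open>Supplies the boundedness required by the gliding hump: the factor in front of B depends
  on N and not on h.\<close>

lemma
  fixes h :: "real ^ 'n::finite \<Rightarrow> real" and N :: nat
  assumes "bounded_continuous h"
  defines "F \<equiv> \<lambda>t. indicator torus_cube t *\<^sub>R (complex_of_real (h t) * of_real (\<Prod>j\<in>UNIV. dirichlet N (0 $ j - t $ j)))"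
  shows cubic_sum_eq: "cubic_sum N h = (\<integral>t. F t \<partial>lborel) / of_real ((2 * pi) ^ CARD('n))"
    and integrable_cubic_sum: "integrable lborel F"
    and cubic_sum_bound: "(\<And>x. \<bar>h x\<bar> \<le> B) \<Longrightarrow> norm (cubic_sum N h) \<le>
      ((2 * real N + 1) ^ CARD('n) * measure lborel (torus_cube :: (real ^ 'n) set) / (2 * pi) ^ CARD('n)) * B"
proof -
  let ?D = "\<lambda>t::real ^ 'n. \<Prod>j\<in>UNIV. dirichlet N (0 $ j - t $ j)"
  have cont: "continuous_on UNIV h" using assms by (simp add: bounded_continuous_def)
  obtain B0 where B0: "\<And>x. \<bar>h x\<bar> \<le> B0" using assms unfolding bounded_continuous_def by blast
  have meas: "(\<lambda>x. complex_of_real (h x)) \<in> borel_measurable borel"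
    using cont by (intro borel_measurable_continuous_onI continuous_intros)
  show "cubic_sum N h = (\<integral>t. F t \<partial>lborel) / of_real ((2 * pi) ^ CARD('n))"
    unfolding cubic_sum_def F_def by (rule fourier_partial_sum_eq[OF meas, where B=B0]) (simp add: B0)
  have D_le: "\<bar>?D t\<bar> \<le> (2 * real N + 1) ^ CARD('n)" for t
  proof -
    have "\<bar>?D t\<bar> \<le> (\<Prod>j\<in>(UNIV :: 'n set). 2 * real N + 1)"
      unfolding abs_prod by (intro prod_mono conjI abs_ge_zero abs_dirichlet_le)
    then show ?thesis by simp
  qed
  have D_meas: "?D \<in> borel_measurable borel"
    by (intro borel_measurable_continuous_onI continuous_on_prod
        continuous_on_compose2[OF continuous_on_dirichlet[of UNIV]] continuous_intros) auto
  have prod_le: "norm (complex_of_real (h t) * of_real (?D t)) \<le> B * (2 * real N + 1) ^ CARD('n)"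
    if "\<And>x. \<bar>h x\<bar> \<le> B" for t B
    unfolding norm_mult norm_of_real using that order_trans[OF abs_ge_zero that] by (intro mult_mono D_le) auto
  have "(\<lambda>t. complex_of_real (h t) * of_real (?D t)) \<in> borel_measurable borel"
    by (intro borel_measurable_times meas measurable_compose[OF D_meas borel_measurable_of_real])
  then show int: "integrable lborel F"
    unfolding F_def by (rule integrable_indicator_bounded[OF _ prod_le[OF B0] torus_cube_borel bounded_torus_cube])
  assume B: "\<And>x. \<bar>h x\<bar> \<le> B"
  have "emeasure lborel (torus_cube :: (real ^ 'n) set) < \<infinity>"
    by (rule emeasure_bounded_finite[OF bounded_torus_cube])
  then have ind: "integrable lborel (indicator (torus_cube :: (real ^ 'n) set) :: _ \<Rightarrow> real)"
    by (intro integrable_real_indicator) auto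
  let ?G = "\<lambda>t :: real ^ 'n. B * (2 * real N + 1) ^ CARD('n) * indicator torus_cube t :: real"
  have G: "integrable lborel ?G" by (rule integrable_mult_right[OF ind])
  have "norm (\<integral>t. F t \<partial>lborel) \<le> (\<integral>t. ?G t \<partial>lborel)"
  proof (rule Bochner_Integration.integral_norm_bound_integral[OF int G])
    fix t
    show "norm (F t) \<le> B * (2 * real N + 1) ^ CARD('n) * indicator torus_cube t"
      using prod_le[OF B, of t] unfolding F_def norm_scaleR by (cases "t \<in> torus_cube") auto
  qed
  also have "\<dots> = B * (2 * real N + 1) ^ CARD('n) * measure lborel (torus_cube :: (real ^ 'n) set)"
    by simp
  finally have le: "norm (\<integral>t. F t \<partial>lborel) \<le> B * (2 * real N + 1) ^ CARD('n) * measure lborel (torus_cube :: (real ^ 'n) set)" .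
  have "norm (cubic_sum N h) = norm (\<integral>t. F t \<partial>lborel) / (2 * pi) ^ CARD('n)"
    unfolding \<open>cubic_sum N h = _\<close> by (simp only: norm_divide norm_of_real) (simp add: power_abs)
  also have "\<dots> \<le> B * (2 * real N + 1) ^ CARD('n) * measure lborel (torus_cube :: (real ^ 'n) set) / (2 * pi) ^ CARD('n)"
    by (rule divide_right_mono[OF le]) simp
  finally show "norm (cubic_sum N h) \<le>
      ((2 * real N + 1) ^ CARD('n) * measure lborel (torus_cube :: (real ^ 'n) set) / (2 * pi) ^ CARD('n)) * B"
    by (simp add: mult_ac)
qed

lemma cubic_sum_comb:
  fixes h k :: "real ^ 'n::finite \<Rightarrow> real"
  assumes h: "bounded_continuous h" and k: "bounded_continuous k"
  shows "cubic_sum N (\<lambda>x. h x + c * k x) = cubic_sum N h + of_real c * cubic_sum N k"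
proof -
  let ?D = "\<lambda>t::real ^ 'n. complex_of_real (\<Prod>j\<in>UNIV. dirichlet N (0 $ j - t $ j))"
  let ?F = "\<lambda>h t. indicator torus_cube t *\<^sub>R (complex_of_real (h t) * ?D t)"
  have "(\<integral>t. ?F (\<lambda>x. h x + c * k x) t \<partial>lborel) = (\<integral>t. ?F h t + of_real c * ?F k t \<partial>lborel)"
    by (intro Bochner_Integration.integral_cong HOL.refl)
      (simp only: of_real_add of_real_mult distrib_right scaleR_add_right mult_scaleR_right mult.assoc)
  also have "\<dots> = (\<integral>t. ?F h t \<partial>lborel) + of_real c * (\<integral>t. ?F k t \<partial>lborel)"
    by (subst Bochner_Integration.integral_add[OF integrable_cubic_sum[OF h] integrable_mult_right[OF integrable_cubic_sum[OF k]]])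
      (simp only: integral_mult_right_zero)
  finally show ?thesis
    by (simp only: cubic_sum_eq[OF h] cubic_sum_eq[OF k] cubic_sum_eq[OF bounded_continuous_comb[OF h k]]
        add_divide_distrib times_divide_eq_right)
qed

section \<open>Blocks normalised for the weights with \<xi>\<close>

locale divergent_weights =
  fixes p :: nat and \<xi> :: "nat \<Rightarrow> real"
  assumes p_pos: "1 \<le> p" and \<xi>_pos: "\<And>n. 1 \<le> n \<Longrightarrow> 0 < \<xi> n" and \<xi>_lim: "filterlim \<xi> at_top sequentially"
begin

text \<open>Times 2 ln^p(N+1), this bounds the contribution of the indices up to N to the variation
  of the N-th unscaled block.\<close>

definition H :: "nat \<Rightarrow> real" where
  "H N = (\<Sum>i=1..N. 1 / (real i * \<xi> i))"

lemma H_ge: "1 \<le> N \<Longrightarrow> 1 / \<xi> 1 \<le> H N"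
  unfolding H_def using member_le_sum[of 1 "{1..N}" "\<lambda>i. 1 / (real i * \<xi> i)"] \<xi>_pos by (simp add: less_imp_le)

lemma H_pos: "1 \<le> N \<Longrightarrow> 0 < H N"
  by (rule less_le_trans[OF _ H_ge]) (simp_all add: \<xi>_pos)

lemma \<xi>_lower_bound: "\<exists>x0>0. \<forall>i\<ge>1. x0 \<le> \<xi> i"
proof -
  obtain m where m: "\<forall>n\<ge>m. 1 \<le> \<xi> n"
    using \<xi>_lim unfolding filterlim_at_top eventually_sequentially by blast
  define x0 where "x0 = Min (insert 1 (\<xi> ` {1..m}))"
  have fin: "finite (insert 1 (\<xi> ` {1..m}))" by simp
  have "0 < t" if "t \<in> insert 1 (\<xi> ` {1..m})" for t using that \<xi>_pos by (elim insertE imageE) simp_all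
  then have "x0 > 0" using Min_in[OF fin] by (simp add: x0_def)
  moreover have "x0 \<le> \<xi> i" if i: "1 \<le> i" for i
  proof (cases "i \<le> m")
    case True
    then show ?thesis unfolding x0_def using i by (intro Min_le[OF fin]) simp
  next
    case False
    have "x0 \<le> 1" unfolding x0_def by (intro Min_le[OF fin]) simp
    also have "1 \<le> \<xi> i" using m False by simp
    finally show ?thesis .
  qed
  ultimately show ?thesis by blast
qed

text \<open>Since \<xi> tends to infinity, H is a fixed head plus an arbitrarily small multiple of a
  harmonic sum, hence of smaller order than the logarithm. In the threshold 6 * K' the 3 compensates
  the harmonic bound and the 2 leaves half of the logarithm for the head.\<close>

lemma H_growth: "\<exists>N\<ge>1. K * H N \<le> ln (real N + 1)"
proof -
  define K' where "K' = max K 1"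
  have "K' > 0" by (simp add: K'_def)
  obtain m where m: "\<forall>n\<ge>m. 6 * K' \<le> \<xi> n"
    using \<xi>_lim unfolding filterlim_at_top eventually_sequentially by blast
  have "filterlim (\<lambda>n. ln (real n + 1)) at_top sequentially" by real_asymp
  then obtain n0 where n0: "\<forall>n\<ge>n0. 2 * K' * H m \<le> ln (real n + 1)"
    unfolding filterlim_at_top eventually_sequentially by blast
  define N where "N = max 1 (max n0 m)"
  have "H N \<le> H m + (\<Sum>i=1..N. 1 / (6 * K') * (1 / real i))"
  proof -
    have "H N = (\<Sum>i\<in>{1..m}. 1 / (real i * \<xi> i)) + (\<Sum>i\<in>{1..N} - {1..m}. 1 / (real i * \<xi> i))"
      unfolding H_def by (subst sum.subset_diff[of "{1..m}" "{1..N}"]) (auto simp: N_def)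
    also have "(\<Sum>i\<in>{1..N} - {1..m}. 1 / (real i * \<xi> i)) \<le> (\<Sum>i\<in>{1..N} - {1..m}. 1 / (6 * K') * (1 / real i))"
    proof (rule sum_mono)
      fix i assume i: "i \<in> {1..N} - {1..m}"
      then have "m \<le> i" by auto
      then have "6 * K' \<le> \<xi> i" using m by blast
      then have "1 / \<xi> i \<le> 1 / (6 * K')" using \<open>K' > 0\<close> by (intro divide_left_mono) auto
      then have "1 / \<xi> i * (1 / real i) \<le> 1 / (6 * K') * (1 / real i)" by (rule mult_right_mono) simp
      then show "1 / (real i * \<xi> i) \<le> 1 / (6 * K') * (1 / real i)" by (simp add: mult.commute)
    qed
    also have "\<dots> \<le> (\<Sum>i=1..N. 1 / (6 * K') * (1 / real i))"
      using \<open>K' > 0\<close> by (intro sum_mono2) auto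
    finally show ?thesis by (simp add: H_def)
  qed
  also have "(\<Sum>i=1..N. 1 / (6 * K') * (1 / real i)) = 1 / (6 * K') * (\<Sum>i=1..N. 1 / real i)"
    by (rule sum_distrib_left[symmetric])
  also have "(\<Sum>i=1..N. 1 / real i) \<le> 3 * ln (real N + 1)"
  proof -
    have "N \<ge> 1" by (simp add: N_def)
    then obtain k where k: "N = Suc k" by (cases N) auto
    have "(\<Sum>i=1..N. 1 / real i) = (\<Sum>i\<le>k. 1 / (real i + 1))"
      unfolding k by (simp only: One_nat_def sum.atLeast1_atMost_eq lessThan_Suc_atMost) (simp add: add.commute)
    also have "\<dots> \<le> 3 * ln (real k + 2)" by (rule sum_inverse_le_ln)
    also have "real k + 2 = real N + 1" by (simp add: k)
    finally show ?thesis .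
  qed
  finally have "H N \<le> H m + 1 / (6 * K') * (3 * ln (real N + 1))" using \<open>K' > 0\<close> by (simp add: divide_right_mono)
  then have "K' * H N \<le> K' * (H m + 1 / (6 * K') * (3 * ln (real N + 1)))"
    using \<open>K' > 0\<close> by (intro mult_left_mono) auto
  also have "\<dots> = K' * H m + ln (real N + 1) / 2" using \<open>K' > 0\<close> by (simp add: distrib_left)
  also have "\<dots> \<le> ln (real N + 1)"
  proof -
    have "n0 \<le> N" by (simp add: N_def)
    then have "2 * (K' * H m) \<le> ln (real N + 1)" using n0 by (simp only: mult.assoc[symmetric])
    then show ?thesis by linarith
  qed
  finally have "K' * H N \<le> ln (real N + 1)" .
  moreover have "K * H N \<le> K' * H N" using H_pos[of N] by (intro mult_right_mono) (auto simp: K'_def N_def)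
  ultimately show ?thesis by (intro exI[of _ N]) (simp add: N_def)
qed

text \<open>Reciprocal of the order of the variation of the N-th block. For N = 0 both
  \<open>H\<close> and the logarithm vanish, and the block is discarded.\<close>

definition block_scale :: "nat \<Rightarrow> real" where
  "block_scale N = (if N = 0 then 0 else 1 / (ln (real N + 1) ^ p * H N))"

lemma ln_power_pos: "1 \<le> N \<Longrightarrow> 0 < ln (real N + 1) ^ p"
  by simp

lemma block_scale_nonneg: "0 \<le> block_scale N"
proof (cases "N = 0")
  case False
  then have "0 < ln (real N + 1) ^ p * H N" by (intro mult_pos_pos ln_power_pos H_pos) simp_all
  then show ?thesis using False by (simp add: block_scale_def)
qed (simp add: block_scale_def)

lemma block_scale_bounded: "block_scale N \<le> \<xi> 1 / ln 2 ^ p"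
proof (cases "N = 0")
  case True
  then show ?thesis using \<xi>_pos[of 1] by (simp add: block_scale_def)
next
  case False
  then have N: "1 \<le> N" by simp
  have "ln 2 ^ p * (1 / \<xi> 1) \<le> ln (real N + 1) ^ p * H N"
    using N H_ge[OF N] \<xi>_pos[of 1] by (intro mult_mono power_mono) auto
  then have "1 / (ln (real N + 1) ^ p * H N) \<le> 1 / (ln 2 ^ p * (1 / \<xi> 1))"
    using \<xi>_pos[of 1] ln_power_pos[OF N] H_pos[OF N] by (intro divide_left_mono mult_pos_pos) auto
  then show ?thesis using False by (simp add: block_scale_def)
qed

text \<open>The p + 1 logarithms of the block against p in the scale leave ln(N+1) / H N up to a
  power of pi, and \<open>H_growth\<close> makes this quotient large.\<close>

lemma scaled_block_unbounded:
  assumes p: "p = CARD('n) - 1"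
  shows "\<exists>N. K \<le> norm (cubic_sum N (\<lambda>x :: real ^ 'n::finite. block_scale N * product_block N x))"
proof -
  obtain N where N: "1 \<le> N" and growth: "(max K 0 * pi ^ CARD('n)) * H N \<le> ln (real N + 1)" using H_growth by blast
  obtain r where r: "(ln (real N + 1) / pi) ^ CARD('n) \<le> r"
    and eq: "fourier_partial_sum (\<lambda>_. N) (\<lambda>x :: real ^ 'n. complex_of_real (product_block N x)) 0 = of_real r"
    using partial_sum_product_block[where 'n='n, of N] by blast
  have card: "CARD('n) = Suc p" using p p_pos by simp
  have "bounded_continuous (\<lambda>_ :: real ^ 'n. 0 :: real)"
    unfolding bounded_continuous_def by (auto intro: exI[of _ 0])
  moreover have bc: "bounded_continuous (product_block N :: real ^ 'n \<Rightarrow> real)"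
    unfolding bounded_continuous_def using abs_product_block_le continuous_on_product_block by blast
  ultimately have "cubic_sum N (\<lambda>x :: real ^ 'n. 0 + block_scale N * product_block N x) =
      cubic_sum N (\<lambda>_ :: real ^ 'n. 0) + of_real (block_scale N) * cubic_sum N (product_block N :: real ^ 'n \<Rightarrow> real)"
    by (rule cubic_sum_comb)
  moreover have "cubic_sum N (\<lambda>_ :: real ^ 'n. 0) = 0"
    by (simp add: cubic_sum_def fourier_partial_sum_def fourier_coeff_def)
  ultimately have T: "cubic_sum N (\<lambda>x :: real ^ 'n. block_scale N * product_block N x) = of_real (block_scale N * r)"
    using eq by (simp add: cubic_sum_def)
  let ?l = "ln (real N + 1)"
  have "0 < ?l" using N by simp
  have "max K 0 \<le> ?l / (pi ^ Suc p * H N)"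
    using growth H_pos[OF N] unfolding card by (subst pos_le_divide_eq) (simp_all add: mult_ac del: power_Suc)
  also have "\<dots> = 1 / (?l ^ p * H N) * (?l / pi) ^ Suc p"
    using \<open>0 < ?l\<close> by (simp add: power_divide)
  also have "\<dots> \<le> 1 / (?l ^ p * H N) * r"
    using r \<open>0 < ?l\<close> H_pos[OF N] unfolding card by (intro mult_left_mono) auto
  finally have "K \<le> block_scale N * r" using N by (simp add: block_scale_def)
  then have "K \<le> \<bar>block_scale N * r\<bar>" by (rule order_trans[OF _ abs_ge_self])
  then show ?thesis by (intro exI[of _ N]) (simp only: T norm_of_real)
qed

text \<open>Up to index N the increments are bounded by 2 and the weights sum to at most ln^p(N+1) H
  N. Beyond N the weights are at most a constant times ln^p(N+1)/(N+1), while the Lipschitz bound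
  and disjointness limit the sum of the increments to 2 pi (N+1). Both parts are bounded multiples
  of the reciprocal of the scale.\<close>

lemma scaled_block_variation:
  obtains V where "V \<ge> 0" and "\<And>N m a b s (y :: nat \<Rightarrow> real ^ 'n::finite).
    (\<And>i. i \<in> {1..m} \<Longrightarrow> 0 \<le> a i \<and> a i < b i \<and> b i < 2 * pi) \<Longrightarrow>
    disjoint_family_on (\<lambda>i. {a i<..<b i}) {1..m} \<Longrightarrow>
    (\<Sum>i=1..m. log_weight p i / \<xi> i * (block_scale N *
      \<bar>product_block N (\<chi> j. if j = s then b i else y i $ j) - product_block N (\<chi> j. if j = s then a i else y i $ j)\<bar>)) \<le> V"
proof -
  obtain x0 where x0: "x0 > 0" "\<And>i. 1 \<le> i \<Longrightarrow> x0 \<le> \<xi> i" using \<xi>_lower_bound by blast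
  define D where "D = 2 * (2 * real p) ^ p"
  define V where "V = 2 + D / x0 * (2 * pi) * \<xi> 1"
  have "D \<ge> 0" by (simp add: D_def)
  have "V \<ge> 0" using x0(1) \<xi>_pos[of 1] \<open>D \<ge> 0\<close> by (simp add: V_def)
  moreover have "(\<Sum>i=1..m. log_weight p i / \<xi> i * (block_scale N *
      \<bar>product_block N (\<chi> j. if j = s then b i else y i $ j) - product_block N (\<chi> j. if j = s then a i else y i $ j)\<bar>)) \<le> V"
    if ab: "\<And>i. i \<in> {1..m} \<Longrightarrow> 0 \<le> a i \<and> a i < b i \<and> b i < 2 * pi"
      and disj: "disjoint_family_on (\<lambda>i. {a i<..<b i}) {1..m}"
    for N m a b s and y :: "nat \<Rightarrow> real ^ 'n"
  proof (cases "N = 0")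
    case True
    then show ?thesis using \<open>V \<ge> 0\<close> by (simp add: block_scale_def)
  next
    case False
    then have N: "1 \<le> N" by simp
    let ?I = "\<lambda>i. \<bar>product_block N (\<chi> j. if j = s then b i else y i $ j) - product_block N (\<chi> j. if j = s then a i else y i $ j)\<bar>"
    define l where "l = ln (real N + 1) ^ p"
    have "l > 0" unfolding l_def by (rule ln_power_pos[OF N])
    have term_le: "log_weight p i / \<xi> i * ?I i \<le>
        (if i \<le> N then 2 * l * (1 / (real i * \<xi> i)) else 0) + D * l / x0 * (b i - a i)" if i: "i \<in> {1..m}" for i
    proof (cases "i \<le> N")
      case True
      have w: "log_weight p i \<le> l / real i"
        unfolding log_weight_def l_def using True by (intro divide_right_mono power_mono) auto
      have "log_weight p i / \<xi> i * ?I i \<le> (l / real i) / \<xi> i * 2"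
        using w \<xi>_pos[of i] i log_weight_nonneg[of p i] \<open>l > 0\<close> product_block_increment(1)[of "a i" "b i" N s "y i"] ab[OF i]
        by (intro mult_mono divide_right_mono) auto
      also have "\<dots> = 2 * l * (1 / (real i * \<xi> i))" by simp
      finally have "log_weight p i / \<xi> i * ?I i \<le> 2 * l * (1 / (real i * \<xi> i))" .
      moreover have "0 \<le> D * l / x0 * (b i - a i)" using \<open>D \<ge> 0\<close> \<open>l > 0\<close> x0(1) ab[OF i] by simp
      ultimately show ?thesis using True by simp
    next
      case False
      have "i \<ge> 1" using i by simp
      have w: "log_weight p i \<le> D * (l / (real N + 1))"
        unfolding D_def l_def using False N by (intro log_weight_le p_pos) auto
      have "log_weight p i / \<xi> i \<le> D * (l / (real N + 1)) / x0"
        using w x0(1) x0(2)[OF \<open>i \<ge> 1\<close>] \<open>D \<ge> 0\<close> \<open>l > 0\<close> by (intro frac_le) auto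
      moreover have "?I i \<le> (real N + 1) * (b i - a i)"
      proof -
        have "?I i \<le> (real N + 1 / 2) * (b i - a i)" using ab[OF i] by (intro product_block_increment(2)) auto
        also have "\<dots> \<le> (real N + 1) * (b i - a i)" using ab[OF i] by (intro mult_right_mono) auto
        finally show ?thesis .
      qed
      ultimately have "log_weight p i / \<xi> i * ?I i \<le> D * (l / (real N + 1)) / x0 * ((real N + 1) * (b i - a i))"
        using \<open>D \<ge> 0\<close> \<open>l > 0\<close> x0(1) by (intro mult_mono) auto
      also have "\<dots> = D * l / x0 * (b i - a i)" by simp
      finally show ?thesis using False by simp
    qed
    have "(\<Sum>i=1..m. log_weight p i / \<xi> i * ?I i) \<le>
        (\<Sum>i=1..m. (if i \<le> N then 2 * l * (1 / (real i * \<xi> i)) else 0) + D * l / x0 * (b i - a i))"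
      by (rule sum_mono[OF term_le])
    also have "\<dots> = (\<Sum>i=1..m. if i \<le> N then 2 * l * (1 / (real i * \<xi> i)) else 0) + D * l / x0 * (\<Sum>i=1..m. b i - a i)"
      by (simp only: sum.distrib sum_distrib_left)
    also have "(\<Sum>i=1..m. if i \<le> N then 2 * l * (1 / (real i * \<xi> i)) else 0) =
        (\<Sum>i\<in>{i \<in> {1..m}. i \<le> N}. 2 * l * (1 / (real i * \<xi> i)))"
      by (rule sum.inter_filter[symmetric]) simp
    also have "\<dots> \<le> (\<Sum>i=1..N. 2 * l * (1 / (real i * \<xi> i)))"
      using \<open>l > 0\<close> \<xi>_pos by (intro sum_mono2) (auto simp: less_imp_le)
    also have "\<dots> = 2 * l * H N" unfolding H_def by (rule sum_distrib_left[symmetric])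
    also have "D * l / x0 * (\<Sum>i=1..m. b i - a i) \<le> D * l / x0 * (2 * pi)"
      using \<open>D \<ge> 0\<close> \<open>l > 0\<close> x0(1) by (intro mult_left_mono sum_disjoint_lengths_le ab disj) auto
    \<comment> \<open>The part from the large indices lacks the factor H N. It is supplied at the
      price of the constant \<xi> 1, since H N is at least its first term 1/\<xi> 1.\<close>
    also have "D * l / x0 * (2 * pi) \<le> D * l / x0 * (2 * pi) * (\<xi> 1 * H N)"
    proof -
      have "1 \<le> \<xi> 1 * H N" using H_ge[OF N] \<xi>_pos[of 1] by (simp add: divide_le_eq mult.commute)
      moreover have "0 \<le> D * l / x0 * (2 * pi)" using \<open>D \<ge> 0\<close> \<open>l > 0\<close> x0(1) by simp
      ultimately show ?thesis using mult_left_mono[of 1 "\<xi> 1 * H N" "D * l / x0 * (2 * pi)"] by simp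
    qed
    finally have sum: "(\<Sum>i=1..m. log_weight p i / \<xi> i * ?I i) \<le> V * (l * H N)"
      by (simp add: V_def algebra_simps)
    have "(\<Sum>i=1..m. log_weight p i / \<xi> i * (block_scale N * ?I i)) = block_scale N * (\<Sum>i=1..m. log_weight p i / \<xi> i * ?I i)"
      by (simp add: sum_distrib_left mult_ac)
    also have "\<dots> \<le> block_scale N * (V * (l * H N))"
      by (rule mult_left_mono[OF sum block_scale_nonneg])
    also have "\<dots> = V" using N \<open>l > 0\<close> H_pos[OF N] by (simp add: block_scale_def l_def)
    finally show ?thesis .
  qed
  ultimately show ?thesis by (rule that)
qed

end

lemma sharp_variation_finiteI:
  fixes f :: "real ^ 'n::finite \<Rightarrow> complex"
  assumes L: "\<And>i. 1 \<le> i \<Longrightarrow> 0 \<le> L i"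
    and le: "\<And>m a b s y. (\<And>i. i \<in> {1..m} \<Longrightarrow> 0 \<le> a i \<and> a i < b i \<and> b i < 2 * pi) \<Longrightarrow>
      disjoint_family_on (\<lambda>i. {a i<..<b i}) {1..m} \<Longrightarrow>
      (\<Sum>i=1..m. norm (coord_increment f s (a i) (b i) (y i)) / L i) \<le> V"
  shows "sharp_variation L f < \<infinity>"
proof -
  have "sharp_variation_in L s f \<le> ennreal V" for s
    unfolding sharp_variation_in_def
  proof (rule SUP_least)
    fix q :: "nat \<times> (nat \<Rightarrow> real) \<times> (nat \<Rightarrow> real) \<times> (nat \<Rightarrow> real ^ 'n)"
    assume q: "q \<in> {(m, a, b, y). (\<forall>i\<in>{1..m}. 0 \<le> a i \<and> a i < b i \<and> b i < 2 * pi \<and> y i \<in> torus_cube) \<and>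
      disjoint_family_on (\<lambda>i. {a i<..<b i}) {1..m}}"
    obtain m a b y where q_eq: "q = (m, a, b, y)" by (cases q) auto
    have ab: "\<And>i. i \<in> {1..m} \<Longrightarrow> 0 \<le> a i \<and> a i < b i \<and> b i < 2 * pi"
      and disj: "disjoint_family_on (\<lambda>i. {a i<..<b i}) {1..m}"
      using q unfolding q_eq by simp_all
    have "(\<Sum>i=1..m. ennreal (norm (coord_increment f s (a i) (b i) (y i)) / L i)) =
        ennreal (\<Sum>i=1..m. norm (coord_increment f s (a i) (b i) (y i)) / L i)"
      by (intro sum_ennreal divide_nonneg_nonneg norm_ge_zero L) simp
    also have "\<dots> \<le> ennreal V" by (intro ennreal_leI le ab disj)
    finally show "(case q of (m, a, b, y) \<Rightarrow>
        \<Sum>i=1..m. ennreal (norm (coord_increment f s (a i) (b i) (y i)) / L i)) \<le> ennreal V"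
      by (simp add: q_eq)
  qed
  then have "sharp_variation L f \<le> (\<Sum>s\<in>(UNIV :: 'n set). ennreal V)"
    unfolding sharp_variation_def by (intro sum_mono)
  also have "\<dots> < \<infinity>" by (simp add: ennreal_mult_less_top ennreal_of_nat_eq_real_of_nat)
  finally show ?thesis .
qed

section \<open>The function with divergent cubical sums\<close>

context divergent_weights
begin

text \<open>The gliding hump leaves room for coefficients of modulus at most (1/2)^k. As all scaled
  blocks share the variation bound V, the variation sums of the series stay below V times a
  geometric series.\<close>

theorem exists_divergent_cubic_sums:
  assumes p: "p = CARD('n::finite) - 1"
  shows "\<exists>f :: real ^ 'n \<Rightarrow> complex. f \<in> sharp_BV (\<lambda>n. real n * \<xi> n / ln (real n + 1) ^ p) \<and>
    range f \<subseteq> \<real> \<and> continuous_on UNIV f \<and> (SUP N. ereal (norm (fourier_partial_sum (\<lambda>_. N) f 0))) = \<infinity>"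
proof -
  define g :: "nat \<Rightarrow> real ^ 'n \<Rightarrow> real" where "g = (\<lambda>N x. block_scale N * product_block N x)"
  define C where "C = \<xi> 1 / ln 2 ^ p"
  define A where "A = (\<lambda>N. (2 * real N + 1) ^ CARD('n) * measure lborel (torus_cube :: (real ^ 'n) set) / (2 * pi) ^ CARD('n) + 1)"
  have g_le: "\<bar>g N x\<bar> \<le> C" for N x
  proof -
    have "\<bar>g N x\<bar> = block_scale N * \<bar>product_block N x\<bar>" by (simp add: g_def abs_mult block_scale_nonneg)
    also have "\<dots> \<le> block_scale N * 1" by (intro mult_left_mono abs_product_block_le block_scale_nonneg)
    also have "\<dots> \<le> C" using block_scale_bounded by (simp add: C_def)
    finally show ?thesis .
  qed
  have bc_g: "bounded_continuous (g N)" for N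
  proof -
    have "continuous_on UNIV (g N)" unfolding g_def by (intro continuous_intros)
    then show ?thesis using g_le unfolding bounded_continuous_def by blast
  qed
  have bc_0: "bounded_continuous (\<lambda>_ :: real ^ 'n. 0 :: real)"
    unfolding bounded_continuous_def by (auto intro: exI[of _ 0])
  have cubic_sum_le: "norm (cubic_sum N h) \<le> A N * B"
    if "bounded_continuous h" "\<And>x. \<bar>h x\<bar> \<le> B" for N B and h :: "real ^ 'n \<Rightarrow> real"
  proof -
    have "0 \<le> B" by (rule order_trans[OF abs_ge_zero that(2)])
    then show ?thesis using cubic_sum_bound[OF that, of N] unfolding A_def distrib_right by linarith
  qed
  have A_ge: "A N \<ge> 1" for N unfolding A_def by simp
  have unbounded: "\<exists>N. K \<le> norm (cubic_sum N (g N))" for K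
    unfolding g_def by (rule scaled_block_unbounded[OF p])
  have "\<exists>\<alpha> n. (\<forall>k. \<bar>\<alpha> k\<bar> \<le> (1 / 2) ^ k) \<and> bounded_continuous (\<lambda>x. \<Sum>k. \<alpha> k * g (n k) x) \<and>
      (\<forall>K. \<exists>m. K \<le> norm (cubic_sum m (\<lambda>x. \<Sum>k. \<alpha> k * g (n k) x)))"
  proof (rule gliding_hump[where A=A and C=C])
    fix u :: "nat \<Rightarrow> real ^ 'n \<Rightarrow> real"
    assume u: "\<And>k. bounded_continuous (u k)" "\<And>k x. \<bar>u k x\<bar> \<le> C * (1 / 2) ^ k"
    show "bounded_continuous (\<lambda>x. \<Sum>k. u k x)" by (rule bounded_continuous_series[OF u])
  qed (rule cubic_sum_comb cubic_sum_le A_ge bc_g bc_0 g_le bounded_continuous_comb unbounded; assumption)+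
  then obtain \<alpha> n where \<alpha>: "\<And>k. \<bar>\<alpha> k\<bar> \<le> (1 / 2) ^ k"
    and bc_F: "bounded_continuous (\<lambda>x. \<Sum>k. \<alpha> k * g (n k) x)"
    and div: "\<And>K. \<exists>m. K \<le> norm (cubic_sum m (\<lambda>x. \<Sum>k. \<alpha> k * g (n k) x))"
    by blast
  define F where "F = (\<lambda>x. \<Sum>k. \<alpha> k * g (n k) x)"
  define f where "f = (\<lambda>x. complex_of_real (F x))"
  have geom: "summable (\<lambda>k. (1 / 2 :: real) ^ k)" by (intro summable_geometric) simp
  have "0 \<le> C" by (rule order_trans[OF abs_ge_zero g_le])
  have summable: "summable (\<lambda>k. \<alpha> k * g (n k) x)" for x
  proof (rule summable_comparison_test'[of "\<lambda>k. (1 / 2) ^ k * C" 0])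
    show "norm (\<alpha> k * g (n k) x) \<le> (1 / 2) ^ k * C" for k
      unfolding real_norm_def abs_mult by (intro mult_mono \<alpha> g_le) simp_all
  qed (intro summable_mult2 geom)
  have "continuous_on UNIV f"
    using bc_F unfolding f_def F_def bounded_continuous_def by (intro continuous_on_of_real) simp
  moreover have "range f \<subseteq> \<real>" by (auto simp: f_def)
  moreover have "(SUP N. ereal (norm (fourier_partial_sum (\<lambda>_. N) f 0))) = \<infinity>"
  proof (rule SUP_PInfty)
    show "\<exists>m\<in>UNIV. ereal (real k) \<le> ereal (norm (fourier_partial_sum (\<lambda>_. m) f 0))" for k
      using div[of "real k"] unfolding cubic_sum_def f_def F_def by simp
  qed
  moreover have "torus_periodic f"
    by (simp add: torus_periodic_def f_def F_def g_def product_block_periodic)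
  moreover have "sharp_variation (\<lambda>n. real n * \<xi> n / ln (real n + 1) ^ p) f < \<infinity>"
  proof (rule scaled_block_variation[where 'n='n])
    fix V assume V: "0 \<le> V" "\<And>N m a b s (y :: nat \<Rightarrow> real ^ 'n).
      (\<And>i. i \<in> {1..m} \<Longrightarrow> 0 \<le> a i \<and> a i < b i \<and> b i < 2 * pi) \<Longrightarrow>
      disjoint_family_on (\<lambda>i. {a i<..<b i}) {1..m} \<Longrightarrow>
      (\<Sum>i=1..m. log_weight p i / \<xi> i * (block_scale N *
        \<bar>product_block N (\<chi> j. if j = s then b i else y i $ j) - product_block N (\<chi> j. if j = s then a i else y i $ j)\<bar>)) \<le> V"
    show ?thesis
    proof (rule sharp_variation_finiteI)
      show "0 \<le> real i * \<xi> i / ln (real i + 1) ^ p" if "1 \<le> i" for i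
        using \<xi>_pos[OF that] by simp
      fix m s and a b :: "nat \<Rightarrow> real" and y :: "nat \<Rightarrow> real ^ 'n"
      assume ab: "\<And>i. i \<in> {1..m} \<Longrightarrow> 0 \<le> a i \<and> a i < b i \<and> b i < 2 * pi"
        and disj: "disjoint_family_on (\<lambda>i. {a i<..<b i}) {1..m}"
      let ?xb = "\<lambda>i :: nat. \<chi> j. if j = s then b i else y i $ j"
      let ?xa = "\<lambda>i :: nat. \<chi> j. if j = s then a i else y i $ j"
      define w where "w = (\<lambda>i :: nat. log_weight p i / \<xi> i)"
      define I where "I = (\<lambda>(k :: nat) (i :: nat). \<bar>g (n k) (?xb i) - g (n k) (?xa i)\<bar>)"
      have w: "0 \<le> w i" if "i \<in> {1..m}" for i
        using \<xi>_pos[of i] that by (simp add: w_def log_weight_nonneg)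
      have I_le: "I k i \<le> 2 * C" for k i
        using g_le[of "n k" "?xb i"] g_le[of "n k" "?xa i"] unfolding I_def by linarith
      have summable_I: "summable (\<lambda>k. (1 / 2) ^ k * I k i)" for i
      proof (rule summable_comparison_test'[of "\<lambda>k. (1 / 2) ^ k * (2 * C)" 0])
        show "norm ((1 / 2) ^ k * I k i) \<le> (1 / 2) ^ k * (2 * C)" for k
          using I_le[of k i] by (simp add: abs_mult I_def)
      qed (intro summable_mult2 geom)
      have inc: "norm (coord_increment f s (a i) (b i) (y i)) \<le> (\<Sum>k. (1 / 2) ^ k * I k i)" for i
      proof -
        have "coord_increment f s (a i) (b i) (y i) = of_real (F (?xb i) - F (?xa i))"
          by (simp add: coord_increment_def f_def)
        also have "F (?xb i) - F (?xa i) = (\<Sum>k. \<alpha> k * g (n k) (?xb i) - \<alpha> k * g (n k) (?xa i))"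
          unfolding F_def by (rule suminf_diff[OF summable summable])
        finally have "norm (coord_increment f s (a i) (b i) (y i)) =
            norm (\<Sum>k. \<alpha> k * g (n k) (?xb i) - \<alpha> k * g (n k) (?xa i))" by (simp only: norm_of_real real_norm_def)
        also have "\<dots> \<le> (\<Sum>k. (1 / 2) ^ k * I k i)"
        proof (rule norm_suminf_le[OF _ summable_I])
          show "norm (\<alpha> k * g (n k) (?xb i) - \<alpha> k * g (n k) (?xa i)) \<le> (1 / 2) ^ k * I k i" for k
            unfolding right_diff_distrib[symmetric] I_def real_norm_def abs_mult
            by (intro mult_right_mono \<alpha> abs_ge_zero)
        qed
        finally show ?thesis .
      qed
      have "(\<Sum>i=1..m. norm (coord_increment f s (a i) (b i) (y i)) / (real i * \<xi> i / ln (real i + 1) ^ p)) =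
          (\<Sum>i=1..m. w i * norm (coord_increment f s (a i) (b i) (y i)))"
        by (intro sum.cong) (simp_all add: w_def log_weight_def)
      also have "\<dots> \<le> (\<Sum>i=1..m. w i * (\<Sum>k. (1 / 2) ^ k * I k i))"
        by (intro sum_mono mult_left_mono inc w)
      also have "\<dots> = (\<Sum>i=1..m. \<Sum>k. w i * ((1 / 2) ^ k * I k i))"
        by (intro sum.cong HOL.refl suminf_mult[symmetric] summable_I)
      also have "\<dots> = (\<Sum>k. \<Sum>i=1..m. w i * ((1 / 2) ^ k * I k i))"
        by (intro suminf_sum[symmetric] summable_mult summable_I)
      also have "\<dots> \<le> (\<Sum>k. (1 / 2) ^ k * V)"
      proof (rule suminf_le)
        fix k
        have "(\<Sum>i=1..m. w i * ((1 / 2) ^ k * I k i)) = (1 / 2) ^ k * (\<Sum>i=1..m. w i * I k i)"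
          by (simp add: sum_distrib_left mult.left_commute)
        also have "(\<Sum>i=1..m. w i * I k i) \<le> V"
          using V(2)[OF ab disj, of "n k" s y]
          by (simp add: w_def I_def g_def right_diff_distrib[symmetric] abs_mult block_scale_nonneg)
        finally show "(\<Sum>i=1..m. w i * ((1 / 2) ^ k * I k i)) \<le> (1 / 2) ^ k * V"
          by simp
        show "summable (\<lambda>k. \<Sum>i=1..m. w i * ((1 / 2) ^ k * I k i))"
          by (intro summable_sum summable_mult summable_I)
        show "summable (\<lambda>k. (1 / 2) ^ k * V)" by (rule summable_mult2[OF geom])
      qed
      finally show "(\<Sum>i=1..m. norm (coord_increment f s (a i) (b i) (y i)) / (real i * \<xi> i / ln (real i + 1) ^ p)) \<le>
          (\<Sum>k. (1 / 2) ^ k * V)" .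
    qed
  qed
  ultimately show ?thesis unfolding sharp_BV_def by (intro exI[of _ f] conjI CollectI)
qed

end

theorem theorem4:
  assumes "CARD('n::finite) > 1"
  shows "class_of_convergence
           (sharp_BV (\<lambda>n. real n / ln (real n + 1) ^ (CARD('n) - 1)) :: (real ^ 'n \<Rightarrow> complex) set)
       \<and> (\<forall>\<xi> :: nat \<Rightarrow> real.
            (\<forall>n\<ge>1. \<xi> n > 0) \<and> filterlim \<xi> at_top sequentially \<longrightarrow>
            (\<exists>f :: real ^ 'n \<Rightarrow> complex.
               f \<in> sharp_BV (\<lambda>n. real n * \<xi> n / ln (real n + 1) ^ (CARD('n) - 1)) \<and>
               range f \<subseteq> \<real> \<and>
               continuous_on UNIV f \<and>
               (SUP N. ereal (norm (fourier_partial_sum (\<lambda>_. N) f 0))) = \<infinity>))"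
proof (intro conjI allI impI)
  fix \<xi> :: "nat \<Rightarrow> real"
  assume \<xi>: "(\<forall>n\<ge>1. \<xi> n > 0) \<and> filterlim \<xi> at_top sequentially"
  interpret divergent_weights "CARD('n) - 1" \<xi>
    using assms \<xi> by unfold_locales auto
  show "\<exists>f :: real ^ 'n \<Rightarrow> complex.
      f \<in> sharp_BV (\<lambda>n. real n * \<xi> n / ln (real n + 1) ^ (CARD('n) - 1)) \<and>
      range f \<subseteq> \<real> \<and> continuous_on UNIV f \<and>
      (SUP N. ereal (norm (fourier_partial_sum (\<lambda>_. N) f 0))) = \<infinity>"
    by (rule exists_divergent_cubic_sums[OF HOL.refl])
qed (rule sharp_BV_class_of_convergence)

end
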